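(* Let $n\ge1$ and let $\mathcal{K}(A,B)$ be an $n$-mode Gaussian channel, with parameters $A,B$ real $2n\times2n$ matrices, $B$ positive semidefinite, $B+i(A^TJ_{2n}A-J_{2n})\ge0$. For $1\le j\le n$ consider the $2n$ coherent input states $\rho_j=\rho_g(\mathbf{e}_j,\mathbf{0};\frac12I_{2n})$ and $\rho_j'=\rho_g(\mathbf{0},\mathbf{e}_j;\frac12I_{2n})$. Then $A$ and $B$ are determined by the following $6n^2+3n-1$ expectation values of observables in output states of the channel: (1) the expectation values, in the output state corresponding to the input $\rho_1$, of the $n(2n+3)$ observables in the lists (a), (b), (c) of the context; (2) the expectation values, in each of the $2n-1$ output states corresponding to the inputs $\rho_2,\dots,\rho_n,\rho_1',\dots,\rho_n'$, of the $2n+1$ observables in list (a) of the context. That is, if $\mathcal{K}(A,B)$ and $\mathcal{K}(\tilde A,\tilde B)$ are two $n$-mode Gaussian channels for which all these expectation values coincide, then $A=\tilde A$ and $B=\tilde B$.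
   Context: $\Gamma(\mathbb{C}^n)=\bigoplus_{r\ge0}(\mathbb{C}^n)^{\circledS r}$ is the boson (symmetric) Fock space over $\mathbb{C}^n$ (inner products are linear in the second variable). For $\mathbf{u}\in\mathbb{C}^n$ the exponential vector is $\mathbf{e}(\mathbf{u})=\bigoplus_{r\ge0}\mathbf{u}^{\otimes r}/\sqrt{r!}$. The Weyl operator $W(\mathbf{u})$ is the unitary operator on $\Gamma(\mathbb{C}^n)$ determined by $W(\mathbf{u})\mathbf{e}(\mathbf{v})=e^{-\frac12\|\mathbf{u}\|^2-\langle\mathbf{u}|\mathbf{v}\rangle}\mathbf{e}(\mathbf{u}+\mathbf{v})$ for all $\mathbf{v}\in\mathbb{C}^n$. A state is a positive operator of trace one. The $n$-mode Gaussian state $\rho_g(\mathbf{l},\mathbf{m};S)$, with $\mathbf{l},\mathbf{m}\in\mathbb{R}^n$ and $S$ a real symmetric $2n\times2n$ matrix satisfying $2S+iJ_{2n}\ge0$, $J_{2n}=\begin{bmatrix} 0 & -I_n \\ I_n & 0 \end{bmatrix}$, is the unique state $\rho$ with $$\mathrm{Tr}\,\rho W(\mathbf{x}+i\mathbf{y})=\exp\left[-i\sqrt2(\mathbf{l}^T\mathbf{x}-\mathbf{m}^T\mathbf{y})-\begin{pmatrix}\mathbf{x}\\ \mathbf{y}\end{pmatrix}^TS\begin{pmatrix}\mathbf{x}\\ \mathbf{y}\end{pmatrix}\right],\quad\mathbf{x},\mathbf{y}\in\mathbb{R}^n.$$ Gaussian channel: $\mathcal{K}(A,B)$ sends the Gaussian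 state $\rho_g(\mathbf{l},\mathbf{m};S)$ to the Gaussian state $\rho_g(\mathbf{l}',\mathbf{m}';S')$ with $$\begin{pmatrix}\mathbf{l}'\\ -\mathbf{m}'\end{pmatrix}=A^T\begin{pmatrix}\mathbf{l}\\ -\mathbf{m}\end{pmatrix},\qquad S'=A^TSA+\tfrac12B.$$ The coherent states with amplitude $\mathbf{u}=\mathbf{x}+i\mathbf{y}$ are $\rho_g(\sqrt2\mathbf{y},\sqrt2\mathbf{x};\frac12I_{2n})$; thus $\rho_j$ has $\mathbf{u}=2^{-1/2}i\mathbf{e}_j$ and $\rho_j'$ has $\mathbf{u}=2^{-1/2}\mathbf{e}_j$, with $\mathbf{e}_j$ the standard basis vectors of $\mathbb{C}^n$. The total number operator $N$ is the self-adjoint operator acting as multiplication by $r$ on the $r$-particle subspace $(\mathbb{C}^n)^{\circledS r}$, $r=0,1,2,\dots$. For a unitary $V$, the expectation value of $V^\dagger NV$ in a state $\rho$ is $\sum_{k\ge0}k\,\mathrm{Tr}(\rho V^\dagger P_kV)$ with $P_k$ the projection onto the $k$-particle subspace. $Sp(2n)$ is the group of real $2n\times2n$ matrices $L$ with $L^TJ_{2n}L=J_{2n}$. For $L\in Sp(2n)$, $\Gamma(L)$ is the unitary operator on $\Gamma(\mathbb{C}^n)$, unique up to a scalar of modulus one, with $\Gamma(L)W(\mathbf{x}+i\mathbf{y})\Gamma(L)^{-1}=W(\mathbf{x}'+i\mathbf{y}')$ for all $\mathbf{x},\mathbf{y}\in\mathbb{R}^n$, where $\begin{pmatrix}\mathbf{x}'\\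 \mathbf{y}'\end{pmatrix}=L\begin{pmatrix}\mathbf{x}\\ \mathbf{y}\end{pmatrix}$. Put $\tau(L)=(L^{-1})^T$. Displacement gates: $G_p^{(j)}=W(2^{-1/2}\,i\,\mathbf{e}_j)$, $G_q^{(j)}=W(2^{-1/2}\,\mathbf{e}_j)$. One-mode symplectic gates: with $$L(x,\alpha)=R\begin{bmatrix}x&0\\ 0&x^{-1}\end{bmatrix}R^T,\quad R=\begin{bmatrix}\cos\alpha&-\sin\alpha\\ \sin\alpha&\cos\alpha\end{bmatrix},$$ $G_{sp}^{(j)}(x,\alpha)$ is $\Gamma(M)$, where $M\in Sp(2n)$ acts on the coordinates $(x_j,y_j)^T$ of $(\mathbf{x},\mathbf{y})$ by the matrix $\tau(L(x,\alpha))$ and fixes all other coordinates. Two-mode symplectic gates: for a $2\times2$ matrix $U=\begin{pmatrix}\alpha&\beta\\ -\bar\beta&\bar\alpha\end{pmatrix}$, $\alpha=\alpha_1+i\alpha_2$, $\beta=\beta_1+i\beta_2$, $|\alpha|^2+|\beta|^2=1$, let $$\mathcal{O}=\begin{bmatrix}\alpha_1&-\alpha_2&\beta_1&-\beta_2\\ \alpha_2&\alpha_1&\beta_2&\beta_1\\ -\beta_1&-\beta_2&\alpha_1&\alpha_2\\ \beta_2&-\beta_1&-\alpha_2&\alpha_1\end{bmatrix},\qquad L(U,x_1,x_2)=\mathcal{O}\,\mathrm{diag}(x_1,x_1^{-1},x_2,x_2^{-1})\,\mathcal{O}^T .$$ For $i<j$, $G_{sp}^{(i,j)}(U,x_1,x_2)$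 is $\Gamma(M)$, where $M\in Sp(2n)$ acts on the coordinates $(x_i,y_i,x_j,y_j)^T$ of $(\mathbf{x},\mathbf{y})$ by the matrix $\tau(L(U,x_1,x_2))$ and fixes all other coordinates. Lists of observables. (a) $N$, and $(G_p^{(j)})^\dagger NG_p^{(j)}$, $(G_q^{(j)})^\dagger NG_q^{(j)}$ for $1\le j\le n$. (b) $G_{sp}^{(j)}(x,\alpha)^\dagger N\,G_{sp}^{(j)}(x,\alpha)$ for $(x,\alpha)\in\{(\sqrt2,0),(\sqrt3,0),(\sqrt2,\pi/4)\}$ and $1\le j\le n-1$, and for $(x,\alpha)\in\{(\sqrt2,0),(\sqrt2,\pi/4)\}$ and $j=n$. (c) $G_{sp}^{(i,j)}(U,x_1,x_2)^\dagger N\,G_{sp}^{(i,j)}(U,x_1,x_2)$ for $1\le i<j\le n$ and $(U,x_1,x_2)\in\{(H,1,2),(H,1,3),(K,1,2),(K,1,3)\}$, where $H=\frac1{\sqrt2}\begin{bmatrix}1&1\\ -1&1\end{bmatrix}$, $K=\frac1{\sqrt2}\begin{bmatrix}i&1\\ -1&-i\end{bmatrix}$. *)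

theory Defs
  imports "HOL-Analysis.Analysis" "HOL-Combinatorics.Multiset_Permutations"
begin

section \<open>The symmetric Fock space\<close>

text \<open>
  The modes are the elements of a finite type \<open>'n\<close>, so $\mathbb{C}^n$ is \<open>complex ^ 'n\<close>.
  A tensor in $(\mathbb{C}^n)^{\otimes r}$ is identified with its coordinates in the basis
  $e_{x_1}\otimes\dots\otimes e_{x_r}$, that is, with a function on the words of length \<open>r\<close>
  over \<open>'n\<close>; it is symmetric iff its coordinates are invariant under permuting the word.
  A vector of the Fock space is then a symmetric square-summable function on all words, and its
  \<open>r\<close>-particle component is the restriction to the words of length \<open>r\<close>.
\<close>

definition fock_vectors :: "('n::finite list \<Rightarrow> complex) set" where
  "fock_vectors = {\<psi>. (\<forall>xs ys. mset xs = mset ys \<longrightarrow> \<psi> xs = \<psi> ys) \<and>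
                       (\<lambda>xs. (cmod (\<psi> xs))\<^sup>2) summable_on UNIV}"

typedef (overloaded) ('n::finite) fock = "fock_vectors :: ('n list \<Rightarrow> complex) set"
  morphisms coord Abs_fock
proof
  show "(\<lambda>_. 0) \<in> fock_vectors" by (simp add: fock_vectors_def)
qed

setup_lifting type_definition_fock

lemma coord_mset: "mset xs = mset ys \<Longrightarrow> coord \<psi> xs = coord \<psi> ys"
  using coord[of \<psi>] unfolding fock_vectors_def by blast

lemma coord_square_summable: "(\<lambda>xs. (cmod (coord \<psi> xs))\<^sup>2) summable_on UNIV"
  using coord[of \<psi>] unfolding fock_vectors_def by blast

lemma fock_eqI: "(\<And>xs. coord \<psi> xs = coord \<phi> xs) \<Longrightarrow> \<psi> = \<phi>"
  by (metis coord_inject ext)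

lemma square_summable_add:
  fixes f g :: "'a \<Rightarrow> complex"
  assumes "(\<lambda>x. (cmod (f x))\<^sup>2) summable_on A" "(\<lambda>x. (cmod (g x))\<^sup>2) summable_on A"
  shows "(\<lambda>x. (cmod (f x + g x))\<^sup>2) summable_on A"
proof (rule summable_on_comparison_test)
  show "(\<lambda>x. 2 * (cmod (f x))\<^sup>2 + 2 * (cmod (g x))\<^sup>2) summable_on A"
    using assms by (intro summable_on_add summable_on_cmult_right)
next
  fix x
  have "(cmod (f x + g x))\<^sup>2 \<le> (cmod (f x) + cmod (g x))\<^sup>2"
    by (intro power_mono norm_triangle_ineq norm_ge_zero)
  also have "\<dots> \<le> 2 * (cmod (f x))\<^sup>2 + 2 * (cmod (g x))\<^sup>2"
    using sum_squares_bound[of "cmod (f x)" "cmod (g x)"] by (simp add: power2_sum)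
  finally show "(cmod (f x + g x))\<^sup>2 \<le> 2 * (cmod (f x))\<^sup>2 + 2 * (cmod (g x))\<^sup>2" .
qed simp

lemma square_summable_cmult:
  fixes f :: "'a \<Rightarrow> complex"
  assumes "(\<lambda>x. (cmod (f x))\<^sup>2) summable_on A"
  shows "(\<lambda>x. (cmod (c * f x))\<^sup>2) summable_on A"
  using assms by (simp add: norm_mult power_mult_distrib summable_on_cmult_right)

lemma summable_coord_mult: "(\<lambda>xs. cnj (coord \<psi> xs) * coord \<phi> xs) summable_on UNIV"
proof (rule abs_summable_summable, rule Infinite_Sum.abs_summable_on_comparison_test')
  show "(\<lambda>xs. (cmod (coord \<psi> xs))\<^sup>2 + (cmod (coord \<phi> xs))\<^sup>2) summable_on UNIV"
    by (intro summable_on_add coord_square_summable)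
  show "cmod (cnj (coord \<psi> xs) * coord \<phi> xs) \<le> (cmod (coord \<psi> xs))\<^sup>2 + (cmod (coord \<phi> xs))\<^sup>2" for xs
  proof -
    have "0 \<le> cmod (coord \<psi> xs) * cmod (coord \<phi> xs)" by simp
    then show ?thesis
      using sum_squares_bound[of "cmod (coord \<psi> xs)" "cmod (coord \<phi> xs)"]
      unfolding norm_mult complex_mod_cnj by linarith
  qed
qed

lift_definition scaleC :: "complex \<Rightarrow> 'n::finite fock \<Rightarrow> 'n fock" (infixr \<open>*\<^sub>C\<close> 75)
  is "\<lambda>c \<psi> xs. c * \<psi> xs"
proof -
  fix c :: complex and \<psi> :: "'n list \<Rightarrow> complex"
  assume "\<psi> \<in> fock_vectors"
  then show "(\<lambda>xs. c * \<psi> xs) \<in> fock_vectors"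
    unfolding fock_vectors_def mem_Collect_eq
    by (intro conjI allI impI square_summable_cmult arg_cong2[where f = "(*)"]) blast+
qed

definition cinner :: "'n::finite fock \<Rightarrow> 'n fock \<Rightarrow> complex" where
  "cinner \<psi> \<phi> = (\<Sum>\<^sub>\<infinity>xs. cnj (coord \<psi> xs) * coord \<phi> xs)"

instantiation fock :: (finite) real_inner
begin

lift_definition zero_fock :: "'a fock" is "\<lambda>_. 0"
  by (simp add: fock_vectors_def)

lift_definition plus_fock :: "'a fock \<Rightarrow> 'a fock \<Rightarrow> 'a fock" is "\<lambda>\<psi> \<phi> xs. \<psi> xs + \<phi> xs"
proof -
  fix \<psi> \<phi> :: "'a list \<Rightarrow> complex"
  assume "\<psi> \<in> fock_vectors" "\<phi> \<in> fock_vectors"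
  then show "(\<lambda>xs. \<psi> xs + \<phi> xs) \<in> fock_vectors"
    unfolding fock_vectors_def mem_Collect_eq
    by (intro conjI allI impI square_summable_add arg_cong2[where f = "(+)"]) blast+
qed

lift_definition uminus_fock :: "'a fock \<Rightarrow> 'a fock" is "\<lambda>\<psi> xs. - \<psi> xs"
  unfolding fock_vectors_def mem_Collect_eq norm_minus_cancel
  by (intro conjI allI impI arg_cong[where f = uminus]) blast+

definition minus_fock :: "'a fock \<Rightarrow> 'a fock \<Rightarrow> 'a fock" where
  "minus_fock \<psi> \<phi> = \<psi> + - \<phi>"

definition scaleR_fock :: "real \<Rightarrow> 'a fock \<Rightarrow> 'a fock" where
  "scaleR_fock r \<psi> = complex_of_real r *\<^sub>C \<psi>"

definition inner_fock :: "'a fock \<Rightarrow> 'a fock \<Rightarrow> real" where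
  "inner_fock \<psi> \<phi> = Re (cinner \<psi> \<phi>)"

definition norm_fock :: "'a fock \<Rightarrow> real" where
  "norm_fock \<psi> = sqrt (inner \<psi> \<psi>)"

definition sgn_fock :: "'a fock \<Rightarrow> 'a fock" where
  "sgn_fock \<psi> = inverse (norm \<psi>) *\<^sub>R \<psi>"

definition dist_fock :: "'a fock \<Rightarrow> 'a fock \<Rightarrow> real" where
  "dist_fock \<psi> \<phi> = norm (\<psi> - \<phi>)"

definition uniformity_fock :: "('a fock \<times> 'a fock) filter" where
  "uniformity_fock = (INF e\<in>{0<..}. principal {(\<psi>, \<phi>). dist \<psi> \<phi> < e})"

definition open_fock :: "'a fock set \<Rightarrow> bool" where
  "open_fock U \<longleftrightarrow> (\<forall>\<psi>\<in>U. \<forall>\<^sub>F (\<psi>', \<phi>) in uniformity. \<psi>' = \<psi> \<longrightarrow> \<phi> \<in> U)"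

instance
proof
  fix \<psi> \<phi> \<eta> :: "'a fock" and a b :: real
  show "\<psi> + \<phi> + \<eta> = \<psi> + (\<phi> + \<eta>)" by transfer (simp add: add.assoc)
  show "\<psi> + \<phi> = \<phi> + \<psi>" by transfer (simp add: add.commute)
  show "0 + \<psi> = \<psi>" by transfer simp
  show "- \<psi> + \<psi> = 0" by transfer simp
  show "\<psi> - \<phi> = \<psi> + - \<phi>" by (fact minus_fock_def)
  show "a *\<^sub>R (\<psi> + \<phi>) = a *\<^sub>R \<psi> + a *\<^sub>R \<phi>"
    unfolding scaleR_fock_def by transfer (simp add: distrib_left)
  show "(a + b) *\<^sub>R \<psi> = a *\<^sub>R \<psi> + b *\<^sub>R \<psi>"
    unfolding scaleR_fock_def by transfer (simp add: distrib_right)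
  show "a *\<^sub>R b *\<^sub>R \<psi> = (a * b) *\<^sub>R \<psi>"
    unfolding scaleR_fock_def by transfer (simp add: mult.assoc)
  show "1 *\<^sub>R \<psi> = \<psi>"
    unfolding scaleR_fock_def by transfer simp
  show "sgn \<psi> = inverse (norm \<psi>) *\<^sub>R \<psi>" by (fact sgn_fock_def)
  show "dist \<psi> \<phi> = norm (\<psi> - \<phi>)" by (fact dist_fock_def)
  show "uniformity = (INF e\<in>{0<..}. principal {(\<psi> :: 'a fock, \<phi>). dist \<psi> \<phi> < e})"
    by (fact uniformity_fock_def)
  show "open U \<longleftrightarrow> (\<forall>\<psi>\<in>U. \<forall>\<^sub>F (\<psi>', \<phi>) in uniformity. \<psi>' = \<psi> \<longrightarrow> \<phi> \<in> U)"
    for U :: "'a fock set" by (fact open_fock_def)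
  have "cinner \<phi> \<psi> = cnj (cinner \<psi> \<phi>)"
    unfolding cinner_def infsum_cnj[symmetric] by (simp add: mult.commute)
  then show "inner \<psi> \<phi> = inner \<phi> \<psi>" by (simp add: inner_fock_def)
  have "cinner (\<psi> + \<phi>) \<eta> = cinner \<psi> \<eta> + cinner \<phi> \<eta>"
    unfolding cinner_def
    by (simp add: plus_fock.rep_eq distrib_right infsum_add summable_coord_mult)
  then show "inner (\<psi> + \<phi>) \<eta> = inner \<psi> \<eta> + inner \<phi> \<eta>" by (simp add: inner_fock_def)
  have "cinner (a *\<^sub>R \<psi>) \<phi> = a * cinner \<psi> \<phi>"
    unfolding cinner_def
    by (simp add: scaleR_fock_def scaleC.rep_eq mult.assoc infsum_cmult_right')
  then show "inner (a *\<^sub>R \<psi>) \<phi> = a * inner \<psi> \<phi>" by (simp add: inner_fock_def)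
  have *: "inner \<psi> \<psi> = (\<Sum>\<^sub>\<infinity>xs. (cmod (coord \<psi> xs))\<^sup>2)"
    unfolding inner_fock_def cinner_def infsum_Re[OF summable_coord_mult, symmetric]
    by (rule infsum_cong) (simp add: cmod_power2 flip: power2_eq_square)
  then show "0 \<le> inner \<psi> \<psi>" by (simp add: infsum_nonneg)
  show "inner \<psi> \<psi> = 0 \<longleftrightarrow> \<psi> = 0"
  proof
    assume "inner \<psi> \<psi> = 0"
    then have "(cmod (coord \<psi> xs))\<^sup>2 = 0" for xs
      using nonneg_infsum_le_0D[OF _ coord_square_summable[of \<psi>], of xs] * by simp
    then show "\<psi> = 0" by (intro fock_eqI) (simp add: zero_fock.rep_eq)
  next
    assume "\<psi> = 0"
    then show "inner \<psi> \<psi> = 0" unfolding * by (simp add: zero_fock.rep_eq)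
  qed
  show "norm \<psi> = sqrt (inner \<psi> \<psi>)" by (fact norm_fock_def)
qed

end

text \<open>The projection onto the \<open>k\<close>-particle subspace.\<close>

lift_definition number_proj :: "nat \<Rightarrow> 'n::finite fock \<Rightarrow> 'n fock"
  is "\<lambda>k \<psi> xs. if length xs = k then \<psi> xs else 0"
proof -
  fix k :: nat and \<psi> :: "'n list \<Rightarrow> complex"
  assume \<psi>: "\<psi> \<in> fock_vectors"
  have "(\<lambda>xs. (cmod (if length xs = k then \<psi> xs else 0))\<^sup>2) summable_on UNIV"
  proof (rule summable_on_comparison_test)
    show "(\<lambda>xs. (cmod (\<psi> xs))\<^sup>2) summable_on UNIV"
      using \<psi> unfolding fock_vectors_def by blast
  qed auto
  moreover have "(if length xs = k then \<psi> xs else 0) = (if length ys = k then \<psi> ys else 0)"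
    if "mset xs = mset ys" for xs ys
  proof -
    have "\<psi> xs = \<psi> ys" using \<psi> that unfolding fock_vectors_def by blast
    then show ?thesis using mset_eq_length[OF that] by simp
  qed
  ultimately show "(\<lambda>xs. if length xs = k then \<psi> xs else 0) \<in> fock_vectors"
    unfolding fock_vectors_def by blast
qed

lemma sum_prod_list_words:
  fixes f :: "'n::finite \<Rightarrow> real"
  shows "(\<Sum>xs | length xs = r. \<Prod>x\<leftarrow>xs. f x) = (\<Sum>x\<in>UNIV. f x) ^ r"
proof (induction r)
  case (Suc r)
  have eq: "{xs :: 'n list. length xs = Suc r} = (\<lambda>(x, xs). x # xs) ` (UNIV \<times> {xs. length xs = r})"
    by (auto simp: length_Suc_conv image_iff)
  have "(\<Sum>xs | length xs = Suc r. \<Prod>x\<leftarrow>xs. f x) =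
        (\<Sum>(x, xs)\<in>UNIV \<times> {xs. length xs = r}. f x * (\<Prod>x\<leftarrow>xs. f x))"
    unfolding eq by (subst sum.reindex) (auto simp: inj_on_def case_prod_unfold)
  also have "\<dots> = (\<Sum>x\<in>UNIV. f x) * (\<Sum>xs | length xs = r. \<Prod>x\<leftarrow>xs. f x)"
    by (simp add: sum_product sum.cartesian_product)
  finally show ?case by (simp add: Suc.IH)
qed simp

lemma cmod_prod_list: "(cmod (\<Prod>x\<leftarrow>xs. f x))\<^sup>2 = (\<Prod>x\<leftarrow>xs. (cmod (f x))\<^sup>2)"
  by (induction xs) (auto simp: norm_mult power_mult_distrib)

text \<open>
  The coordinates of $\mathbf{u}^{\otimes r}$ are the products
  $u_{x_1}\cdots u_{x_r}$.
\<close>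

lift_definition exp_vec :: "complex ^ 'n \<Rightarrow> 'n::finite fock"
  is "\<lambda>u xs. (\<Prod>x\<leftarrow>xs. u $ x) / complex_of_real (sqrt (fact (length xs)))"
proof -
  fix u :: "complex ^ 'n"
  let ?g = "\<lambda>xs :: 'n list. (\<Prod>x\<leftarrow>xs. (cmod (u $ x))\<^sup>2) / fact (length xs)"
  let ?s = "\<Sum>x\<in>UNIV. (cmod (u $ x))\<^sup>2"
  have g_nonneg: "0 \<le> ?g xs" for xs
    by (auto intro!: divide_nonneg_pos prod_list_nonneg)
  have g_summable: "?g summable_on UNIV"
  proof (rule nonneg_bdd_above_summable_on)
    show "bdd_above (sum ?g ` {F. F \<subseteq> UNIV \<and> finite F})"
    proof (rule bdd_aboveI2)
      fix F :: "'n list set" assume "F \<in> {F. F \<subseteq> UNIV \<and> finite F}"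
      then have F: "finite F" by simp
      define R where "R = Max (insert 0 (length ` F))"
      have fin: "finite {xs :: 'n list. length xs = r}" for r
        using finite_lists_length_eq[of "UNIV :: 'n set" r] by simp
      have sub: "F \<subseteq> (\<Union>r\<le>R. {xs. length xs = r})"
        unfolding R_def using F by auto
      have "sum ?g F \<le> sum ?g (\<Union>r\<le>R. {xs. length xs = r})"
        by (rule sum_mono2[OF _ sub]) (use fin g_nonneg in auto)
      also have "\<dots> = (\<Sum>r\<le>R. sum ?g {xs. length xs = r})"
        by (rule sum.UNION_disjoint) (use fin in auto)
      also have "\<dots> = (\<Sum>r\<le>R. ?s ^ r / fact r)"
      proof (rule sum.cong)
        fix r
        have "sum ?g {xs. length xs = r} = (\<Sum>xs | length xs = r. (\<Prod>x\<leftarrow>xs. (cmod (u $ x))\<^sup>2) / fact r)"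
          by (rule sum.cong) auto
        then show "sum ?g {xs. length xs = r} = ?s ^ r / fact r"
          by (simp add: sum_prod_list_words flip: sum_divide_distrib)
      qed simp
      also have "\<dots> \<le> exp ?s"
      proof -
        have *: "(\<lambda>r. ?s ^ r / fact r) sums exp ?s"
          using exp_converges[of ?s] by (simp add: divide_inverse mult.commute)
        have "(\<Sum>r\<le>R. ?s ^ r / fact r) \<le> (\<Sum>r. ?s ^ r / fact r)"
          by (rule sum_le_suminf[OF sums_summable[OF *]])
             (simp_all add: sum_nonneg)
        then show ?thesis using sums_unique[OF *] by simp
      qed
      finally show "sum ?g F \<le> exp ?s" .
    qed
  qed (use g_nonneg in auto)
  have "(cmod ((\<Prod>x\<leftarrow>xs. u $ x) / complex_of_real (sqrt (fact (length xs)))))\<^sup>2 = ?g xs" for xs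
  proof -
    have "(cmod (complex_of_real (sqrt (fact (length xs)))))\<^sup>2 = fact (length xs)"
      by (simp only: norm_of_real power2_abs) simp
    then show ?thesis
      by (simp only: norm_divide power_divide cmod_prod_list)
  qed
  with g_summable have
    "(\<lambda>xs. (cmod ((\<Prod>x\<leftarrow>xs. u $ x) / complex_of_real (sqrt (fact (length xs)))))\<^sup>2) summable_on UNIV"
    by (simp only:)
  moreover have "(\<Prod>x\<leftarrow>xs. u $ x) / complex_of_real (sqrt (fact (length xs))) =
       (\<Prod>x\<leftarrow>ys. u $ x) / complex_of_real (sqrt (fact (length ys)))"
    if "mset xs = mset ys" for xs ys :: "'n list"
  proof -
    have "mset (map (($) u) xs) = mset (map (($) u) ys)" using that by simp
    then have "(\<Prod>x\<leftarrow>xs. u $ x) = (\<Prod>x\<leftarrow>ys. u $ x)"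
      unfolding prod_mset_prod_list[symmetric] by (rule arg_cong)
    then show ?thesis using mset_eq_length[OF that] by simp
  qed
  ultimately show "(\<lambda>xs. (\<Prod>x\<leftarrow>xs. u $ x) / complex_of_real (sqrt (fact (length xs)))) \<in> fock_vectors"
    unfolding fock_vectors_def by blast
qed

text \<open>
  The occupation-number basis: the normalised symmetrisations of $e_{x_1}\otimes\dots\otimes e_{x_r}$,
  indexed by the multisets $\{x_1,\dots,x_r\}$.
\<close>

lift_definition number_basis :: "'n multiset \<Rightarrow> 'n::finite fock"
  is "\<lambda>M xs. if mset xs = M
             then complex_of_real (1 / sqrt (card (permutations_of_multiset M))) else 0"
proof -
  fix M :: "'n multiset"
  let ?c = "complex_of_real (1 / sqrt (card (permutations_of_multiset M)))"
  have "(\<lambda>xs. (cmod (if mset xs = M then ?c else 0))\<^sup>2) summable_on UNIV"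
  proof -
    have "(\<lambda>xs. (cmod ?c)\<^sup>2) summable_on permutations_of_multiset M"
      by (rule summable_on_finite) simp
    then show ?thesis
      by (rule summable_on_cong_neutral[THEN iffD1, rotated -1])
         (auto simp: permutations_of_multiset_def)
  qed
  then show "(\<lambda>xs. if mset xs = M then ?c else 0) \<in> fock_vectors"
    by (auto simp: fock_vectors_def)
qed

lemma cinner_number_basis:
  assumes "mset xs = M"
  shows "cinner (number_basis M) \<psi> = sqrt (card (permutations_of_multiset M)) * coord \<psi> xs"
proof -
  let ?P = "permutations_of_multiset M"
  have ne: "card ?P \<noteq> 0" using permutations_of_multiset_not_empty[of M] by (simp add: card_eq_0_iff)
  have "cinner (number_basis M) \<psi> =
        (\<Sum>\<^sub>\<infinity>ys\<in>?P. complex_of_real (1 / sqrt (card ?P)) * coord \<psi> xs)"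
    unfolding cinner_def
  proof (rule infsum_cong_neutral)
    fix ys assume "ys \<in> UNIV \<inter> ?P"
    then have "mset ys = M" by (simp add: permutations_of_multiset_def)
    then show "cnj (coord (number_basis M) ys) * coord \<psi> ys =
               complex_of_real (1 / sqrt (card ?P)) * coord \<psi> xs"
      using assms coord_mset[of ys xs \<psi>] by (simp add: number_basis.rep_eq)
  qed (auto simp: number_basis.rep_eq permutations_of_multiset_def)
  also have "\<dots> = complex_of_real (card ?P / sqrt (card ?P)) * coord \<psi> xs"
    by simp
  also have "card ?P / sqrt (card ?P) = sqrt (card ?P)"
    by (rule real_div_sqrt) simp
  finally show ?thesis .
qed

lemma number_basis_orthonormal:
  "cinner (number_basis M) (number_basis M') = (if M = M' then 1 else 0)"
proof -
  obtain xs where xs: "mset xs = M" using ex_mset by blast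
  show ?thesis
    using permutations_of_multiset_not_empty[of M]
    by (auto simp: cinner_number_basis[OF xs] number_basis.rep_eq xs card_eq_0_iff
        simp flip: of_real_mult)
qed

lemma number_basis_total:
  assumes "\<And>M. cinner (number_basis M) \<psi> = 0"
  shows "\<psi> = 0"
proof (rule fock_eqI)
  fix xs
  show "coord \<psi> xs = coord 0 xs"
    using assms[of "mset xs"] permutations_of_multiset_not_empty[of "mset xs"]
    by (simp add: cinner_number_basis[OF refl] zero_fock.rep_eq card_eq_0_iff)
qed


section \<open>Operators and states\<close>

type_synonym 'n operator = "'n fock \<Rightarrow> 'n fock"

definition bounded_op :: "'n::finite operator \<Rightarrow> bool" where
  "bounded_op T \<longleftrightarrow> bounded_linear T \<and> (\<forall>c \<psi>. T (c *\<^sub>C \<psi>) = c *\<^sub>C T \<psi>)"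

definition unitary_op :: "'n::finite operator \<Rightarrow> bool" where
  "unitary_op U \<longleftrightarrow> bounded_op U \<and> bij U \<and> (\<forall>\<psi> \<phi>. cinner (U \<psi>) (U \<phi>) = cinner \<psi> \<phi>)"

definition positive_op :: "'n::finite operator \<Rightarrow> bool" where
  "positive_op T \<longleftrightarrow> bounded_op T \<and> (\<forall>\<psi>. cinner \<psi> (T \<psi>) \<in> \<real>\<^sub>\<ge>\<^sub>0)"

definition adj_op :: "'n::finite operator \<Rightarrow> 'n operator" where
  "adj_op T = (THE T'. \<forall>\<psi> \<phi>. cinner (T' \<psi>) \<phi> = cinner \<psi> (T \<phi>))"

text \<open>
  Used only for trace-class \<open>T\<close>, for which the sum converges absolutely and has the same value in
  every orthonormal basis. For positive \<open>T\<close>, \<open>tr_op T = 1\<close> already forces \<open>T\<close> to be trace class,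
  as \<open>infsum\<close> is \<open>0\<close> for divergent sums.
\<close>

definition tr_op :: "'n::finite operator \<Rightarrow> complex" where
  "tr_op T = (\<Sum>\<^sub>\<infinity>M. cinner (number_basis M) (T (number_basis M)))"

definition state :: "'n::finite operator \<Rightarrow> bool" where
  "state \<rho> \<longleftrightarrow> positive_op \<rho> \<and> tr_op \<rho> = 1"

text \<open>The expectation value of \<open>V\<^sup>\<dagger> N V\<close> in the state \<open>\<rho>\<close>, for unitary \<open>V\<close>.\<close>

definition number_expectation :: "'n::finite operator \<Rightarrow> 'n operator \<Rightarrow> complex" where
  "number_expectation \<rho> V =
     (\<Sum>\<^sub>\<infinity>k. of_nat k * tr_op (\<rho> \<circ> adj_op V \<circ> number_proj k \<circ> V))"


section \<open>Weyl operators and phase space\<close>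

definition cdot :: "complex ^ 'n \<Rightarrow> complex ^ 'n::finite \<Rightarrow> complex" where
  "cdot u v = (\<Sum>j\<in>UNIV. cnj (u $ j) * v $ j)"

definition weyl :: "complex ^ 'n \<Rightarrow> 'n::finite operator" where
  "weyl u = (THE W. unitary_op W \<and>
     (\<forall>v. W (exp_vec v) = exp (- complex_of_real ((norm u)\<^sup>2) / 2 - cdot u v) *\<^sub>C exp_vec (u + v)))"

text \<open>
  Vectors in $\mathbb{R}^{2n}$ are indexed by \<open>'n + 'n\<close>, with \<open>Inl j\<close> the index of $x_j$ and
  \<open>Inr j\<close> that of $y_j$.
\<close>

definition pt :: "real ^ 'n \<Rightarrow> real ^ 'n \<Rightarrow> real ^ ('n + 'n::finite)" where
  "pt x y = (\<chi> a. case a of Inl j \<Rightarrow> x $ j | Inr j \<Rightarrow> y $ j)"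

definition cvec :: "real ^ ('n + 'n) \<Rightarrow> complex ^ 'n::finite" where
  "cvec z = (\<chi> j. Complex (z $ Inl j) (z $ Inr j))"

definition Jmat :: "real ^ ('n + 'n) ^ ('n + 'n::finite)" where
  "Jmat = (\<chi> a b. case (a, b) of
      (Inl i, Inr j) \<Rightarrow> if i = j then -1 else 0
    | (Inr i, Inl j) \<Rightarrow> if i = j then 1 else 0
    | _ \<Rightarrow> 0)"

definition psd :: "real ^ 'k ^ 'k::finite \<Rightarrow> bool" where
  "psd B \<longleftrightarrow> transpose B = B \<and> (\<forall>v. 0 \<le> v \<bullet> (B *v v))"

text \<open>\<open>cpsd P Q\<close> states that $P + iQ \ge 0$.\<close>

definition cpsd :: "real ^ 'k ^ 'k \<Rightarrow> real ^ 'k ^ 'k::finite \<Rightarrow> bool" where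
  "cpsd P Q \<longleftrightarrow>
     (\<forall>v :: complex ^ 'k. cdot v ((\<chi> a b. Complex (P $ a $ b) (Q $ a $ b)) *v v) \<in> \<real>\<^sub>\<ge>\<^sub>0)"


section \<open>Gaussian states and channels\<close>

text \<open>\<open>gaussian_state l m S \<rho>\<close> states that \<open>\<rho>\<close> is the state $\rho_g(\mathbf{l},\mathbf{m};S)$.\<close>

definition gaussian_state ::
    "real ^ 'n \<Rightarrow> real ^ 'n \<Rightarrow> real ^ ('n + 'n) ^ ('n + 'n) \<Rightarrow> 'n::finite operator \<Rightarrow> bool" where
  "gaussian_state l m S \<rho> \<longleftrightarrow>
     transpose S = S \<and> cpsd (2 *\<^sub>R S) Jmat \<and> state \<rho> \<and>
     (\<forall>x y. tr_op (\<rho> \<circ> weyl (cvec (pt x y))) =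
        exp (- \<i> * complex_of_real (sqrt 2 * (l \<bullet> x - m \<bullet> y))
             - complex_of_real (pt x y \<bullet> (S *v pt x y))))"

text \<open>
  \<open>K\<close> is a map on operators of which only the action on Gaussian states is prescribed.
\<close>

definition gaussian_channel ::
    "real ^ ('n + 'n) ^ ('n + 'n) \<Rightarrow> real ^ ('n + 'n) ^ ('n + 'n) \<Rightarrow>
     ('n::finite operator \<Rightarrow> 'n operator) \<Rightarrow> bool" where
  "gaussian_channel A B K \<longleftrightarrow>
     psd B \<and> cpsd B (transpose A ** Jmat ** A - Jmat) \<and>
     (\<forall>l m S \<rho> l' m'. gaussian_state l m S \<rho> \<longrightarrow>
        pt l' (- m') = transpose A *v pt l (- m) \<longrightarrow>
        gaussian_state l' m' (transpose A ** S ** A + (1 / 2) *\<^sub>R B) (K \<rho>))"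


section \<open>Symplectic transformations and gates\<close>

definition Sp :: "(real ^ ('n + 'n) ^ ('n + 'n::finite)) set" where
  "Sp = {L. transpose L ** Jmat ** L = Jmat}"

text \<open>\<open>second_quant L V\<close> states that \<open>V\<close> is a version of $\Gamma(L)$, which is unique only up to
  a phase.\<close>

definition second_quant ::
    "real ^ ('n + 'n) ^ ('n + 'n) \<Rightarrow> 'n::finite operator \<Rightarrow> bool" where
  "second_quant L V \<longleftrightarrow> unitary_op V \<and>
     (\<forall>z. V \<circ> weyl (cvec z) \<circ> inv V = weyl (cvec (L *v z)))"

definition tau :: "real ^ 'k ^ 'k \<Rightarrow> real ^ 'k ^ 'k::finite" where
  "tau L = transpose (matrix_inv L)"

text \<open>
  For injective \<open>f\<close>, the matrix acting by \<open>Q\<close> on the coordinates selected by \<open>f\<close> and fixing all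
  others.
\<close>

definition embed :: "('k \<Rightarrow> 'm) \<Rightarrow> real ^ 'k ^ 'k \<Rightarrow> real ^ 'm ^ 'm::finite" where
  "embed f Q = (\<chi> a b. if a \<in> range f \<and> b \<in> range f then Q $ inv f a $ inv f b
                       else if a = b then 1 else 0)"

definition coords1 :: "'n \<Rightarrow> 2 \<Rightarrow> 'n + 'n" where
  "coords1 j k = (if k = 1 then Inl j else Inr j)"

definition coords2 :: "'n \<Rightarrow> 'n \<Rightarrow> 4 \<Rightarrow> 'n + 'n" where
  "coords2 i j k =
     (if k = 1 then Inl i else if k = 2 then Inr i else if k = 3 then Inl j else Inr j)"

definition rot :: "real \<Rightarrow> real ^ 2 ^ 2" where
  "rot \<alpha> = vector [vector [cos \<alpha>, - sin \<alpha>], vector [sin \<alpha>, cos \<alpha>]]"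

definition L1 :: "real \<Rightarrow> real \<Rightarrow> real ^ 2 ^ 2" where
  "L1 x \<alpha> = rot \<alpha> ** vector [vector [x, 0], vector [0, inverse x]] ** transpose (rot \<alpha>)"

text \<open>The orthogonal matrix $\mathcal{O}$ of $U$, read off from the first row $(\alpha,\beta)$ of $U$.\<close>

definition Omat :: "complex ^ 2 ^ 2 \<Rightarrow> real ^ 4 ^ 4" where
  "Omat U = (let \<alpha>1 = Re (U $ 1 $ 1); \<alpha>2 = Im (U $ 1 $ 1);
                 \<beta>1 = Re (U $ 1 $ 2); \<beta>2 = Im (U $ 1 $ 2) in
     vector [vector [ \<alpha>1, - \<alpha>2,   \<beta>1, - \<beta>2],
             vector [ \<alpha>2,   \<alpha>1,   \<beta>2,   \<beta>1],
             vector [-\<beta>1, - \<beta>2,   \<alpha>1,   \<alpha>2],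
             vector [ \<beta>2, - \<beta>1, - \<alpha>2,   \<alpha>1]])"

definition L2 :: "complex ^ 2 ^ 2 \<Rightarrow> real \<Rightarrow> real \<Rightarrow> real ^ 4 ^ 4" where
  "L2 U x1 x2 = Omat U **
     vector [vector [x1, 0, 0, 0], vector [0, inverse x1, 0, 0],
             vector [0, 0, x2, 0], vector [0, 0, 0, inverse x2]] **
     transpose (Omat U)"

definition Hmat :: "complex ^ 2 ^ 2" where
  "Hmat = (1 / sqrt 2) *\<^sub>R vector [vector [1, 1], vector [-1, 1]]"

definition Kmat :: "complex ^ 2 ^ 2" where
  "Kmat = (1 / sqrt 2) *\<^sub>R vector [vector [\<i>, 1], vector [-1, -\<i>]]"

definition Gp :: "'n \<Rightarrow> 'n::finite operator" where
  "Gp j = weyl (axis j (\<i> / complex_of_real (sqrt 2)))"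

definition Gq :: "'n \<Rightarrow> 'n::finite operator" where
  "Gq j = weyl (axis j (1 / complex_of_real (sqrt 2)))"


section \<open>The observables\<close>

text \<open>
  The observables are the operators \<open>V\<^sup>\<dagger> N V\<close> with \<open>V\<close> in one of the three sets below.
  The argument \<open>\<Gamma>\<close> is a choice of a version of $\Gamma(L)$ for each $L\in Sp(2n)$.
  The modes $1,\dots,n$ are numbered by the linear order of \<open>'n\<close>, so the first mode is
  \<open>Min UNIV\<close> and the last one \<open>Max UNIV\<close>.
\<close>

definition gates_a :: "('n::finite operator) set" where
  "gates_a = {id} \<union> range Gp \<union> range Gq"

definition gates_b ::
    "(real ^ ('n + 'n) ^ ('n + 'n) \<Rightarrow> 'n::{finite,linorder} operator) \<Rightarrow> 'n operator set" where
  "gates_b \<Gamma> =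
     {\<Gamma> (embed (coords1 j) (tau (L1 x \<alpha>))) | j x \<alpha>.
        j \<noteq> Max UNIV \<and> (x, \<alpha>) \<in> {(sqrt 2, 0), (sqrt 3, 0), (sqrt 2, pi / 4)}} \<union>
     {\<Gamma> (embed (coords1 j) (tau (L1 x \<alpha>))) | j x \<alpha>.
        j = Max UNIV \<and> (x, \<alpha>) \<in> {(sqrt 2, 0), (sqrt 2, pi / 4)}}"

definition gates_c ::
    "(real ^ ('n + 'n) ^ ('n + 'n) \<Rightarrow> 'n::{finite,linorder} operator) \<Rightarrow> 'n operator set" where
  "gates_c \<Gamma> =
     {\<Gamma> (embed (coords2 i j) (tau (L2 U x1 x2))) | i j U x1 x2.
        i < j \<and> (U, x1, x2) \<in> {(Hmat, 1, 2), (Hmat, 1, 3), (Kmat, 1, 2), (Kmat, 1, 3)}}"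

end

theory Submission
  imports Defs "HOL-Probability.Characteristic_Functions" "HOL-Real_Asymp.Real_Asymp"
begin

text \<open>
  The mean particle number of a Gaussian state with mean vector \<open>w = (l, -m)\<close> and covariance \<open>S\<close> is
  \<open>(tr S + |w|\<^sup>2 - n) / 2\<close>: the average of \<open>W(\<zeta> e\<^sub>j)\<close> over a centred circular Gaussian \<open>\<zeta>\<close> is a
  multiple of \<open>s ^ N\<^sub>j\<close>, so the characteristic function of the state gives the generating function
  of its number distribution, and the mean is read off as the variance of \<open>\<zeta>\<close> tends to zero. To exchange
  the average with the trace, a state is written as a sum of vector states by a Cholesky decomposition
  in the number basis, which avoids the spectral theorem.

  A displacement gate translates \<open>w\<close> and a symplectic gate transforms \<open>(w, S)\<close> linearly. Hence the list (a)
  yields \<open>w\<close> and \<open>tr S\<close> of each output state; the vectors \<open>w\<close> are, up to sign, the columns of \<open>A\<^sup>T\<close>.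
  With \<open>A\<close> known, each gate in (b) and (c) gives a linear equation for the covariance of the first
  output state, and together these determine all its entries, hence \<open>B\<close>.
\<close>

section \<open>The Fock space as a complex Hilbert space\<close>

text \<open>\<open>weyl\<close> and \<open>adj_op\<close> are definite descriptions, so neither may
  be used before existence and uniqueness are settled. Weyl operators are fixed by their values on
  exponential vectors and extended from there by completeness; traces are evaluated only for
  operators whose adjoint is supplied explicitly. The number operator is unbounded and finiteness of
  its mean is not given. The generating function involves only contractions, and finiteness comes
  out of the limit together with the value. The average over \<zeta> is computed on exponential
  vectors of real vectors: they are already total, and for them the integrals over the real and
  imaginary part of \<zeta> separate. Every mode contributes a factor 1 / (1 + variance), which is
  the origin of the term -n/2. For the difference D of two covariances a symplectic gate only yields
  tr (D (Q^2 - 1)) = 0. A squeezing parameter x enters through the pair (x^2 - 1, x^(-2) - 1), and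
  two values of x give non-proportional pairs; this is why the gates come with two parameters. The
  last mode can spare one gate because tr D = 0 is known.\<close>

lemma coord_add [simp]: "coord (\<psi> + \<phi>) xs = coord \<psi> xs + coord \<phi> xs"
  by (simp add: plus_fock.rep_eq)

lemma coord_zero [simp]: "coord 0 xs = 0"
  by (simp add: zero_fock.rep_eq)

lemma coord_scaleC [simp]: "coord (c *\<^sub>C \<psi>) xs = c * coord \<psi> xs"
  by (simp add: scaleC.rep_eq)

lemma coord_minus [simp]: "coord (\<psi> - \<phi>) xs = coord \<psi> xs - coord \<phi> xs"
  by (subst minus_fock_def) (metis coord_add uminus_fock.rep_eq diff_conv_add_uminus)

lemma coord_scaleR [simp]: "coord (r *\<^sub>R \<psi>) xs = complex_of_real r * coord \<psi> xs"
  by (simp add: scaleR_fock_def)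

lemma coord_sum: "coord (sum f F) xs = (\<Sum>i\<in>F. coord (f i) xs)"
  by (induction F rule: infinite_finite_induct) auto

lemma scaleR_scaleC_fock: "r *\<^sub>R \<psi> = complex_of_real r *\<^sub>C \<psi>" for \<psi> :: "'n::finite fock"
  by (simp add: scaleR_fock_def)

lemma scaleC_scaleC [simp]: "a *\<^sub>C b *\<^sub>C \<psi> = (a * b) *\<^sub>C \<psi>"
  by (rule fock_eqI) simp

lemma scaleC_one [simp]: "1 *\<^sub>C \<psi> = \<psi>"
  by (rule fock_eqI) simp

lemma scaleC_zero_left [simp]: "0 *\<^sub>C \<psi> = 0"
  by (rule fock_eqI) simp

lemma scaleC_zero_right [simp]: "c *\<^sub>C 0 = 0"
  by (rule fock_eqI) simp

lemma scaleC_add_right: "c *\<^sub>C (\<psi> + \<phi>) = c *\<^sub>C \<psi> + c *\<^sub>C \<phi>"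
  by (rule fock_eqI) (simp add: algebra_simps)

lemma scaleC_add_left: "(a + b) *\<^sub>C \<psi> = a *\<^sub>C \<psi> + b *\<^sub>C \<psi>"
  by (rule fock_eqI) (simp add: algebra_simps)

lemma scaleC_diff_right: "c *\<^sub>C (\<psi> - \<phi>) = c *\<^sub>C \<psi> - c *\<^sub>C \<phi>"
  by (rule fock_eqI) (simp add: algebra_simps)

lemma cinner_has_sum: "((\<lambda>xs. cnj (coord \<psi> xs) * coord \<phi> xs) has_sum cinner \<psi> \<phi>) UNIV"
  unfolding cinner_def by (intro has_sum_infsum summable_coord_mult)

lemma cinner_commute: "cinner \<phi> \<psi> = cnj (cinner \<psi> \<phi>)"
  unfolding cinner_def infsum_cnj[symmetric] by (simp add: mult.commute)

lemma cinner_add_left: "cinner (\<psi> + \<phi>) \<eta> = cinner \<psi> \<eta> + cinner \<phi> \<eta>"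
  unfolding cinner_def
  by (simp add: distrib_right infsum_add summable_coord_mult)

lemma cinner_add_right: "cinner \<eta> (\<psi> + \<phi>) = cinner \<eta> \<psi> + cinner \<eta> \<phi>"
  by (metis cinner_add_left cinner_commute complex_cnj_add)

lemma cinner_scaleC_left: "cinner (c *\<^sub>C \<psi>) \<phi> = cnj c * cinner \<psi> \<phi>"
  unfolding cinner_def by (simp add: mult.assoc infsum_cmult_right')

lemma cinner_scaleC_right: "cinner \<psi> (c *\<^sub>C \<phi>) = c * cinner \<psi> \<phi>"
  by (metis cinner_commute cinner_scaleC_left complex_cnj_mult complex_cnj_cnj)

lemma cinner_zero_left [simp]: "cinner 0 \<psi> = 0"
  by (simp add: cinner_def)

lemma cinner_zero_right [simp]: "cinner \<psi> 0 = 0"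
  by (simp add: cinner_def)

lemma cinner_diff_left: "cinner (\<psi> - \<phi>) \<eta> = cinner \<psi> \<eta> - cinner \<phi> \<eta>"
  by (metis add_diff_cancel_right' cinner_add_left diff_add_cancel)

lemma cinner_diff_right: "cinner \<eta> (\<psi> - \<phi>) = cinner \<eta> \<psi> - cinner \<eta> \<phi>"
  by (metis add_diff_cancel_right' cinner_add_right diff_add_cancel)

lemma cinner_sum_left: "cinner (sum f F) \<eta> = (\<Sum>i\<in>F. cinner (f i) \<eta>)"
  by (induction F rule: infinite_finite_induct) (auto simp: cinner_add_left)

lemma cinner_self: "cinner \<psi> \<psi> = complex_of_real ((norm \<psi>)\<^sup>2)"
proof -
  have "Im (cinner \<psi> \<psi>) = 0"
    using cinner_commute[of \<psi> \<psi>] by (metis complex_cnj_cancel_iff complex_is_Real_iff Reals_cnj_iff)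
  moreover have "Re (cinner \<psi> \<psi>) = (norm \<psi>)\<^sup>2"
    by (metis inner_fock_def power2_norm_eq_inner)
  ultimately show ?thesis by (simp add: complex_eq_iff)
qed

lemma norm_fock_has_sum: "((\<lambda>xs. (cmod (coord \<psi> xs))\<^sup>2) has_sum (norm \<psi>)\<^sup>2) UNIV"
proof -
  have "((\<lambda>xs. Re (cnj (coord \<psi> xs) * coord \<psi> xs)) has_sum Re (cinner \<psi> \<psi>)) UNIV"
    by (intro has_sum_Re cinner_has_sum)
  then show ?thesis
    by (simp add: cinner_self cmod_power2 flip: power2_eq_square)
qed

lemma norm_scaleC [simp]: "norm (c *\<^sub>C \<psi>) = cmod c * norm \<psi>"
proof -
  have "complex_of_real ((norm (c *\<^sub>C \<psi>))\<^sup>2) = complex_of_real ((cmod c * norm \<psi>)\<^sup>2)"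
    by (simp add: cinner_scaleC_left cinner_scaleC_right power_mult_distrib complex_norm_square
        flip: cinner_self of_real_power)
  then have "(norm (c *\<^sub>C \<psi>))\<^sup>2 = (cmod c * norm \<psi>)\<^sup>2"
    by (simp only: of_real_eq_iff)
  then show ?thesis by (simp add: power2_eq_iff_nonneg)
qed

text \<open>Multiplying \<phi> by a phase makes the inner product real and nonnegative, which
  reduces the claim to the inequality for the real inner product.\<close>

lemma Cauchy_Schwarz_cinner: "cmod (cinner \<psi> \<phi>) \<le> norm \<psi> * norm \<phi>"
proof (cases "cinner \<psi> \<phi> = 0")
  case False
  define c where "c = cnj (sgn (cinner \<psi> \<phi>))"
  have "c * cinner \<psi> \<phi> = cmod (cinner \<psi> \<phi>)"
    using False complex_norm_square[of "cinner \<psi> \<phi>"]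
    by (simp add: c_def sgn_eq divide_simps power2_eq_square mult.commute)
  then have "cmod (cinner \<psi> \<phi>) = Re (cinner \<psi> (c *\<^sub>C \<phi>))"
    by (simp add: cinner_scaleC_right)
  also have "\<dots> \<le> norm \<psi> * norm (c *\<^sub>C \<phi>)"
    using norm_cauchy_schwarz[of \<psi> "c *\<^sub>C \<phi>"] by (simp add: inner_fock_def)
  also have "norm (c *\<^sub>C \<phi>) = norm \<phi>"
    using False by (simp add: c_def norm_sgn)
  finally show ?thesis .
qed auto

lemma bounded_bilinear_cinner: "bounded_bilinear cinner"
proof
  show "\<exists>K. \<forall>\<psi> \<phi> :: 'a fock. norm (cinner \<psi> \<phi>) \<le> norm \<psi> * norm \<phi> * K"
    by (rule exI[of _ 1]) (simp add: Cauchy_Schwarz_cinner)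
qed (simp_all add: cinner_add_left cinner_add_right cinner_scaleC_left cinner_scaleC_right
    scaleR_scaleC_fock scaleR_conv_of_real)

lemmas tendsto_cinner [tendsto_intros] = bounded_bilinear.tendsto[OF bounded_bilinear_cinner]
lemmas continuous_on_cinner [continuous_intros] =
  bounded_bilinear.continuous_on[OF bounded_bilinear_cinner]

lemma bounded_linear_scaleC: "bounded_linear (\<lambda>\<psi>. c *\<^sub>C \<psi>)"
  by (rule bounded_linear_intro[where K = "cmod c"])
    (simp_all add: scaleC_add_right scaleR_scaleC_fock mult.commute)

section \<open>Coordinatewise convergence and completeness\<close>

lemma coord_le_norm: "cmod (coord \<psi> xs) \<le> norm \<psi>"
proof -
  have "(cmod (coord \<psi> xs))\<^sup>2 \<le> (norm \<psi>)\<^sup>2"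
    using finite_sum_le_has_sum[OF norm_fock_has_sum[of \<psi>], of "{xs}"] by simp
  then show ?thesis by (simp add: power2_le_iff_abs_le)
qed

lemma norm_fock_leI:
  assumes "\<And>F. finite F \<Longrightarrow> (\<Sum>xs\<in>F. (cmod (coord \<psi> xs))\<^sup>2) \<le> B\<^sup>2" "0 \<le> B"
  shows "norm \<psi> \<le> B"
proof -
  have "(norm \<psi>)\<^sup>2 \<le> B\<^sup>2"
    using has_sum_le_finite_sums[OF norm_fock_has_sum] assms by blast
  then show ?thesis using assms by (simp add: power2_le_iff_abs_le)
qed

text \<open>The Cauchy bound on a finite set of words passes to the limit in one index, and finite
  sets of words control the norm.\<close>

lemma tendsto_fockI_Cauchy:
  assumes "Cauchy X" and lim: "\<And>xs. (\<lambda>n. coord (X n) xs) \<longlonglongrightarrow> coord L xs"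
  shows "X \<longlonglongrightarrow> L"
proof (rule metric_LIMSEQ_I)
  fix e :: real assume "0 < e"
  then obtain N where N: "\<And>m n. m \<ge> N \<Longrightarrow> n \<ge> N \<Longrightarrow> norm (X m - X n) < e / 2"
    using CauchyD[OF assms(1), of "e / 2"] by auto
  have "norm (X n - L) \<le> e / 2" if "n \<ge> N" for n
  proof (rule norm_fock_leI)
    fix F :: "'a list set" assume F: "finite F"
    show "(\<Sum>xs\<in>F. (cmod (coord (X n - L) xs))\<^sup>2) \<le> (e / 2)\<^sup>2"
    proof (rule LIMSEQ_le_const2)
      show "(\<lambda>m. \<Sum>xs\<in>F. (cmod (coord (X n - X m) xs))\<^sup>2) \<longlonglongrightarrow> (\<Sum>xs\<in>F. (cmod (coord (X n - L) xs))\<^sup>2)"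
        unfolding coord_minus by (intro tendsto_intros lim)
      have "(\<Sum>xs\<in>F. (cmod (coord (X n - X m) xs))\<^sup>2) \<le> (e / 2)\<^sup>2" if "m \<ge> N" for m
      proof -
        have "(\<Sum>xs\<in>F. (cmod (coord (X n - X m) xs))\<^sup>2) \<le> (norm (X n - X m))\<^sup>2"
          using finite_sum_le_has_sum[OF norm_fock_has_sum[of "X n - X m"] F] by simp
        also have "\<dots> \<le> (e / 2)\<^sup>2"
          using N[OF \<open>n \<ge> N\<close> \<open>m \<ge> N\<close>] by (intro power_mono) auto
        finally show ?thesis .
      qed
      then show "\<exists>M. \<forall>m\<ge>M. (\<Sum>xs\<in>F. (cmod (coord (X n - X m) xs))\<^sup>2) \<le> (e / 2)\<^sup>2" by blast
    qed
  qed (use \<open>0 < e\<close> in auto)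
  then show "\<exists>N. \<forall>n\<ge>N. dist (X n) L < e"
    using \<open>0 < e\<close> by (intro exI[of _ N]) (fastforce simp: dist_norm)
qed

text \<open>The coordinatewise limit inherits symmetry, and a common norm bound tested on finite
  sets of words makes it square summable.\<close>

instance fock :: (finite) complete_space
proof
  fix X :: "nat \<Rightarrow> 'a fock" assume X: "Cauchy X"
  have "Cauchy (\<lambda>n. coord (X n) xs)" for xs
  proof (rule CauchyI)
    fix e :: real assume "0 < e"
    then obtain M where "\<forall>m\<ge>M. \<forall>n\<ge>M. norm (X m - X n) < e" using CauchyD[OF X] by blast
    then show "\<exists>M. \<forall>m\<ge>M. \<forall>n\<ge>M. cmod (coord (X m) xs - coord (X n) xs) < e"
      unfolding coord_minus[symmetric] by (meson coord_le_norm le_less_trans)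
  qed
  then have "\<exists>l. (\<lambda>n. coord (X n) xs) \<longlonglongrightarrow> l" for xs
    by (simp add: Cauchy_convergent_iff convergent_def)
  then obtain f where f: "\<And>xs. (\<lambda>n. coord (X n) xs) \<longlonglongrightarrow> f xs" by metis
  obtain B where B: "\<And>n. norm (X n) \<le> B"
    using Cauchy_Bseq[OF X] unfolding Bseq_def by blast
  have "f xs = f ys" if "mset xs = mset ys" for xs ys
    using f[of xs] f[of ys] coord_mset[OF that] LIMSEQ_unique by simp
  moreover have "(\<lambda>xs. (cmod (f xs))\<^sup>2) summable_on UNIV"
  proof (rule nonneg_bdd_above_summable_on)
    show "bdd_above (sum (\<lambda>xs. (cmod (f xs))\<^sup>2) ` {F. F \<subseteq> UNIV \<and> finite F})"
    proof (rule bdd_aboveI2)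
      fix F :: "'a list set" assume "F \<in> {F. F \<subseteq> UNIV \<and> finite F}"
      then have F: "finite F" by simp
      show "(\<Sum>xs\<in>F. (cmod (f xs))\<^sup>2) \<le> B\<^sup>2"
      proof (rule LIMSEQ_le_const2)
        show "(\<lambda>n. \<Sum>xs\<in>F. (cmod (coord (X n) xs))\<^sup>2) \<longlonglongrightarrow> (\<Sum>xs\<in>F. (cmod (f xs))\<^sup>2)"
          by (intro tendsto_intros f)
        have "(\<Sum>xs\<in>F. (cmod (coord (X n) xs))\<^sup>2) \<le> B\<^sup>2" for n
        proof -
          have "(\<Sum>xs\<in>F. (cmod (coord (X n) xs))\<^sup>2) \<le> (norm (X n))\<^sup>2"
            using finite_sum_le_has_sum[OF norm_fock_has_sum F] by simp
          also have "\<dots> \<le> B\<^sup>2" using B by (intro power_mono) auto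
          finally show ?thesis .
        qed
        then show "\<exists>N. \<forall>n\<ge>N. (\<Sum>xs\<in>F. (cmod (coord (X n) xs))\<^sup>2) \<le> B\<^sup>2" by blast
      qed
    qed
  qed simp
  ultimately have "f \<in> fock_vectors" unfolding fock_vectors_def by blast
  then have "coord (Abs_fock f) = f" by (rule Abs_fock_inverse)
  then have "X \<longlonglongrightarrow> Abs_fock f" by (intro tendsto_fockI_Cauchy X) (simp only: f)
  then show "convergent X" unfolding convergent_def by blast
qed

text \<open>Dominated convergence for square-summable families: a finite set of words carries almost
  all the mass of \<phi>, and off that set \<open>X n\<close> is bounded by \<phi>.\<close>

lemma tendsto_zero_fock_dominated:
  assumes dom: "\<And>n xs. cmod (coord (X n) xs) \<le> cmod (coord \<phi> xs)"
    and lim: "\<And>xs. (\<lambda>n. coord (X n) xs) \<longlonglongrightarrow> 0"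
  shows "X \<longlonglongrightarrow> 0"
proof (rule metric_LIMSEQ_I)
  fix e :: real assume e: "0 < e"
  then obtain F where F: "finite F"
    and F_dist: "dist (\<Sum>xs\<in>F. (cmod (coord \<phi> xs))\<^sup>2) ((norm \<phi>)\<^sup>2) \<le> e\<^sup>2 / 4"
    using has_sum_finite_approximation[OF norm_fock_has_sum[of \<phi>], of "e\<^sup>2 / 4"] by auto
  have "0 < e\<^sup>2" using e by simp
  with F_dist have F_ge: "(norm \<phi>)\<^sup>2 - e\<^sup>2 / 2 < (\<Sum>xs\<in>F. (cmod (coord \<phi> xs))\<^sup>2)"
    unfolding dist_real_def by linarith
  have "(\<lambda>n. \<Sum>xs\<in>F. (cmod (coord (X n) xs))\<^sup>2) \<longlonglongrightarrow> (\<Sum>xs\<in>F. (cmod 0)\<^sup>2)"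
    by (intro tendsto_intros lim)
  then have "\<forall>\<^sub>F n in sequentially. (\<Sum>xs\<in>F. (cmod (coord (X n) xs))\<^sup>2) < e\<^sup>2 / 2"
    using e by (intro order_tendstoD(2)[where y = 0]) auto
  then obtain N where N: "\<And>n. n \<ge> N \<Longrightarrow> (\<Sum>xs\<in>F. (cmod (coord (X n) xs))\<^sup>2) < e\<^sup>2 / 2"
    by (auto simp: eventually_sequentially)
  have "norm (X n) < e" if "n \<ge> N" for n
  proof -
    let ?a = "\<lambda>xs. (cmod (coord (X n) xs))\<^sup>2" and ?b = "\<lambda>xs. (cmod (coord \<phi> xs))\<^sup>2"
    have ab: "?a xs \<le> ?b xs" for xs using dom by (intro power_mono) auto
    have "((\<lambda>xs. ?b xs - ?a xs) has_sum ((norm \<phi>)\<^sup>2 - (norm (X n))\<^sup>2)) UNIV"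
      using has_sum_add[OF norm_fock_has_sum[of \<phi>] has_sum_uminusI[OF norm_fock_has_sum[of "X n"]]]
      by simp
    from finite_sum_le_has_sum[OF this F]
    have "(\<Sum>xs\<in>F. ?b xs) - (\<Sum>xs\<in>F. ?a xs) \<le> (norm \<phi>)\<^sup>2 - (norm (X n))\<^sup>2"
      using ab by (simp add: sum_subtractf)
    then have "(norm (X n))\<^sup>2 < e\<^sup>2"
      using F_ge N[OF that] by linarith
    then show ?thesis using e by (simp add: power2_less_imp_less)
  qed
  then show "\<exists>N. \<forall>n\<ge>N. dist (X n) 0 < e" by auto
qed

section \<open>Total sets and the number basis\<close>

definition closed_csubspace :: "'n::finite fock set \<Rightarrow> bool" where
  "closed_csubspace X \<longleftrightarrow> subspace X \<and> closed X \<and> (\<forall>c. \<forall>\<psi>\<in>X. c *\<^sub>C \<psi> \<in> X)"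

text \<open>\<open>span\<close> is the real span; admitting all complex multiples of the generators
  turns its closure into the closed complex span.\<close>

definition clcspan :: "'n::finite fock set \<Rightarrow> 'n fock set" where
  "clcspan G = closure (span {c *\<^sub>C g | c g. g \<in> G})"

lemma bounded_op_linear: "bounded_op T \<Longrightarrow> linear T"
  by (simp add: bounded_op_def bounded_linear.linear)

lemma subspace_closure:
  fixes S :: "'a::real_normed_vector set"
  assumes "subspace S"
  shows "subspace (closure S)"
  unfolding subspace_def
proof (intro conjI ballI allI)
  show "0 \<in> closure S" using assms closure_subset subspace_0 by blast
next
  fix x y assume "x \<in> closure S" "y \<in> closure S"
  then obtain f g where "\<And>n. f n \<in> S" "f \<longlonglongrightarrow> x" "\<And>n. g n \<in> S" "g \<longlonglongrightarrow> y"
    by (auto simp: closure_sequential)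
  then have "\<forall>n. f n + g n \<in> S" "(\<lambda>n. f n + g n) \<longlonglongrightarrow> x + y"
    using assms by (auto intro: subspace_add tendsto_add)
  then show "x + y \<in> closure S" by (subst closure_sequential) (rule exI[of _ "\<lambda>n. f n + g n"], simp)
next
  fix c :: real and x assume "x \<in> closure S"
  then obtain f where "\<And>n. f n \<in> S" "f \<longlonglongrightarrow> x"
    by (auto simp: closure_sequential)
  then have "\<forall>n. c *\<^sub>R f n \<in> S" "(\<lambda>n. c *\<^sub>R f n) \<longlonglongrightarrow> c *\<^sub>R x"
    using assms by (auto intro!: subspace_scale tendsto_intros)
  then show "c *\<^sub>R x \<in> closure S" by (subst closure_sequential) (rule exI[of _ "\<lambda>n. c *\<^sub>R f n"], simp)
qed

text \<open>The preimage of \<open>Y\<close> under \<open>T\<close> is again a closed complex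
  subspace. With \<open>T = id\<close> this is minimality of the span; with \<open>Y = {0}\<close>
  it shows that a bounded operator is determined by a total set.\<close>

lemma clcspan_minimal:
  assumes T: "bounded_op T" and Y: "closed_csubspace Y" and gen: "\<And>g. g \<in> G \<Longrightarrow> T g \<in> Y"
    and "\<psi> \<in> clcspan G"
  shows "T \<psi> \<in> Y"
proof -
  have lin: "bounded_linear T" and TC: "\<And>c \<psi>. T (c *\<^sub>C \<psi>) = c *\<^sub>C T \<psi>"
    using T by (auto simp: bounded_op_def)
  have "subspace {\<psi>. T \<psi> \<in> Y}"
    using Y bounded_linear.linear[OF lin] unfolding closed_csubspace_def
    by (auto simp: subspace_def linear_0 linear_add linear_scale)
  moreover have "{c *\<^sub>C g | c g. g \<in> G} \<subseteq> {\<psi>. T \<psi> \<in> Y}"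
    using gen Y by (auto simp: TC closed_csubspace_def)
  ultimately have "span {c *\<^sub>C g | c g. g \<in> G} \<subseteq> {\<psi>. T \<psi> \<in> Y}"
    by (intro span_minimal)
  moreover have "closed (T -` Y)"
    using Y by (intro closed_vimage linear_continuous_on lin) (auto simp: closed_csubspace_def)
  ultimately have "clcspan G \<subseteq> T -` Y"
    unfolding clcspan_def by (intro closure_minimal) auto
  then show ?thesis using assms by auto
qed

lemma bounded_op_id: "bounded_op id"
  by (simp add: bounded_op_def id_def bounded_linear_ident)

lemma clcspan_superset: "g \<in> G \<Longrightarrow> c *\<^sub>C g \<in> clcspan G"
  unfolding clcspan_def by (rule subsetD[OF closure_subset], rule span_base) blast

lemma closed_csubspace_clcspan: "closed_csubspace (clcspan G)"
  unfolding closed_csubspace_def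
proof (intro conjI allI ballI)
  show "subspace (clcspan G)" unfolding clcspan_def by (intro subspace_closure subspace_span)
  show cl: "closed (clcspan G)" unfolding clcspan_def by simp
  fix c :: complex and \<psi> assume "\<psi> \<in> clcspan G"
  define S where "S = {c *\<^sub>C g | c g. g \<in> G}"
  have lin: "linear (\<lambda>\<psi>. c *\<^sub>C \<psi>)" using bounded_linear_scaleC bounded_linear.linear by blast
  have "S \<subseteq> (\<lambda>\<psi>. c *\<^sub>C \<psi>) -` span S"
  proof
    fix \<phi> assume "\<phi> \<in> S"
    then obtain d g where "\<phi> = d *\<^sub>C g" "g \<in> G" unfolding S_def by blast
    then have "c *\<^sub>C \<phi> = (c * d) *\<^sub>C g" by simp
    then have "c *\<^sub>C \<phi> \<in> S" using \<open>g \<in> G\<close> unfolding S_def by blast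
    then show "\<phi> \<in> (\<lambda>\<psi>. c *\<^sub>C \<psi>) -` span S" by (simp add: span_base)
  qed
  then have "span S \<subseteq> (\<lambda>\<psi>. c *\<^sub>C \<psi>) -` span S"
    by (intro span_minimal) (auto simp: subspace_def linear_add[OF lin] linear_scale[OF lin]
      span_zero span_add span_scale)
  then have "(\<lambda>\<psi>. c *\<^sub>C \<psi>) ` closure (span S) \<subseteq> closure (span S)"
    by (intro image_closure_subset linear_continuous_on bounded_linear_scaleC closed_closure)
      (use closure_subset in blast)
  then show "c *\<^sub>C \<psi> \<in> clcspan G"
    using \<open>\<psi> \<in> clcspan G\<close> unfolding clcspan_def S_def by auto
qed

text \<open>
  The clamping to \<open>[0, 1]\<close> makes \<open>diag f\<close> bounded for every \<open>f\<close>.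
\<close>

lift_definition diag :: "('n multiset \<Rightarrow> real) \<Rightarrow> 'n::finite operator"
  is "\<lambda>f \<psi> xs. complex_of_real (max 0 (min 1 (f (mset xs)))) * \<psi> xs"
proof -
  fix f :: "'n multiset \<Rightarrow> real" and \<psi> :: "'n list \<Rightarrow> complex"
  assume \<psi>: "\<psi> \<in> fock_vectors"
  have "(\<lambda>xs. (cmod (complex_of_real (max 0 (min 1 (f (mset xs)))) * \<psi> xs))\<^sup>2) summable_on UNIV"
  proof (rule summable_on_comparison_test)
    show "(\<lambda>xs. (cmod (\<psi> xs))\<^sup>2) summable_on UNIV"
      using \<psi> unfolding fock_vectors_def by blast
    show "(cmod (complex_of_real (max 0 (min 1 (f (mset xs)))) * \<psi> xs))\<^sup>2 \<le> (cmod (\<psi> xs))\<^sup>2" for xs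
      unfolding norm_mult by (intro power_mono mult_left_le_one_le) auto
  qed auto
  moreover have "complex_of_real (max 0 (min 1 (f (mset xs)))) * \<psi> xs =
      complex_of_real (max 0 (min 1 (f (mset ys)))) * \<psi> ys" if "mset xs = mset ys" for xs ys
  proof -
    have "\<psi> xs = \<psi> ys" using \<psi> that unfolding fock_vectors_def by blast
    with that show ?thesis by simp
  qed
  ultimately show "(\<lambda>xs. complex_of_real (max 0 (min 1 (f (mset xs)))) * \<psi> xs) \<in> fock_vectors"
    unfolding fock_vectors_def by blast
qed

lemma coord_diag:
  assumes "\<And>M. 0 \<le> f M" "\<And>M. f M \<le> 1"
  shows "coord (diag f \<psi>) xs = complex_of_real (f (mset xs)) * coord \<psi> xs"
  using assms by (simp add: diag.rep_eq)

lemma norm_fock_mono: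
  assumes "\<And>xs. cmod (coord \<psi> xs) \<le> cmod (coord \<phi> xs)"
  shows "norm \<psi> \<le> norm \<phi>"
proof -
  have "(norm \<psi>)\<^sup>2 \<le> (norm \<phi>)\<^sup>2"
    by (rule has_sum_mono[OF norm_fock_has_sum norm_fock_has_sum]) (rule power_mono[OF assms norm_ge_zero])
  then show ?thesis by (rule power2_le_imp_le) simp
qed

lemma bounded_op_diag: "bounded_op (diag f)"
  unfolding bounded_op_def
proof (intro conjI allI)
  show "diag f (c *\<^sub>C \<psi>) = c *\<^sub>C diag f \<psi>" for c \<psi>
    by (rule fock_eqI) (simp add: diag.rep_eq)
  show "bounded_linear (diag f)"
  proof (rule bounded_linear_intro[where K = 1])
    show "norm (diag f \<psi>) \<le> norm \<psi> * 1" for \<psi>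
      by (simp add: diag.rep_eq norm_mult norm_fock_mono mult_left_le_one_le)
  qed (auto intro!: fock_eqI simp: diag.rep_eq algebra_simps)
qed

text \<open>Pointwise convergence of the weights gives strong convergence, since the difference
  applied to \<psi> is dominated by \<psi> itself.\<close>

lemma tendsto_diag:
  assumes f: "\<And>n M. 0 \<le> f n M" "\<And>n M. f n M \<le> 1" and g: "\<And>M. 0 \<le> g M" "\<And>M. g M \<le> 1"
    and lim: "\<And>M. (\<lambda>n. f n M) \<longlonglongrightarrow> g M"
  shows "(\<lambda>n. diag (f n) \<psi>) \<longlonglongrightarrow> diag g \<psi>"
proof -
  have eq: "coord (diag (f n) \<psi> - diag g \<psi>) xs = complex_of_real (f n (mset xs) - g (mset xs)) * coord \<psi> xs"
    for n xs by (simp add: coord_diag f g algebra_simps)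
  have "(\<lambda>n. diag (f n) \<psi> - diag g \<psi>) \<longlonglongrightarrow> 0"
  proof (rule tendsto_zero_fock_dominated[where \<phi> = \<psi>])
    fix n xs
    have "\<bar>f n (mset xs) - g (mset xs)\<bar> \<le> 1"
      using f(1)[of n "mset xs"] f(2)[of n "mset xs"] g(1)[of "mset xs"] g(2)[of "mset xs"] by linarith
    then show "cmod (coord (diag (f n) \<psi> - diag g \<psi>) xs) \<le> cmod (coord \<psi> xs)"
      unfolding eq norm_mult norm_of_real by (intro mult_left_le_one_le) auto
  next
    fix xs
    have "(\<lambda>n. complex_of_real (f n (mset xs) - g (mset xs)) * coord \<psi> xs) \<longlonglongrightarrow>
        complex_of_real (g (mset xs) - g (mset xs)) * coord \<psi> xs"
      by (intro tendsto_intros lim)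
    then show "(\<lambda>n. coord (diag (f n) \<psi> - diag g \<psi>) xs) \<longlonglongrightarrow> 0" unfolding eq by simp
  qed
  then show ?thesis using Lim_null by blast
qed

definition rvec :: "real ^ 'n \<Rightarrow> complex ^ 'n::finite" where
  "rvec v = (\<chi> i. complex_of_real (v $ i))"

text \<open>Each occurrence of \<open>j\<close> in a word picks up one factor \<open>t\<close>,
  which amounts to rescaling the \<open>j\<close>-th entry of the vector.\<close>

lemma diag_exp_vec:
  assumes "0 \<le> t" "t \<le> 1"
  shows "diag (\<lambda>M. t ^ count M j) (exp_vec (rvec v)) = exp_vec (rvec (\<chi> i. if i = j then t * v $ i else v $ i))"
proof (rule fock_eqI)
  fix xs :: "'a list"
  have "complex_of_real (t ^ count (mset xs) j) * (\<Prod>x\<leftarrow>xs. rvec v $ x) =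
      (\<Prod>x\<leftarrow>xs. rvec (\<chi> i. if i = j then t * v $ i else v $ i) $ x)"
    by (induction xs) (auto simp: rvec_def mult_ac)
  then show "coord (diag (\<lambda>M. t ^ count M j) (exp_vec (rvec v))) xs =
      coord (exp_vec (rvec (\<chi> i. if i = j then t * v $ i else v $ i))) xs"
    using assms by (simp add: coord_diag power_le_one exp_vec.rep_eq)
qed

text \<open>
  With \<open>Q\<^sub>i\<close> the projection onto \<open>N\<^sub>j = i\<close>, the operators
  \<open>t ^ (-k) (t ^ N\<^sub>j - (\<Sum>i<k. t ^ i Q\<^sub>i))\<close> are contractions that converge strongly to \<open>Q\<^sub>k\<close>
  as \<open>t\<close> tends to zero.
\<close>

lemma diag_count_eq_mem:
  assumes X: "closed_csubspace X" and \<psi>: "\<psi> \<in> X"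
    and inv: "\<And>t \<psi>. 0 \<le> t \<Longrightarrow> t \<le> 1 \<Longrightarrow> \<psi> \<in> X \<Longrightarrow> diag (\<lambda>M. t ^ count M j) \<psi> \<in> X"
  shows "diag (\<lambda>M. if count M j = k then 1 else 0) \<psi> \<in> X"
proof (induction k rule: less_induct)
  case (less k)
  have sub: "subspace X" and scl: "\<And>c \<psi>. \<psi> \<in> X \<Longrightarrow> c *\<^sub>C \<psi> \<in> X" and cl: "closed X"
    using X by (auto simp: closed_csubspace_def)
  define f where "f t M = (if k \<le> count M j then t ^ (count M j - k) else 0)" for t :: real and M
  have f01: "0 \<le> f t M" "f t M \<le> 1" if "0 < t" "t \<le> 1" for t M
    using that by (auto simp: f_def power_le_one)
  have mem: "diag (f t) \<psi> \<in> X" if t: "0 < t" "t \<le> 1" for t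
  proof -
    define \<phi> where "\<phi> = diag (\<lambda>M. t ^ count M j) \<psi> -
        (\<Sum>i<k. complex_of_real (t ^ i) *\<^sub>C diag (\<lambda>M. if count M j = i then 1 else 0) \<psi>)"
    have "\<phi> \<in> X"
      unfolding \<phi>_def using t \<psi> less by (intro subspace_diff subspace_sum sub inv scl) auto
    moreover have "diag (f t) \<psi> = complex_of_real (1 / t ^ k) *\<^sub>C \<phi>"
    proof (rule fock_eqI)
      fix xs
      have "(\<Sum>i<k. complex_of_real (t ^ i) * (complex_of_real (if count (mset xs) j = i then 1 else 0) * coord \<psi> xs)) =
          (\<Sum>i<k. if i = count (mset xs) j then complex_of_real (t ^ i) * coord \<psi> xs else 0)"
        by (rule sum.cong) auto
      also have "\<dots> = (if count (mset xs) j < k then complex_of_real (t ^ count (mset xs) j) * coord \<psi> xs else 0)"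
        by simp
      finally have "coord \<phi> xs = complex_of_real (t ^ count (mset xs) j) * coord \<psi> xs -
          (if count (mset xs) j < k then complex_of_real (t ^ count (mset xs) j) * coord \<psi> xs else 0)"
        using t unfolding \<phi>_def by (simp add: coord_sum coord_diag power_le_one)
      moreover have "t ^ (m - k) = t ^ m / t ^ k" if "k \<le> m" for m
        using t that by (simp add: power_diff)
      ultimately show "coord (diag (f t) \<psi>) xs = coord (complex_of_real (1 / t ^ k) *\<^sub>C \<phi>) xs"
        using t f01[OF t] by (simp add: coord_diag) (simp add: f_def)
    qed
    ultimately show ?thesis using scl by simp
  qed
  have "(\<lambda>n. diag (f (inverse (real (Suc n)))) \<psi>) \<longlonglongrightarrow> diag (\<lambda>M. if count M j = k then 1 else 0) \<psi>"
  proof (rule tendsto_diag)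
    fix M
    consider "count M j < k" | "count M j = k" | "k < count M j" by linarith
    then show "(\<lambda>n. f (inverse (real (Suc n))) M) \<longlonglongrightarrow> (if count M j = k then 1 else 0)"
    proof cases
      case 3
      have "(\<lambda>n. inverse (real (Suc n)) ^ (count M j - k)) \<longlonglongrightarrow> 0 ^ (count M j - k)"
        by (intro tendsto_power LIMSEQ_inverse_real_of_nat)
      then show ?thesis using 3 LIMSEQ_inverse_real_of_nat by (simp add: f_def del: of_nat_Suc)
    qed (simp_all add: f_def)
  next
    fix n M
    show "0 \<le> f (inverse (real (Suc n))) M" by (simp add: f_def)
    show "f (inverse (real (Suc n))) M \<le> 1"
      unfolding f_def by (auto intro!: power_le_one simp: inverse_le_1_iff)
  qed auto
  then show ?case
    by (rule closed_sequentially[OF cl, rotated]) (rule mem, auto simp: inverse_le_1_iff)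
qed

lemma coord_number_basis:
  "coord (number_basis M) xs =
    (if mset xs = M then complex_of_real (1 / sqrt (card (permutations_of_multiset M))) else 0)"
  by (simp add: number_basis.rep_eq)

lemma card_permutations_of_multiset_pos: "0 < card (permutations_of_multiset M)"
  using permutations_of_multiset_not_empty[of M] by (simp add: card_gt_0_iff)

text \<open>There are finitely many modes, so cutting a vector off at particle number
  \<open>n\<close> leaves a finite combination of number states; the cut-offs converge to the
  vector.\<close>

lemma number_basis_total_csubspace:
  assumes X: "closed_csubspace X" and mem: "\<And>M. number_basis M \<in> X"
  shows "\<psi> \<in> X"
proof -
  have sub: "subspace X" and scl: "\<And>c \<psi>. \<psi> \<in> X \<Longrightarrow> c *\<^sub>C \<psi> \<in> X" and cl: "closed X"
    using X by (auto simp: closed_csubspace_def)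
  have fin: "finite {M :: 'a multiset. size M \<le> n}" for n
  proof -
    have "{M :: 'a multiset. size M \<le> n} \<subseteq> mset ` {xs. set xs \<subseteq> UNIV \<and> length xs \<le> n}"
    proof
      fix M :: "'a multiset" assume "M \<in> {M. size M \<le> n}"
      moreover obtain xs where "mset xs = M" using ex_mset by blast
      ultimately show "M \<in> mset ` {xs. set xs \<subseteq> UNIV \<and> length xs \<le> n}"
        by (auto intro!: image_eqI[of _ _ xs])
    qed
    then show ?thesis by (rule finite_subset) (use finite_lists_length_le[of "UNIV :: 'a set" n] in simp)
  qed
  have "diag (\<lambda>M. if size M \<le> n then 1 else 0) \<psi> =
      (\<Sum>M | size M \<le> n. cinner (number_basis M) \<psi> *\<^sub>C number_basis M)" for n
  proof (rule fock_eqI)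
    fix xs
    have "(\<Sum>M | size M \<le> n. cinner (number_basis M) \<psi> * coord (number_basis M) xs) =
      (\<Sum>M | size M \<le> n. if mset xs = M then cinner (number_basis (mset xs)) \<psi> * coord (number_basis (mset xs)) xs else 0)"
      by (rule sum.cong) (auto simp: coord_number_basis)
    also have "\<dots> = (if length xs \<le> n then cinner (number_basis (mset xs)) \<psi> * coord (number_basis (mset xs)) xs else 0)"
      using fin[of n] by (simp add: sum.delta)
    also have "cinner (number_basis (mset xs)) \<psi> * coord (number_basis (mset xs)) xs = coord \<psi> xs"
      using card_permutations_of_multiset_pos[of "mset xs"]
      by (simp add: cinner_number_basis[OF refl] coord_number_basis)
    finally show "coord (diag (\<lambda>M. if size M \<le> n then 1 else 0) \<psi>) xs =
        coord (\<Sum>M | size M \<le> n. cinner (number_basis M) \<psi> *\<^sub>C number_basis M) xs"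
      by (simp add: coord_sum coord_diag)
  qed
  then have "diag (\<lambda>M. if size M \<le> n then 1 else 0) \<psi> \<in> X" for n
    by (simp only:) (intro subspace_sum sub scl mem)
  moreover have "(\<lambda>n. diag (\<lambda>M. if size M \<le> n then 1 else 0) \<psi>) \<longlonglongrightarrow> diag (\<lambda>M. 1) \<psi>"
  proof (rule tendsto_diag)
    fix M :: "'a multiset"
    show "(\<lambda>n. if size M \<le> n then 1 else (0::real)) \<longlonglongrightarrow> 1"
      by (rule tendsto_eventually) (auto simp: eventually_sequentially intro!: exI[of _ "size M"])
  qed auto
  ultimately have "diag (\<lambda>M. 1) \<psi> \<in> X" by (rule closed_sequentially[OF cl])
  moreover have "diag (\<lambda>M. 1) \<psi> = \<psi>" by (rule fock_eqI) (simp add: coord_diag)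
  ultimately show ?thesis by simp
qed

text \<open>The closed span is invariant under every \<open>t ^ N\<^sub>j\<close>, hence under the
  projections onto fixed occupation numbers. Applied mode by mode to a single exponential vector,
  these isolate each number state.\<close>

lemma exp_vec_real_total: "clcspan (range (\<lambda>v. exp_vec (rvec v))) = UNIV"
proof -
  define X where "X = clcspan (range (\<lambda>v :: real ^ 'a. exp_vec (rvec v)))"
  have X: "closed_csubspace X" unfolding X_def by (rule closed_csubspace_clcspan)
  have exp_mem: "exp_vec (rvec v) \<in> X" for v
    using clcspan_superset[of "exp_vec (rvec v)" _ 1] unfolding X_def by auto
  have inv: "diag (\<lambda>M. t ^ count M j) \<psi> \<in> X" if "0 \<le> t" "t \<le> 1" "\<psi> \<in> X" for t j \<psi>
    using \<open>\<psi> \<in> X\<close>[unfolded X_def]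
    by (rule clcspan_minimal[OF bounded_op_diag X, rotated]) (use that in \<open>auto simp: diag_exp_vec exp_mem\<close>)
  have nb: "number_basis M \<in> X" for M :: "'a multiset"
  proof -
    \<comment> \<open>The all-ones vector has nonzero overlap with every number state.\<close>
    let ?e = "exp_vec (rvec (\<chi> i. 1)) :: 'a fock"
    have "diag (\<lambda>M'. if \<forall>j\<in>J. count M' j = count M j then 1 else 0) ?e \<in> X" if "finite J" for J
      using that
    proof induction
      case empty
      have "diag (\<lambda>M'. 1) ?e = ?e" by (rule fock_eqI) (simp add: coord_diag)
      then show ?case using exp_mem by simp
    next
      case (insert j J)
      have "diag (\<lambda>M'. if \<forall>i\<in>insert j J. count M' i = count M i then 1 else 0) ?e =
          diag (\<lambda>M'. if count M' j = count M j then 1 else 0)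
            (diag (\<lambda>M'. if \<forall>j\<in>J. count M' j = count M j then 1 else 0) ?e)"
        by (rule fock_eqI) (simp add: coord_diag)
      then show ?case using diag_count_eq_mem[OF X insert.IH inv] by simp
    qed
    from this[of UNIV] have mem: "diag (\<lambda>M'. if M' = M then 1 else 0) ?e \<in> X"
      by (simp add: multiset_eq_iff)
    have "number_basis M = complex_of_real (sqrt (fact (size M)) / sqrt (card (permutations_of_multiset M))) *\<^sub>C
        diag (\<lambda>M'. if M' = M then 1 else 0) ?e"
      by (rule fock_eqI) (auto simp: coord_number_basis coord_diag exp_vec.rep_eq rvec_def map_replicate_const)
    then show ?thesis using mem X by (simp add: closed_csubspace_def)
  qed
  show ?thesis using number_basis_total_csubspace[OF X nb] unfolding X_def by auto
qed

text \<open>Words are grouped by their multiset. All words of a group have the same coordinate, so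
  the group sum is its size times one term, which matches the normalisation of
  \<open>number_basis M\<close>.\<close>

lemma parseval_number_basis:
  "((\<lambda>M. cinner \<psi> (number_basis M) * cinner (number_basis M) \<phi>) has_sum cinner \<psi> \<phi>) UNIV"
proof -
  let ?P = "permutations_of_multiset :: 'a multiset \<Rightarrow> _"
  have "bij_betw (\<lambda>xs. (mset xs, xs)) (UNIV :: 'a list set) (Sigma UNIV ?P)"
    by (rule bij_betwI[of _ _ _ snd]) (auto simp: permutations_of_multiset_def)
  then have "((\<lambda>(M, xs). cnj (coord \<psi> xs) * coord \<phi> xs) has_sum cinner \<psi> \<phi>) (Sigma UNIV ?P)"
    using cinner_has_sum[of \<psi> \<phi>]
    by (subst has_sum_reindex_bij_betw[symmetric]) auto
  then show ?thesis
  proof (rule has_sum_SigmaD)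
    fix M :: "'a multiset"
    obtain xs where xs: "mset xs = M" using ex_mset by blast
    have "(\<Sum>ys\<in>?P M. cnj (coord \<psi> ys) * coord \<phi> ys) = (\<Sum>ys\<in>?P M. cnj (coord \<psi> xs) * coord \<phi> xs)"
      by (intro sum.cong refl arg_cong2[where f = "(*)"] arg_cong[where f = cnj] coord_mset)
        (auto simp: permutations_of_multiset_def xs)
    also have "\<dots> = complex_of_real (sqrt (card (?P M)) * sqrt (card (?P M))) * (cnj (coord \<psi> xs) * coord \<phi> xs)"
      by simp
    also have "\<dots> = cinner \<psi> (number_basis M) * cinner (number_basis M) \<phi>"
      by (subst cinner_commute) (simp only: cinner_number_basis[OF xs] complex_cnj_mult
          complex_cnj_complex_of_real of_real_mult mult_ac)
    finally show "((\<lambda>xs. case (M, xs) of (M, xs) \<Rightarrow> cnj (coord \<psi> xs) * coord \<phi> xs) has_sum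
        cinner \<psi> (number_basis M) * cinner (number_basis M) \<phi>) (?P M)"
      by (simp add: has_sum_finite_iff)
  qed
qed

lemma norm_parseval_number_basis:
  "((\<lambda>M. (cmod (cinner (number_basis M) \<psi>))\<^sup>2) has_sum (norm \<psi>)\<^sup>2) UNIV"
proof -
  have "Re (cinner \<psi> (number_basis M) * cinner (number_basis M) \<psi>) = (cmod (cinner (number_basis M) \<psi>))\<^sup>2" for M
    by (subst cinner_commute) (simp add: cmod_power2, simp add: power2_eq_square)
  then show ?thesis
    using has_sum_Re[OF parseval_number_basis[of \<psi> \<psi>]] by (simp add: cinner_self)
qed

section \<open>Unitary extension and the Weyl operators\<close>

lemma bounded_op_add: "bounded_op T \<Longrightarrow> T (\<psi> + \<phi>) = T \<psi> + T \<phi>"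
  by (simp add: bounded_op_linear linear_add)

lemma bounded_op_scaleC: "bounded_op T \<Longrightarrow> T (c *\<^sub>C \<psi>) = c *\<^sub>C T \<psi>"
  by (simp add: bounded_op_def)

lemma bounded_op_comp: "bounded_op S \<Longrightarrow> bounded_op T \<Longrightarrow> bounded_op (S \<circ> T)"
  by (auto simp: bounded_op_def o_def intro: bounded_linear_compose)

lemma bounded_op_scale: "bounded_op T \<Longrightarrow> bounded_op (\<lambda>\<psi>. c *\<^sub>C T \<psi>)"
  by (auto simp: bounded_op_def mult.commute intro: bounded_linear_compose[OF bounded_linear_scaleC])

lemma bounded_op_diff: "bounded_op S \<Longrightarrow> bounded_op T \<Longrightarrow> bounded_op (\<lambda>\<psi>. S \<psi> - T \<psi>)"
  by (auto simp: bounded_op_def scaleC_diff_right intro: bounded_linear_sub)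

lemma closed_csubspace_zero: "closed_csubspace {0}"
  by (simp add: closed_csubspace_def subspace_def)

lemma bounded_op_eqI:
  assumes S: "bounded_op S" and T: "bounded_op T" and G: "clcspan G = UNIV"
    and eq: "\<And>g. g \<in> G \<Longrightarrow> S g = T g"
  shows "S = T"
proof
  fix \<psi>
  have "S \<psi> - T \<psi> \<in> {0}"
    by (rule clcspan_minimal[OF bounded_op_diff[OF S T] closed_csubspace_zero, of G]) (auto simp: eq G)
  then show "S \<psi> = T \<psi>" by simp
qed

text \<open>The defect from linearity is orthogonal to the range of \<open>W\<close>, which is the
  whole space. Linearity, boundedness and injectivity thus all come from preservation of inner
  products.\<close>

lemma unitary_opI:
  assumes pres: "\<And>\<psi> \<phi>. cinner (W \<psi>) (W \<phi>) = cinner \<psi> \<phi>" and "surj W"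
  shows "unitary_op W"
proof -
  have zero: "d = 0" if d: "\<And>\<eta>. cinner d (W \<eta>) = 0" for d
  proof -
    obtain \<eta> where "d = W \<eta>" using \<open>surj W\<close> by (metis surjD)
    then have "cinner d d = 0" using d by metis
    then show ?thesis by (simp add: cinner_self)
  qed
  have add: "W (\<psi> + \<phi>) = W \<psi> + W \<phi>" for \<psi> \<phi>
    using zero[of "W (\<psi> + \<phi>) - (W \<psi> + W \<phi>)"]
    by (simp add: cinner_diff_left cinner_add_left pres)
  have scl: "W (c *\<^sub>C \<psi>) = c *\<^sub>C W \<psi>" for c \<psi>
    using zero[of "W (c *\<^sub>C \<psi>) - c *\<^sub>C W \<psi>"]
    by (simp add: cinner_diff_left cinner_scaleC_left pres)
  have "complex_of_real ((norm (W \<psi>))\<^sup>2) = complex_of_real ((norm \<psi>)\<^sup>2)" for \<psi>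
    using pres[of \<psi> \<psi>] by (simp only: cinner_self)
  then have norm: "norm (W \<psi>) = norm \<psi>" for \<psi>
    by (simp only: of_real_eq_iff) (simp add: power2_eq_iff_nonneg)
  have "bounded_linear W"
    by (rule bounded_linear_intro[where K = 1]) (simp_all add: add scl norm scaleR_scaleC_fock)
  moreover have "inj W"
  proof (rule injI)
    fix \<psi> \<phi> assume "W \<psi> = W \<phi>"
    then have "W (\<psi> - \<phi>) = 0" using \<open>bounded_linear W\<close> by (simp add: bounded_linear.linear linear_diff)
    then show "\<psi> = \<phi>" using norm[of "\<psi> - \<phi>"] by simp
  qed
  ultimately show ?thesis
    using \<open>surj W\<close> by (simp add: unitary_op_def bounded_op_def bij_def scl pres)
qed

text \<open>\<open>G\<close> will be the graph of an isometry and \<open>f\<close> one of its two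
  projections. On the graph a projection preserves norms up to the factor \<open>sqrt 2\<close>, so
  its image is complete, hence closed; a closed subspace containing a total set is
  everything.\<close>

lemma total_fst_image:
  fixes G :: "('n::finite fock \<times> 'n fock) set"
  assumes sub: "subspace G" and "closed G" and f: "bounded_linear f"
    and norm: "\<And>p. p \<in> G \<Longrightarrow> norm (fst p) = norm (snd p)"
    and normf: "\<And>p. p \<in> G \<Longrightarrow> norm (f p) = norm (fst p)"
    and E: "clcspan (range E) = UNIV" and mem: "\<And>c i. c *\<^sub>C E i \<in> f ` G"
  shows "f ` G = UNIV"
proof -
  have "complete (f ` G)"
  proof (rule complete_isometric_image[OF _ sub f])
    show "\<forall>p\<in>G. 1 / sqrt 2 * norm p \<le> norm (f p)"
    proof
      fix p assume p: "p \<in> G"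
      have "norm p = sqrt 2 * norm (fst p)"
        using norm[OF p] by (simp add: norm_prod_def real_sqrt_mult)
      then show "1 / sqrt 2 * norm p \<le> norm (f p)" by (simp add: normf[OF p])
    qed
    show "complete G" using \<open>closed G\<close> by (simp add: complete_eq_closed)
  qed simp
  then have "closed (f ` G)" by (rule complete_imp_closed)
  moreover have "span {c *\<^sub>C g | c g. g \<in> range E} \<subseteq> f ` G"
    by (rule span_minimal) (use mem in \<open>auto intro: linear_subspace_image[OF bounded_linear.linear[OF f] sub]\<close>)
  ultimately have "clcspan (range E) \<subseteq> f ` G"
    unfolding clcspan_def by (intro closure_minimal)
  then show ?thesis using E by auto
qed

text \<open>The operator is built as a graph, the closed span of the pairs
  \<open>(c *\<^sub>C E i, c *\<^sub>C F i)\<close>. Equal Gram matrices make the two components of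
  a graph point equally long, which gives single-valuedness; totality of both families makes both
  projections onto.\<close>

lemma unitary_extension:
  fixes E F :: "'i \<Rightarrow> 'n::finite fock"
  assumes gram: "\<And>i j. cinner (E i) (E j) = cinner (F i) (F j)"
    and E: "clcspan (range E) = UNIV" and F: "clcspan (range F) = UNIV"
  obtains W where "unitary_op W" "\<And>i. W (E i) = F i"
proof -
  define S where "S = {(c *\<^sub>C E i, c *\<^sub>C F i) | c i. True}"
  define G where "G = closure (span S)"
  define P where "P p q \<longleftrightarrow> cinner (fst p) (fst q) = cinner (snd p) (snd q)" for p q :: "'n fock \<times> 'n fock"
  have sub1: "subspace {p. P p q}" for q
    by (auto simp: subspace_def P_def cinner_add_left cinner_scaleC_left scaleR_scaleC_fock)
  have sub2: "subspace {q. P p q}" for p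
    by (auto simp: subspace_def P_def cinner_add_right cinner_scaleC_right scaleR_scaleC_fock)
  have cl1: "closed {p. P p q}" for q
    unfolding P_def by (intro closed_Collect_eq continuous_intros)
  have cl2: "closed {q. P p q}" for p
    unfolding P_def by (intro closed_Collect_eq continuous_intros)
  \<comment> \<open>The identity \<open>P\<close> is carried from the generators to their closed
    span one argument at a time.\<close>
  have "S \<subseteq> {p. P p q}" if "q \<in> S" for q
    using that by (auto simp: S_def P_def cinner_scaleC_left cinner_scaleC_right gram)
  then have "G \<subseteq> {p. P p q}" if "q \<in> S" for q
    unfolding G_def using that by (intro closure_minimal span_minimal sub1 cl1) auto
  then have "S \<subseteq> {q. P p q}" if "p \<in> G" for p using that by auto
  then have "G \<subseteq> {q. P p q}" if "p \<in> G" for p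
    unfolding G_def by (intro closure_minimal span_minimal sub2 cl2) (use that G_def in auto)
  then have P: "P p q" if "p \<in> G" "q \<in> G" for p q
    using that by (metis mem_Collect_eq subsetD)
  have norm: "norm (fst p) = norm (snd p)" if "p \<in> G" for p
  proof -
    have "(norm (fst p))\<^sup>2 = (norm (snd p))\<^sup>2"
      using P[OF that that] unfolding P_def cinner_self by (simp only: of_real_eq_iff)
    then show ?thesis by (simp add: power2_eq_iff_nonneg)
  qed
  have sub: "subspace G" unfolding G_def by (intro subspace_closure subspace_span)
  have cl: "closed G" unfolding G_def by simp
  have mem: "(c *\<^sub>C E i, c *\<^sub>C F i) \<in> G" for c i
    unfolding G_def S_def by (rule subsetD[OF closure_subset], rule span_base) blast
  have "fst ` G = UNIV"
    by (rule total_fst_image[OF sub cl bounded_linear_fst norm refl E]) (force intro: mem image_eqI)+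
  moreover have "snd ` G = UNIV"
    by (rule total_fst_image[OF sub cl bounded_linear_snd norm norm[symmetric] F]) (force intro: mem image_eqI)+
  \<comment> \<open>The difference of the two points is \<open>(0, b - b')\<close>, and its
    components have equal norm.\<close>
  moreover have uniq: "b = b'" if "(a, b) \<in> G" "(a, b') \<in> G" for a b b'
    using norm[OF subspace_diff[OF sub that]] by simp
  moreover define W where "W a = (THE b. (a, b) \<in> G)" for a
  ultimately have W: "(a, W a) \<in> G" for a
  proof -
    obtain b where "(a, b) \<in> G" using \<open>fst ` G = UNIV\<close> by (metis UNIV_I imageE prod.collapse)
    then show ?thesis unfolding W_def by (rule theI) (rule uniq[OF _ \<open>(a, b) \<in> G\<close>])
  qed
  have W_eq: "W a = b" if "(a, b) \<in> G" for a b using uniq[OF W that] .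
  have "unitary_op W"
  proof (rule unitary_opI)
    show "cinner (W \<psi>) (W \<phi>) = cinner \<psi> \<phi>" for \<psi> \<phi>
      using P[OF W W] by (simp add: P_def)
    show "surj W"
    proof (rule surjI)
      fix b show "W (SOME a. (a, b) \<in> G) = b"
      proof (rule W_eq, rule someI_ex)
        show "\<exists>a. (a, b) \<in> G" using \<open>snd ` G = UNIV\<close> by (metis UNIV_I imageE prod.collapse)
      qed
    qed
  qed
  moreover have "W (E i) = F i" for i using W_eq mem[of 1 i] by simp
  ultimately show ?thesis using that by blast
qed

section \<open>Inner products of exponential vectors\<close>

lemma sum_prod_list_words_comm_semiring:
  fixes f :: "'n::finite \<Rightarrow> 'a::comm_semiring_1"
  shows "(\<Sum>xs | length xs = r. \<Prod>x\<leftarrow>xs. f x) = (\<Sum>x\<in>UNIV. f x) ^ r"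
proof (induction r)
  case (Suc r)
  have eq: "{xs :: 'n list. length xs = Suc r} = (\<lambda>(x, xs). x # xs) ` (UNIV \<times> {xs. length xs = r})"
    by (auto simp: length_Suc_conv image_iff)
  have "(\<Sum>xs | length xs = Suc r. \<Prod>x\<leftarrow>xs. f x) =
        (\<Sum>(x, xs)\<in>UNIV \<times> {xs. length xs = r}. f x * (\<Prod>x\<leftarrow>xs. f x))"
    unfolding eq by (subst sum.reindex) (auto simp: inj_on_def case_prod_unfold)
  also have "\<dots> = (\<Sum>x\<in>UNIV. f x) * (\<Sum>xs | length xs = r. \<Prod>x\<leftarrow>xs. f x)"
    by (simp add: sum_product sum.cartesian_product)
  finally show ?case by (simp add: Suc.IH)
qed simp

lemma finite_words [simp]: "finite {xs :: 'n::finite list. length xs = r}"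
  using finite_lists_length_eq[of "UNIV :: 'n set" r] by simp

lemma bij_betw_words: "bij_betw (\<lambda>xs. (length xs, xs)) UNIV (Sigma UNIV (\<lambda>r. {xs. length xs = r}))"
  by (rule bij_betwI[of _ _ _ snd]) auto

text \<open>Words of length \<open>r\<close> contribute \<open>cdot u v ^ r / fact r\<close> by the
  multinomial expansion, and summing over \<open>r\<close> gives the exponential series.\<close>

lemma cinner_exp_vec: "cinner (exp_vec u) (exp_vec v) = exp (cdot u v)"
proof -
  let ?g = "\<lambda>xs. (\<Prod>x\<leftarrow>xs. cnj (u $ x) * v $ x) / fact (length xs)"
  have coord: "cnj (coord (exp_vec u) xs) * coord (exp_vec v) xs = ?g xs" for xs
  proof -
    have "cnj (\<Prod>x\<leftarrow>xs. u $ x) * (\<Prod>x\<leftarrow>xs. v $ x) = (\<Prod>x\<leftarrow>xs. cnj (u $ x) * v $ x)"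
      by (induction xs) (auto simp: mult_ac)
    moreover have "complex_of_real (sqrt (fact (length xs))) * complex_of_real (sqrt (fact (length xs))) = fact (length xs)"
      by (simp flip: of_real_mult)
    ultimately show ?thesis by (simp add: exp_vec.rep_eq)
  qed
  have "(?g has_sum cinner (exp_vec u) (exp_vec v)) UNIV"
    using cinner_has_sum[of "exp_vec u" "exp_vec v"] unfolding coord .
  then have "((\<lambda>(r, xs). ?g xs) has_sum cinner (exp_vec u) (exp_vec v)) (Sigma UNIV (\<lambda>r. {xs. length xs = r}))"
    by (subst has_sum_reindex_bij_betw[OF bij_betw_words, symmetric]) simp
  then have "((\<lambda>r. cdot u v ^ r / fact r) has_sum cinner (exp_vec u) (exp_vec v)) UNIV"
  proof (rule has_sum_SigmaD)
    fix r
    have "(\<Sum>xs | length xs = r. ?g xs) = (\<Sum>xs | length xs = r. \<Prod>x\<leftarrow>xs. cnj (u $ x) * v $ x) / fact r"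
      by (simp add: sum_divide_distrib)
    also have "\<dots> = cdot u v ^ r / fact r"
      by (simp add: sum_prod_list_words_comm_semiring cdot_def)
    finally show "((\<lambda>xs. case (r, xs) of (r, xs) \<Rightarrow> ?g xs) has_sum cdot u v ^ r / fact r) {xs. length xs = r}"
      by (simp add: has_sum_finite_iff)
  qed
  then have "(\<lambda>r. cdot u v ^ r / fact r) sums cinner (exp_vec u) (exp_vec v)"
    by (rule has_sum_imp_sums)
  moreover have "(\<lambda>r. cdot u v ^ r / fact r) sums exp (cdot u v)"
    using exp_converges[of "cdot u v"] by (simp add: scaleR_conv_of_real divide_inverse mult.commute)
  ultimately show ?thesis by (rule sums_unique2)
qed

lemma cdot_add_left: "cdot (u + v) w = cdot u w + cdot v w"
  by (simp add: cdot_def sum.distrib algebra_simps)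

lemma cdot_add_right: "cdot w (u + v) = cdot w u + cdot w v"
  by (simp add: cdot_def sum.distrib algebra_simps)

lemma cdot_minus_left: "cdot (- u) v = - cdot u v"
  by (simp add: cdot_def sum_negf)

lemma cdot_commute: "cdot v u = cnj (cdot u v)"
  by (simp add: cdot_def mult.commute)

lemma cdot_self: "cdot u u = complex_of_real ((norm u)\<^sup>2)"
proof -
  have "(norm u)\<^sup>2 = (\<Sum>j\<in>UNIV. (cmod (u $ j))\<^sup>2)"
    by (simp add: norm_vec_def L2_set_def sum_nonneg)
  then show ?thesis
    by (simp only: cdot_def of_real_sum complex_norm_square mult.commute)
qed

lemma norm_add_cdot: "(norm (u + v))\<^sup>2 = (norm u)\<^sup>2 + (norm v)\<^sup>2 + 2 * Re (cdot u v)"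
proof -
  have "complex_of_real ((norm (u + v))\<^sup>2) = cdot (u + v) (u + v)" by (rule cdot_self[symmetric])
  also have "\<dots> = complex_of_real ((norm u)\<^sup>2) + complex_of_real ((norm v)\<^sup>2) + (cdot u v + cnj (cdot u v))"
    by (simp only: cdot_add_left cdot_add_right) (simp add: cdot_self cdot_commute[of v u])
  also have "\<dots> = complex_of_real ((norm u)\<^sup>2 + (norm v)\<^sup>2 + 2 * Re (cdot u v))"
    by (simp add: complex_add_cnj)
  finally show ?thesis by (simp only: of_real_eq_iff)
qed

section \<open>Existence, uniqueness and composition of the Weyl operators\<close>

definition weyl_factor :: "complex ^ 'n::finite \<Rightarrow> complex ^ 'n \<Rightarrow> complex" where
  "weyl_factor u v = exp (- complex_of_real ((norm u)\<^sup>2) / 2 - cdot u v)"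

lemma exp_vec_total: "clcspan (range exp_vec) = UNIV"
proof -
  have "\<psi> \<in> clcspan (range exp_vec)" for \<psi> :: "'a fock"
  proof -
    have "id \<psi> \<in> clcspan (range exp_vec)"
      by (rule clcspan_minimal[OF bounded_op_id closed_csubspace_clcspan, of "range (\<lambda>v. exp_vec (rvec v))"])
        (use clcspan_superset[of _ "range exp_vec" 1] in \<open>auto simp: exp_vec_real_total\<close>)
    then show ?thesis by simp
  qed
  then show ?thesis by auto
qed

text \<open>The scalar factor is exactly what keeps the Gram matrix of the exponential vectors
  unchanged under translation by \<open>u\<close>, and the translated family is total again because
  the factors do not vanish.\<close>

lemma weyl_exists: "\<exists>W. unitary_op W \<and> (\<forall>v. W (exp_vec v) = weyl_factor u v *\<^sub>C exp_vec (u + v))"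
proof -
  define F where "F v = weyl_factor u v *\<^sub>C exp_vec (u + v)" for v
  have "cinner (exp_vec v) (exp_vec w) = cinner (F v) (F w)" for v w
  proof -
    have "cinner (F v) (F w) = exp (cnj (- complex_of_real ((norm u)\<^sup>2) / 2 - cdot u v) +
        (- complex_of_real ((norm u)\<^sup>2) / 2 - cdot u w) + cdot (u + v) (u + w))"
      by (simp add: F_def weyl_factor_def cinner_scaleC_left cinner_scaleC_right cinner_exp_vec exp_cnj algebra_simps flip: exp_add)
    also have "\<dots> = exp (cdot v w)"
      by (rule arg_cong[where f = exp]) (simp add: cdot_add_left cdot_add_right cdot_self cdot_commute[of v u])
    finally show ?thesis by (simp add: cinner_exp_vec)
  qed
  moreover have "clcspan (range F) = UNIV"
  proof -
    have mem: "exp_vec w \<in> clcspan (range F)" for w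
    proof -
      have "exp_vec w = (1 / weyl_factor u (w - u)) *\<^sub>C F (w - u)"
        by (simp add: F_def weyl_factor_def)
      then show ?thesis using clcspan_superset[of "F (w - u)" "range F"] by simp
    qed
    have "id \<psi> \<in> clcspan (range F)" for \<psi>
      by (rule clcspan_minimal[OF bounded_op_id closed_csubspace_clcspan, of "range exp_vec"])
        (auto simp: mem exp_vec_total)
    then show ?thesis by auto
  qed
  ultimately obtain W where "unitary_op W" "\<And>v. W (exp_vec v) = F v"
    using unitary_extension[OF _ exp_vec_total] by metis
  then show ?thesis unfolding F_def by blast
qed

text \<open>The prescribed values determine the operator on a total set, so the definite description
  in \<open>weyl\<close> denotes it.\<close>

lemma weyl_spec: "unitary_op (weyl u) \<and> (\<forall>v. weyl u (exp_vec v) = weyl_factor u v *\<^sub>C exp_vec (u + v))"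
proof -
  obtain W where W: "unitary_op W \<and> (\<forall>v. W (exp_vec v) = weyl_factor u v *\<^sub>C exp_vec (u + v))"
    using weyl_exists by blast
  have "\<exists>!W. unitary_op W \<and> (\<forall>v. W (exp_vec v) = weyl_factor u v *\<^sub>C exp_vec (u + v))"
  proof (rule ex1I, rule W)
    fix W' assume W': "unitary_op W' \<and> (\<forall>v. W' (exp_vec v) = weyl_factor u v *\<^sub>C exp_vec (u + v))"
    show "W' = W"
      by (rule bounded_op_eqI[OF _ _ exp_vec_total]) (use W W' in \<open>auto simp: unitary_op_def\<close>)
  qed
  from theI'[OF this] show ?thesis unfolding weyl_def weyl_factor_def .
qed

lemma unitary_weyl: "unitary_op (weyl u)"
  and weyl_exp_vec: "weyl u (exp_vec v) = weyl_factor u v *\<^sub>C exp_vec (u + v)"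
  using weyl_spec by blast+

lemma bounded_op_unitary: "unitary_op U \<Longrightarrow> bounded_op U"
  by (simp add: unitary_op_def)

text \<open>Both sides are bounded operators, so it is enough to compare exponents on exponential
  vectors; the norm terms cancel the real part of \<open>cdot z u\<close> and leave the
  phase.\<close>

lemma weyl_weyl: "weyl z (weyl u \<psi>) = exp (- \<i> * Im (cdot z u)) *\<^sub>C weyl (z + u) \<psi>"
proof -
  have "weyl z \<circ> weyl u = (\<lambda>\<psi>. exp (- \<i> * Im (cdot z u)) *\<^sub>C weyl (z + u) \<psi>)"
  proof (rule bounded_op_eqI[OF _ _ exp_vec_total])
    fix g :: "'a fock" assume "g \<in> range exp_vec"
    then obtain v where g: "g = exp_vec v" by blast
    \<comment> \<open>Writing both parts through \<open>cdot z u\<close> and its conjugate makes the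
      comparison of the exponents linear in these two quantities.\<close>
    have re: "complex_of_real (Re (cdot z u)) = (cdot z u + cnj (cdot z u)) / 2"
      by (simp add: complex_add_cnj)
    have im: "\<i> * complex_of_real (Im (cdot z u)) = (cdot z u - cnj (cdot z u)) / 2"
      by (simp add: complex_diff_cnj)
    have "weyl_factor u v * weyl_factor z (u + v) = exp (- \<i> * Im (cdot z u)) * weyl_factor (z + u) v"
      unfolding weyl_factor_def exp_add[symmetric]
    proof (rule arg_cong[where f = exp])
      show "- complex_of_real ((norm u)\<^sup>2) / 2 - cdot u v + (- complex_of_real ((norm z)\<^sup>2) / 2 - cdot z (u + v)) =
        - \<i> * complex_of_real (Im (cdot z u)) + (- complex_of_real ((norm (z + u))\<^sup>2) / 2 - cdot (z + u) v)"
        unfolding norm_add_cdot of_real_add of_real_mult cdot_add_left cdot_add_right re minus_mult_left[symmetric] im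
        by (simp add: field_simps)
    qed
    then show "(weyl z \<circ> weyl u) g = exp (- \<i> * Im (cdot z u)) *\<^sub>C weyl (z + u) g"
      by (simp add: g weyl_exp_vec bounded_op_scaleC[OF bounded_op_unitary[OF unitary_weyl]] add.assoc)
  qed (intro bounded_op_comp bounded_op_scale bounded_op_unitary unitary_weyl)+
  then show ?thesis by (metis comp_apply)
qed

lemma weyl_zero: "weyl 0 = id"
  by (rule bounded_op_eqI[OF bounded_op_unitary[OF unitary_weyl] bounded_op_id exp_vec_total])
    (auto simp: weyl_exp_vec weyl_factor_def cdot_def)

lemma weyl_minus: "weyl (- u) (weyl u \<psi>) = \<psi>"
  by (simp add: weyl_weyl cdot_minus_left cdot_self weyl_zero)

lemma inv_weyl: "inv (weyl u) = weyl (- u)"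
  by (rule inv_unique_comp) (auto simp: fun_eq_iff weyl_minus weyl_minus[of "- u", simplified])

lemma unitary_inv_apply [simp]:
  assumes "unitary_op U"
  shows "inv U (U \<psi>) = \<psi>" "U (inv U \<psi>) = \<psi>"
  using assms by (auto simp: unitary_op_def bij_is_inj bij_is_surj surj_f_inv_f)

lemma unitary_cinner: "unitary_op U \<Longrightarrow> cinner (U \<psi>) (U \<phi>) = cinner \<psi> \<phi>"
  by (simp add: unitary_op_def)

lemma unitary_cinner_inv: "unitary_op U \<Longrightarrow> cinner \<psi> (inv U \<phi>) = cinner (U \<psi>) \<phi>"
  by (metis unitary_cinner unitary_inv_apply(2))

lemma unitary_cinner_inv_left: "unitary_op U \<Longrightarrow> cinner (inv U \<psi>) \<phi> = cinner \<psi> (U \<phi>)"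
  by (metis unitary_cinner unitary_inv_apply(2))

lemma unitary_norm: "unitary_op U \<Longrightarrow> norm (U \<psi>) = norm \<psi>"
  by (simp add: norm_eq_sqrt_inner inner_fock_def unitary_cinner)

lemma unitary_id: "unitary_op id"
  by (rule unitary_opI) auto

lemma adj_op_unitary:
  assumes "unitary_op U"
  shows "adj_op U = inv U"
  unfolding adj_op_def
proof (rule the_equality)
  show "\<forall>\<psi> \<phi>. cinner (inv U \<psi>) \<phi> = cinner \<psi> (U \<phi>)" using assms by (simp add: unitary_cinner_inv_left)
  fix T assume T: "\<forall>\<psi> \<phi>. cinner (T \<psi>) \<phi> = cinner \<psi> (U \<phi>)"
  show "T = inv U"
  proof
    fix \<psi>
    have "cinner (T \<psi> - inv U \<psi>) (T \<psi> - inv U \<psi>) = 0"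
      using T assms by (simp add: cinner_diff_left unitary_cinner_inv_left)
    then show "T \<psi> = inv U \<psi>" by (simp add: cinner_self)
  qed
qed

section \<open>Decomposition of states into vector states\<close>

text \<open>Collects the properties of a positive operator that a Cholesky step preserves.\<close>

definition pos_form :: "'n::finite operator \<Rightarrow> bool" where
  "pos_form R \<longleftrightarrow> (\<forall>\<psi> \<phi>. R (\<psi> + \<phi>) = R \<psi> + R \<phi>) \<and> (\<forall>c \<psi>. R (c *\<^sub>C \<psi>) = c *\<^sub>C R \<psi>) \<and>
     (\<forall>\<psi> \<phi>. cinner (R \<psi>) \<phi> = cinner \<psi> (R \<phi>)) \<and> (\<forall>\<psi>. 0 \<le> Re (cinner \<psi> (R \<psi>)))"

lemma pos_formD:
  assumes "pos_form R"
  shows "R (\<psi> + \<phi>) = R \<psi> + R \<phi>" "R (c *\<^sub>C \<psi>) = c *\<^sub>C R \<psi>"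
    "cinner (R \<psi>) \<phi> = cinner \<psi> (R \<phi>)" "0 \<le> Re (cinner \<psi> (R \<psi>))"
  using assms by (auto simp: pos_form_def)

lemma pos_form_self:
  assumes "pos_form R"
  shows "cinner \<psi> (R \<psi>) = complex_of_real (Re (cinner \<psi> (R \<psi>)))"
proof -
  have "cnj (cinner \<psi> (R \<psi>)) = cinner \<psi> (R \<psi>)"
    using pos_formD(3)[OF assms, of \<psi> \<psi>] cinner_commute[of "R \<psi>" \<psi>] by simp
  then show ?thesis by (simp add: complex_eq_iff)
qed

text \<open>Polarisation: real values of the form at \<psi> + \<phi> and at \<psi> + i \<phi> force
  it to be Hermitian.\<close>

lemma positive_op_pos_form:
  assumes "positive_op R"
  shows "pos_form R"
proof -
  have B: "bounded_op R" and pos: "\<And>\<psi>. cinner \<psi> (R \<psi>) \<in> \<real>\<^sub>\<ge>\<^sub>0"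
    using assms by (auto simp: positive_op_def)
  have Im: "Im (cinner \<psi> (R \<psi>)) = 0" for \<psi>
    using pos[of \<psi>] by (simp add: complex_nonneg_Reals_iff)
  have "cinner (R \<psi>) \<phi> = cinner \<psi> (R \<phi>)" for \<psi> \<phi>
  proof -
    have "Im (cinner \<psi> (R \<phi>) + cinner \<phi> (R \<psi>)) = 0"
      using Im[of "\<psi> + \<phi>"] Im[of \<psi>] Im[of \<phi>]
      by (simp add: bounded_op_add[OF B] cinner_add_left cinner_add_right)
    moreover have "Re (cinner \<psi> (R \<phi>) - cinner \<phi> (R \<psi>)) = 0"
      using Im[of "\<psi> + \<i> *\<^sub>C \<phi>"] Im[of \<psi>] Im[of \<phi>]
      by (simp add: bounded_op_add[OF B] bounded_op_scaleC[OF B] cinner_add_left cinner_add_right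
          cinner_scaleC_left cinner_scaleC_right)
    ultimately have "cnj (cinner \<phi> (R \<psi>)) = cinner \<psi> (R \<phi>)" by (simp add: complex_eq_iff)
    then show ?thesis using cinner_commute[of "R \<psi>" \<phi>] by simp
  qed
  moreover have "0 \<le> Re (cinner \<psi> (R \<psi>))" for \<psi>
    using pos[of \<psi>] by (simp add: complex_nonneg_Reals_iff)
  ultimately show ?thesis
    unfolding pos_form_def using bounded_op_add[OF B] bounded_op_scaleC[OF B] by blast
qed

text \<open>The form is nonnegative at \<open>\<psi> + l *\<^sub>C b\<close>; choosing
  \<open>l\<close> as a real multiple of \<open>z\<close> turns this into a real quadratic
  inequality in the parameter \<open>t\<close>.\<close>

lemma pos_form_Cauchy_Schwarz:
  assumes R: "pos_form R"
  shows "(cmod (cinner b (R \<psi>)))\<^sup>2 \<le> Re (cinner b (R b)) * Re (cinner \<psi> (R \<psi>))"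
proof -
  define q where "q \<psi> = Re (cinner \<psi> (R \<psi>))" for \<psi>
  define z where "z = cinner b (R \<psi>)"
  have z': "cinner \<psi> (R b) = cnj z"
    unfolding z_def by (metis R cinner_commute pos_formD(3))
  have expand: "0 \<le> q \<psi> - 2 * t * (cmod z)\<^sup>2 + t\<^sup>2 * (cmod z)\<^sup>2 * q b" for t
  proof -
    define l where "l = - (complex_of_real t * z)"
    have "cinner (\<psi> + l *\<^sub>C b) (R (\<psi> + l *\<^sub>C b)) =
        cinner \<psi> (R \<psi>) + l * cnj z + cnj l * z + (cnj l * l) * cinner b (R b)"
      by (simp add: pos_formD[OF R] cinner_add_left cinner_add_right cinner_scaleC_left
          cinner_scaleC_right z' algebra_simps flip: z_def)
    also have "\<dots> = complex_of_real (q \<psi> - 2 * t * (cmod z)\<^sup>2 + t\<^sup>2 * (cmod z)\<^sup>2 * q b)"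
    proof -
      have zz: "z * cnj z = complex_of_real ((cmod z)\<^sup>2)" by (simp only: complex_norm_square)
      then have "l * cnj z = - complex_of_real (t * (cmod z)\<^sup>2)" "cnj l * z = - complex_of_real (t * (cmod z)\<^sup>2)"
        unfolding l_def by (simp_all add: mult.assoc mult.commute[of "cnj z" z])
      moreover have "cnj l * l = complex_of_real (t\<^sup>2 * (cmod z)\<^sup>2)"
        using zz unfolding l_def by (simp add: mult_ac power2_eq_square)
      moreover have "cinner \<psi> (R \<psi>) = complex_of_real (q \<psi>)" "cinner b (R b) = complex_of_real (q b)"
        using pos_form_self[OF R] unfolding q_def by blast+
      ultimately show ?thesis
        by simp
    qed
    finally show ?thesis using pos_formD(4)[OF R, of "\<psi> + l *\<^sub>C b"] by simp
  qed
  have qpos: "0 \<le> q \<psi>" "0 \<le> q b" unfolding q_def using pos_formD(4)[OF R] by blast+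
  have "(cmod z)\<^sup>2 \<le> q b * q \<psi>"
  proof (cases "q b = 0")
    case True
    have "(cmod z)\<^sup>2 = 0"
    proof (rule ccontr)
      assume "(cmod z)\<^sup>2 \<noteq> 0"
      \<comment> \<open>With \<open>q b = 0\<close> the expression is affine in \<open>t\<close>,
        and at this \<open>t\<close> its value is -1.\<close>
      then show False
        using expand[of "(q \<psi> + 1) / (2 * (cmod z)\<^sup>2)"] True by simp
    qed
    then show ?thesis using qpos by simp
  next
    case False
    then have "0 < q b" using qpos by simp
    \<comment> \<open>\<open>t = 1 / q b\<close> is the minimiser of the quadratic.\<close>
    then show ?thesis
      using expand[of "1 / q b"] by (simp add: field_simps power2_eq_square)
  qed
  then show ?thesis by (simp add: q_def z_def)
qed

lemma pos_form_kernel: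
  assumes R: "pos_form R" and "Re (cinner b (R b)) = 0"
  shows "R b = 0"
proof -
  have "cinner b (R (R b)) = 0"
    using pos_form_Cauchy_Schwarz[OF R, of b "R b"] assms(2) by simp
  then have "cinner (R b) (R b) = 0" by (simp add: pos_formD(3)[OF R])
  then show ?thesis by (simp add: cinner_self)
qed

text \<open>The Cholesky column for the pivot vector \<open>b\<close>. For a vanishing pivot the
  factor is \<open>1 / sqrt 0 = 0\<close>, so the column is zero and the step does nothing.\<close>

definition chol_vec :: "'n::finite operator \<Rightarrow> 'n fock \<Rightarrow> 'n fock" where
  "chol_vec R b = complex_of_real (1 / sqrt (Re (cinner b (R b)))) *\<^sub>C R b"

definition chol_step :: "'n::finite operator \<Rightarrow> 'n fock \<Rightarrow> 'n operator" where
  "chol_step R b = (\<lambda>\<psi>. R \<psi> - cinner (chol_vec R b) \<psi> *\<^sub>C chol_vec R b)"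

lemma cinner_chol_vec:
  assumes "pos_form R"
  shows "cinner (chol_vec R b) \<psi> = complex_of_real (1 / sqrt (Re (cinner b (R b)))) * cinner b (R \<psi>)"
  unfolding chol_vec_def by (simp add: cinner_scaleC_left pos_formD(3)[OF assms])

text \<open>Positivity survives because the Cauchy-Schwarz inequality bounds the subtracted rank-one
  form by the form of \<open>R\<close>.\<close>

lemma pos_form_chol_step:
  assumes R: "pos_form R"
  shows "pos_form (chol_step R b)"
proof -
  let ?v = "chol_vec R b"
  have "0 \<le> Re (cinner \<psi> (chol_step R b \<psi>))" for \<psi>
  proof -
    let ?q = "Re (cinner b (R b))"
    have "cinner \<psi> (chol_step R b \<psi>) = cinner \<psi> (R \<psi>) - cinner ?v \<psi> * cnj (cinner ?v \<psi>)"
      unfolding chol_step_def cinner_diff_right cinner_scaleC_right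
      by (subst cinner_commute[of \<psi> ?v]) simp
    then have "Re (cinner \<psi> (chol_step R b \<psi>)) = Re (cinner \<psi> (R \<psi>)) - (cmod (cinner ?v \<psi>))\<^sup>2"
      by (simp flip: complex_norm_square)
    moreover have "(cmod (cinner ?v \<psi>))\<^sup>2 \<le> Re (cinner \<psi> (R \<psi>))"
    proof (cases "?q = 0")
      case True
      then show ?thesis using pos_formD(4)[OF R] by (simp add: cinner_chol_vec[OF R])
    next
      case False
      then have q: "0 < ?q" using pos_formD(4)[OF R, of b] by simp
      then have "(cmod (cinner ?v \<psi>))\<^sup>2 = (cmod (cinner b (R \<psi>)))\<^sup>2 / ?q"
        by (simp add: cinner_chol_vec[OF R] norm_mult norm_divide power_divide)
      also have "\<dots> \<le> Re (cinner \<psi> (R \<psi>))"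
        using pos_form_Cauchy_Schwarz[OF R, of b \<psi>] q by (simp add: field_simps)
      finally show ?thesis .
    qed
    ultimately show ?thesis by simp
  qed
  moreover have "cinner (chol_step R b \<psi>) \<phi> = cinner \<psi> (chol_step R b \<phi>)" for \<psi> \<phi>
    using cinner_commute[of \<psi> ?v]
    by (simp add: chol_step_def cinner_diff_right cinner_diff_left cinner_scaleC_left
        cinner_scaleC_right pos_formD(3)[OF R])
  moreover have "chol_step R b (\<psi> + \<phi>) = chol_step R b \<psi> + chol_step R b \<phi>" for \<psi> \<phi>
    by (simp add: chol_step_def pos_formD[OF R] cinner_add_right scaleC_add_left)
  moreover have "chol_step R b (c *\<^sub>C \<psi>) = c *\<^sub>C chol_step R b \<psi>" for c \<psi>
    by (simp add: chol_step_def pos_formD[OF R] cinner_scaleC_right scaleC_diff_right)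
  ultimately show ?thesis unfolding pos_form_def by blast
qed

text \<open>Either \<open>b\<close> already lies in the kernel of \<open>R\<close>, or the rank-one
  part reproduces \<open>R b\<close> exactly.\<close>

lemma chol_step_self:
  assumes R: "pos_form R"
  shows "chol_step R b b = 0"
proof (cases "Re (cinner b (R b)) = 0")
  case True
  then show ?thesis using pos_form_kernel[OF R True] by (simp add: chol_step_def chol_vec_def)
next
  case False
  define q where "q = Re (cinner b (R b))"
  have q: "0 < q" using False pos_formD(4)[OF R, of b] unfolding q_def by simp
  have "cinner (chol_vec R b) b = complex_of_real (sqrt q)"
  proof -
    have "cinner (chol_vec R b) b = complex_of_real (1 / sqrt q * q)"
      unfolding cinner_chol_vec[OF R] of_real_mult q_def by (subst pos_form_self[OF R, of b]) simp
    also have "1 / sqrt q * q = sqrt q" using q by (simp add: real_div_sqrt)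
    finally show ?thesis .
  qed
  then show ?thesis using q by (simp add: chol_step_def chol_vec_def flip: q_def)
qed

lemma chol_step_kernel:
  assumes R: "pos_form R" and "R c = 0"
  shows "chol_step R b c = 0"
  using assms by (simp add: chol_step_def cinner_chol_vec)

fun chol :: "'n::finite operator \<Rightarrow> (nat \<Rightarrow> 'n fock) \<Rightarrow> nat \<Rightarrow> 'n operator" where
  "chol \<rho> b 0 = \<rho>"
| "chol \<rho> b (Suc n) = chol_step (chol \<rho> b n) (b n)"

lemma pos_form_chol: "pos_form \<rho> \<Longrightarrow> pos_form (chol \<rho> b n)"
  by (induction n) (auto intro: pos_form_chol_step)

lemma chol_kernel:
  assumes "pos_form \<rho>" "j < n"
  shows "chol \<rho> b n (b j) = 0"
  using assms(2)
proof (induction n)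
  case (Suc n)
  then show ?case
    using pos_form_chol[OF assms(1), of b n]
    by (cases "j = n") (auto intro: chol_step_self chol_step_kernel)
qed simp

lemma chol_expand:
  "\<rho> \<psi> = (\<Sum>k<n. cinner (chol_vec (chol \<rho> b k) (b k)) \<psi> *\<^sub>C chol_vec (chol \<rho> b k) (b k)) + chol \<rho> b n \<psi>"
  by (induction n) (auto simp: chol_step_def)

text \<open>Once a number state has served as pivot it lies in the kernel of every later remainder,
  and all later columns are orthogonal to it. On each number state the expansion is therefore a
  finite sum and raises no question of convergence.\<close>

lemma pos_form_decomposition:
  fixes \<rho> :: "'n::finite operator"
  assumes "pos_form \<rho>"
  shows "\<exists>(v :: nat \<Rightarrow> 'n fock) (N :: 'n multiset \<Rightarrow> nat).
    (\<forall>M. \<forall>k\<ge>N M. cinner (v k) (number_basis M) = 0) \<and>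
    (\<forall>M. \<rho> (number_basis M) = (\<Sum>k<N M. cinner (v k) (number_basis M) *\<^sub>C v k))"
proof -
  \<comment> \<open>Words enumerate the number states with repetitions; a repeated pivot lies in the
    kernel of the remainder and yields a zero column.\<close>
  define b where "b n = number_basis (mset (from_nat n :: 'n list))" for n
  define v where "v k = chol_vec (chol \<rho> b k) (b k)" for k
  \<comment> \<open>\<open>Suc\<close>, because the pivot \<open>b k\<close> is annihilated only
    after step \<open>k\<close>, that is by the remainders with index at least
    \<open>k + 1\<close>.\<close>
  define N where "N M = Suc (to_nat (SOME xs. mset xs = M))" for M :: "'n multiset"
  have b_N: "b (N M - 1) = number_basis M" for M
    unfolding b_def N_def using someI_ex[OF ex_mset[of M]] by simp
  have ker: "chol \<rho> b k (number_basis M) = 0" if "k \<ge> N M" for k M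
    using chol_kernel[OF assms, of "N M - 1" k b] that b_N[of M] by (simp add: N_def)
  show ?thesis
  proof (intro exI conjI allI impI)
    show "cinner (v k) (number_basis M) = 0" if "k \<ge> N M" for k M
      unfolding v_def by (simp add: cinner_chol_vec[OF pos_form_chol[OF assms]] ker[OF that])
    show "\<rho> (number_basis M) = (\<Sum>k<N M. cinner (v k) (number_basis M) *\<^sub>C v k)" for M
      using chol_expand[of \<rho> "number_basis M" b "N M"] by (simp add: ker v_def)
  qed
qed

lemma summable_on_norm_square_basis:
  fixes v :: "nat \<Rightarrow> 'n::finite fock"
  assumes "(\<lambda>k. (norm (v k))\<^sup>2) summable_on UNIV"
  shows "(\<lambda>(k, M). (cmod (cinner (number_basis M) (v k)))\<^sup>2) summable_on UNIV \<times> UNIV"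
  by (rule summable_on_SigmaI[where g = "\<lambda>k. (norm (v k))\<^sup>2"])
    (use assms norm_parseval_number_basis in auto)

text \<open>Formally \<rho> is the sum of the rank-one operators of the vectors \<open>v k\<close>.
  On a fixed number state the sum over \<open>k\<close> is finite; the sums over \<open>k\<close>
  and over number states are then exchanged by absolute summability, for which the adjoint
  \<open>T'\<close> acts on \<open>v k\<close> and Parseval is applied to
  \<open>T' (v k)\<close>.\<close>

lemma state_decomposition:
  fixes \<rho> :: "'n::finite operator"
  assumes "state \<rho>"
  obtains v :: "nat \<Rightarrow> 'n fock"
  where "((\<lambda>k. (norm (v k))\<^sup>2) has_sum 1) UNIV"
    and "\<And>T T'. (\<And>\<psi> \<phi>. cinner (T' \<psi>) \<phi> = cinner \<psi> (T \<phi>)) \<Longrightarrow> (\<And>\<psi>. norm (T' \<psi>) \<le> norm \<psi>) \<Longrightarrow>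
          ((\<lambda>k. cinner (v k) (T (v k))) has_sum tr_op (\<rho> \<circ> T)) UNIV"
proof -
  have R: "pos_form \<rho>" using assms by (simp add: state_def positive_op_pos_form)
  obtain v :: "nat \<Rightarrow> 'n fock" and N :: "'n multiset \<Rightarrow> nat"
    where vN: "\<And>M k. k \<ge> N M \<Longrightarrow> cinner (v k) (number_basis M) = 0"
      and rho: "\<And>M. \<rho> (number_basis M) = (\<Sum>k<N M. cinner (v k) (number_basis M) *\<^sub>C v k)"
    using pos_form_decomposition[OF R] by metis
  have vN': "cinner (number_basis M) (v k) = 0" if "k \<ge> N M" for M k
    using vN[OF that] by (metis cinner_commute complex_cnj_zero)
  have expand: "((\<lambda>k. cinner (T' (v k)) (number_basis M) * cinner (number_basis M) (v k)) has_sum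
      cinner (number_basis M) (\<rho> (T (number_basis M)))) UNIV"
    if adj: "\<And>\<psi> \<phi>. cinner (T' \<psi>) \<phi> = cinner \<psi> (T \<phi>)" for T T' M
  proof (rule has_sum_finite_neutralI[where B = "{..<N M}"])
    have "cinner (number_basis M) (\<rho> (T (number_basis M))) = cinner (\<rho> (number_basis M)) (T (number_basis M))"
      by (rule pos_formD(3)[OF R, symmetric])
    also have "\<dots> = (\<Sum>k<N M. cinner (T' (v k)) (number_basis M) * cinner (number_basis M) (v k))"
      unfolding rho cinner_sum_left cinner_scaleC_left adj
      by (intro sum.cong refl) (metis cinner_commute mult.commute)
    finally show "cinner (number_basis M) (\<rho> (T (number_basis M))) =
      (\<Sum>k<N M. cinner (T' (v k)) (number_basis M) * cinner (number_basis M) (v k))" .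
  qed (use vN' in auto)
  have norm_v: "((\<lambda>k. (norm (v k))\<^sup>2) has_sum 1) UNIV"
  proof -
    have "tr_op \<rho> = 1" using assms by (simp add: state_def)
    \<comment> \<open>A divergent \<open>infsum\<close> has the value 0, so the value 1 implies
      summability.\<close>
    then have "((\<lambda>M. cinner (number_basis M) (\<rho> (number_basis M))) has_sum 1) UNIV"
      unfolding tr_op_def by (metis has_sum_infsum infsum_not_exists zero_neq_one)
    then have tr: "((\<lambda>M. Re (cinner (number_basis M) (\<rho> (number_basis M)))) has_sum 1) UNIV"
      using has_sum_Re by fastforce
    let ?f = "\<lambda>(M, k). (cmod (cinner (number_basis M) (v k)))\<^sup>2"
    have row: "((\<lambda>k. ?f (M, k)) has_sum Re (cinner (number_basis M) (\<rho> (number_basis M)))) UNIV" for M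
    proof -
      have "Re (cinner (id (v k)) (number_basis M) * cinner (number_basis M) (v k)) = ?f (M, k)" for k
        unfolding id_def by (subst cinner_commute) (simp add: cmod_power2, simp add: power2_eq_square)
      then show ?thesis using has_sum_Re[OF expand[of id id M]] by simp
    qed
    have "?f summable_on UNIV \<times> UNIV"
      using row by (rule summable_on_SigmaI) (use tr in \<open>auto simp: summable_on_def\<close>)
    then have "(?f has_sum 1) (UNIV \<times> UNIV)"
      using row tr by (intro has_sum_SigmaI) auto
    then have "((\<lambda>(k, M). ?f (M, k)) has_sum 1) (UNIV \<times> UNIV)"
      by (subst (asm) has_sum_swap) simp
    then show ?thesis
      by (rule has_sum_SigmaD) (use norm_parseval_number_basis in auto)
  qed
  moreover have "((\<lambda>k. cinner (v k) (T (v k))) has_sum tr_op (\<rho> \<circ> T)) UNIV"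
    if adj: "\<And>\<psi> \<phi>. cinner (T' \<psi>) \<phi> = cinner \<psi> (T \<phi>)" and bd: "\<And>\<psi>. norm (T' \<psi>) \<le> norm \<psi>" for T T'
  proof -
    let ?f = "\<lambda>(k, M). cinner (T' (v k)) (number_basis M) * cinner (number_basis M) (v k)"
    have sv: "(\<lambda>k. (norm (v k))\<^sup>2) summable_on UNIV" using norm_v by (auto simp: summable_on_def)
    have sT: "(\<lambda>k. (norm (T' (v k)))\<^sup>2) summable_on UNIV"
      using sv by (rule summable_on_comparison_test) (auto intro: power_mono bd)
    \<comment> \<open>A product is at most the sum of the squares of its factors; both families of
      squares are summable by Parseval, the first because \<open>T'\<close> is a
      contraction.\<close>
    have "?f summable_on UNIV \<times> UNIV"
    proof (rule abs_summable_summable, rule Infinite_Sum.abs_summable_on_comparison_test')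
      show "(\<lambda>p. (case p of (k, M) \<Rightarrow> (cmod (cinner (number_basis M) (T' (v k))))\<^sup>2) +
          (case p of (k, M) \<Rightarrow> (cmod (cinner (number_basis M) (v k)))\<^sup>2)) summable_on UNIV \<times> UNIV"
        by (intro summable_on_add summable_on_norm_square_basis sv sT)
      fix p :: "nat \<times> 'n multiset"
      obtain k M where p: "p = (k, M)" by fastforce
      have "cmod (cinner (T' (v k)) (number_basis M)) = cmod (cinner (number_basis M) (T' (v k)))"
        by (subst cinner_commute) simp
      moreover have "a * b \<le> a\<^sup>2 + b\<^sup>2" if "0 \<le> a" "0 \<le> b" for a b :: real
        using sum_squares_bound[of a b] mult_nonneg_nonneg[OF that] by simp
      ultimately show "cmod (?f p) \<le> (case p of (k, M) \<Rightarrow> (cmod (cinner (number_basis M) (T' (v k))))\<^sup>2) +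
          (case p of (k, M) \<Rightarrow> (cmod (cinner (number_basis M) (v k)))\<^sup>2)"
        by (simp add: p norm_mult)
    qed
    then obtain S where S: "(?f has_sum S) (UNIV \<times> UNIV)" by (auto simp: summable_on_def)
    have "((\<lambda>k. cinner (T' (v k)) (v k)) has_sum S) UNIV"
      using S by (rule has_sum_SigmaD) (use parseval_number_basis in auto)
    moreover have "((\<lambda>(M, k). ?f (k, M)) has_sum S) (UNIV \<times> UNIV)"
      using S by (subst (asm) has_sum_swap) simp
    then have "((\<lambda>M. cinner (number_basis M) (\<rho> (T (number_basis M)))) has_sum S) UNIV"
      by (rule has_sum_SigmaD) (use expand[OF adj] in auto)
    then have "tr_op (\<rho> \<circ> T) = S" unfolding tr_op_def by (simp add: infsumI)
    ultimately show ?thesis by (simp add: adj)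
  qed
  ultimately show ?thesis using that by blast
qed

section \<open>Projections onto a fixed particle number\<close>

lemma coord_number_proj: "coord (number_proj k \<psi>) xs = (if length xs = k then coord \<psi> xs else 0)"
  by (simp add: number_proj.rep_eq)

lemma cinner_number_proj: "cinner (number_proj k \<psi>) \<phi> = cinner \<psi> (number_proj k \<phi>)"
  unfolding cinner_def by (rule infsum_cong) (simp add: coord_number_proj)

lemma norm_number_proj_le: "norm (number_proj k \<psi>) \<le> norm \<psi>"
  by (rule norm_fock_mono) (simp add: coord_number_proj)

lemma cinner_number_proj_self:
  "cinner \<psi> (number_proj k \<psi>) = complex_of_real (\<Sum>xs | length xs = k. (cmod (coord \<psi> xs))\<^sup>2)"
proof -
  have "((\<lambda>xs. cnj (coord \<psi> xs) * coord (number_proj k \<psi>) xs) has_sum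
      (\<Sum>xs | length xs = k. complex_of_real ((cmod (coord \<psi> xs))\<^sup>2))) UNIV"
    by (rule has_sum_finite_neutralI[where B = "{xs. length xs = k}"])
      (auto simp: coord_number_proj simp del: of_real_power simp add: complex_norm_square mult.commute)
  then have "cinner \<psi> (number_proj k \<psi>) = (\<Sum>xs | length xs = k. complex_of_real ((cmod (coord \<psi> xs))\<^sup>2))"
    using cinner_has_sum has_sum_unique by blast
  then show ?thesis by (simp only: of_real_sum)
qed

section \<open>Gaussian averages of Weyl operators\<close>

abbreviation std_normal2 :: "(real \<times> real) measure" where
  "std_normal2 \<equiv> std_normal_distribution \<Otimes>\<^sub>M std_normal_distribution"

lemma prob_space_std_normal: "prob_space std_normal_distribution"
  by (rule prob_space_normal_density) simp

interpretation std_normal: prob_space std_normal_distribution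
  by (rule prob_space_std_normal)

interpretation std_normal2: pair_prob_space std_normal_distribution std_normal_distribution ..

text \<open>Completing the square turns the integrand into a multiple of the normal density with
  mean \<open>\<epsilon> * a / (1 + \<epsilon>\<^sup>2)\<close> and variance
  \<open>1 / (1 + \<epsilon>\<^sup>2)\<close>.\<close>

lemma integral_std_normal_quadratic_exp:
  "(\<integral>x. exp (- (\<epsilon>\<^sup>2 * x\<^sup>2 / 2) + \<epsilon> * a * x) \<partial>std_normal_distribution) =
    exp (\<epsilon>\<^sup>2 * a\<^sup>2 / (2 * (1 + \<epsilon>\<^sup>2))) / sqrt (1 + \<epsilon>\<^sup>2)"
proof -
  define r where "r = sqrt (1 + \<epsilon>\<^sup>2)"
  have r: "0 < r" "r\<^sup>2 = 1 + \<epsilon>\<^sup>2" by (auto simp: r_def add_pos_nonneg)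
  have eq: "std_normal_density x * exp (- (\<epsilon>\<^sup>2 * x\<^sup>2 / 2) + \<epsilon> * a * x) =
      exp (\<epsilon>\<^sup>2 * a\<^sup>2 / (2 * r\<^sup>2)) / r * normal_density (\<epsilon> * a / r\<^sup>2) (1 / r) x" for x
  proof -
    have "- x\<^sup>2 / 2 + (- (\<epsilon>\<^sup>2 * x\<^sup>2 / 2) + \<epsilon> * a * x) = - (r\<^sup>2 * x\<^sup>2 / 2) + \<epsilon> * a * x"
      by (simp add: r(2) field_simps)
    also have "\<dots> = \<epsilon>\<^sup>2 * a\<^sup>2 / (2 * r\<^sup>2) + (- (x - \<epsilon> * a / r\<^sup>2)\<^sup>2 / (2 * (1 / r)\<^sup>2))"
      using r(1) by (simp add: field_simps power2_eq_square)
    finally have "exp (- x\<^sup>2 / 2) * exp (- (\<epsilon>\<^sup>2 * x\<^sup>2 / 2) + \<epsilon> * a * x) =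
        exp (\<epsilon>\<^sup>2 * a\<^sup>2 / (2 * r\<^sup>2)) * exp (- (x - \<epsilon> * a / r\<^sup>2)\<^sup>2 / (2 * (1 / r)\<^sup>2))"
      by (simp only: exp_add[symmetric])
    moreover have "1 / sqrt (2 * pi * (1 / r)\<^sup>2) = r / sqrt (2 * pi)"
      using r(1) by (simp add: real_sqrt_mult real_sqrt_divide power_divide)
    ultimately show ?thesis
      using r(1) unfolding std_normal_density_def normal_density_def by simp
  qed
  have "(\<integral>x. exp (- (\<epsilon>\<^sup>2 * x\<^sup>2 / 2) + \<epsilon> * a * x) \<partial>std_normal_distribution) =
      (\<integral>x. exp (\<epsilon>\<^sup>2 * a\<^sup>2 / (2 * r\<^sup>2)) / r * normal_density (\<epsilon> * a / r\<^sup>2) (1 / r) x \<partial>lborel)"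
    by (subst integral_density) (simp_all only: real_scaleR_def eq, simp_all)
  also have "\<dots> = exp (\<epsilon>\<^sup>2 * a\<^sup>2 / (2 * r\<^sup>2)) / r"
    using r(1) by simp
  finally show ?thesis by (simp add: r(2)) (simp add: r_def)
qed

text \<open>Rescaling the variable by \<open>sqrt (1 + \<epsilon>\<^sup>2)\<close> absorbs the
  quadratic factor into the density and leaves the characteristic function of the standard normal
  distribution.\<close>

lemma integral_std_normal_quadratic_iexp:
  "(\<integral>x. complex_of_real (exp (- (\<epsilon>\<^sup>2 * x\<^sup>2 / 2))) * iexp (\<epsilon> * b * x) \<partial>std_normal_distribution) =
    complex_of_real (exp (- (\<epsilon>\<^sup>2 * b\<^sup>2 / (2 * (1 + \<epsilon>\<^sup>2)))) / sqrt (1 + \<epsilon>\<^sup>2))"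
proof -
  define r where "r = sqrt (1 + \<epsilon>\<^sup>2)"
  have r: "0 < r" "r\<^sup>2 = 1 + \<epsilon>\<^sup>2" by (auto simp: r_def add_pos_nonneg)
  let ?f = "\<lambda>x. complex_of_real (exp (- (\<epsilon>\<^sup>2 * x\<^sup>2 / 2))) * iexp (\<epsilon> * b * x)"
  have eq: "std_normal_density (1 / r * x) *\<^sub>R ?f (1 / r * x) = std_normal_density x *\<^sub>R iexp ((\<epsilon> * b / r) * x)" for x
  proof -
    have "- (1 / r * x)\<^sup>2 / 2 + (- (\<epsilon>\<^sup>2 * (1 / r * x)\<^sup>2 / 2)) = - (r\<^sup>2 * (1 / r * x)\<^sup>2) / 2"
      by (simp add: r(2) algebra_simps)
    also have "r\<^sup>2 * (1 / r * x)\<^sup>2 = x\<^sup>2" using r(1) by (simp add: power_divide)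
    finally have "exp (- (1 / r * x)\<^sup>2 / 2) * exp (- (\<epsilon>\<^sup>2 * (1 / r * x)\<^sup>2 / 2)) = exp (- x\<^sup>2 / 2)"
      by (simp only: exp_add[symmetric])
    then have "std_normal_density (1 / r * x) * exp (- (\<epsilon>\<^sup>2 * (1 / r * x)\<^sup>2 / 2)) = std_normal_density x"
      unfolding std_normal_density_def by simp
    then have "std_normal_density (1 / r * x) *\<^sub>R ?f (1 / r * x) = std_normal_density x *\<^sub>R iexp (\<epsilon> * b * (1 / r * x))"
      by (simp only: scaleR_conv_of_real mult.assoc[symmetric] of_real_mult[symmetric])
    then show ?thesis by simp
  qed
  have "(\<integral>x. ?f x \<partial>std_normal_distribution) = (\<integral>x. std_normal_density x *\<^sub>R ?f x \<partial>lborel)"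
    by (subst integral_density) simp_all
  also have "\<dots> = \<bar>1 / r\<bar> *\<^sub>R (\<integral>x. std_normal_density (0 + 1 / r * x) *\<^sub>R ?f (0 + 1 / r * x) \<partial>lborel)"
    by (rule lborel_integral_real_affine) (use r in auto)
  also have "\<dots> = (1 / r) *\<^sub>R (\<integral>x. std_normal_density x *\<^sub>R iexp ((\<epsilon> * b / r) * x) \<partial>lborel)"
    using r(1) by (simp only: add_0 eq) simp
  also have "\<dots> = (1 / r) *\<^sub>R char std_normal_distribution (\<epsilon> * b / r)"
    unfolding char_def by (subst integral_density) simp_all
  also have "\<dots> = complex_of_real (exp (- (\<epsilon>\<^sup>2 * b\<^sup>2 / (2 * r\<^sup>2))) / r)"
    by (simp add: char_std_normal_distribution scaleR_conv_of_real power_divide power_mult_distrib)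
  finally show ?thesis by (simp only: r(2)) (simp add: r_def)
qed

text \<open>The vectors at which measurability and the integral formula hold form a closed complex
  subspace. Closedness is dominated convergence, with a constant bound because every
  \<open>V p\<close> is isometric.\<close>

lemma average_extend:
  fixes V :: "'p \<Rightarrow> 'n::finite operator"
  assumes "prob_space M" and V: "\<And>p. unitary_op (V p)" and G: "clcspan G = UNIV"
    and gen: "\<And>g. g \<in> G \<Longrightarrow> (\<lambda>p. cinner \<phi> (V p g)) \<in> borel_measurable M"
      "\<And>g. g \<in> G \<Longrightarrow> (\<integral>p. cinner \<phi> (V p g) \<partial>M) = cinner \<phi>' g"
  shows "(\<lambda>p. cinner \<phi> (V p \<psi>)) \<in> borel_measurable M \<and> (\<integral>p. cinner \<phi> (V p \<psi>) \<partial>M) = cinner \<phi>' \<psi>"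
proof -
  interpret prob_space M by fact
  define Y where "Y = {\<psi>. (\<lambda>p. cinner \<phi> (V p \<psi>)) \<in> borel_measurable M \<and> (\<integral>p. cinner \<phi> (V p \<psi>) \<partial>M) = cinner \<phi>' \<psi>}"
  have bound: "cmod (cinner \<phi> (V p \<psi>)) \<le> norm \<phi> * norm \<psi>" for p \<psi>
    using Cauchy_Schwarz_cinner[of \<phi> "V p \<psi>"] by (simp add: unitary_norm[OF V])
  have integrable: "integrable M (\<lambda>p. cinner \<phi> (V p \<psi>))" if "\<psi> \<in> Y" for \<psi>
    by (rule integrable_const_bound[where B = "norm \<phi> * norm \<psi>"]) (use that bound in \<open>auto simp: Y_def\<close>)
  note lin = bounded_op_add[OF bounded_op_unitary[OF V]] bounded_op_scaleC[OF bounded_op_unitary[OF V]]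
  have scale: "c *\<^sub>C \<psi> \<in> Y" if "\<psi> \<in> Y" for c \<psi>
    using that by (auto simp: Y_def lin cinner_scaleC_right)
  have zero: "0 \<in> Y"
    using lin(2)[of _ 0 0] by (simp add: Y_def)
  have "subspace Y"
  proof (rule subspaceI)
    show "\<psi> + \<eta> \<in> Y" if "\<psi> \<in> Y" "\<eta> \<in> Y" for \<psi> \<eta>
      using that integrable[OF that(1)] integrable[OF that(2)] by (auto simp: Y_def lin cinner_add_right)
  qed (use zero scale in \<open>auto simp: scaleR_scaleC_fock\<close>)
  moreover have "closed Y"
    unfolding closed_sequential_limits
  proof (intro allI impI, elim conjE)
    fix f \<psi> assume f: "\<forall>n. f n \<in> Y" and lim: "f \<longlonglongrightarrow> \<psi>"
    have lim': "(\<lambda>n. cinner \<phi> (V p (f n))) \<longlonglongrightarrow> cinner \<phi> (V p \<psi>)" for p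
    proof (rule tendsto_cinner[OF tendsto_const])
      have "bounded_linear (V p)" using V by (simp add: unitary_op_def bounded_op_def)
      then show "(\<lambda>n. V p (f n)) \<longlonglongrightarrow> V p \<psi>" using lim by (rule bounded_linear.tendsto)
    qed
    have meas: "(\<lambda>p. cinner \<phi> (V p \<psi>)) \<in> borel_measurable M"
      by (rule borel_measurable_LIMSEQ_metric[OF _ lim']) (use f in \<open>auto simp: Y_def\<close>)
    have "Bseq f" using lim by (intro convergent_imp_Bseq convergentI)
    then obtain B where B: "\<And>n. norm (f n) \<le> B" unfolding Bseq_def by blast
    have "(\<lambda>n. \<integral>p. cinner \<phi> (V p (f n)) \<partial>M) \<longlonglongrightarrow> (\<integral>p. cinner \<phi> (V p \<psi>) \<partial>M)"
    proof (rule integral_dominated_convergence[where w = "\<lambda>_. norm \<phi> * B"])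
      show "AE p in M. norm (cinner \<phi> (V p (f n))) \<le> norm \<phi> * B" for n
        using bound[of _ "f n"] B[of n] by (intro AE_I2) (meson mult_left_mono norm_ge_zero order_trans)
    qed (use meas lim' f in \<open>auto simp: Y_def\<close>)
    moreover have "(\<lambda>n. \<integral>p. cinner \<phi> (V p (f n)) \<partial>M) \<longlonglongrightarrow> cinner \<phi>' \<psi>"
      using f tendsto_cinner[OF tendsto_const lim, of \<phi>'] by (simp add: Y_def)
    ultimately show "\<psi> \<in> Y" unfolding Y_def using meas LIMSEQ_unique by blast
  qed
  ultimately have "closed_csubspace Y" using scale by (simp add: closed_csubspace_def)
  then have "id \<psi> \<in> Y"
    by (rule clcspan_minimal[OF bounded_op_id, of _ G]) (use gen G in \<open>auto simp: Y_def\<close>)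
  then show ?thesis by (simp add: Y_def)
qed

lemma cinner_diag: "cinner (diag f \<psi>) \<phi> = cinner \<psi> (diag f \<phi>)"
  unfolding cinner_def by (rule infsum_cong) (simp add: diag.rep_eq)

lemma cdot_axis_left: "cdot (axis j z) v = cnj z * v $ j"
proof -
  have "cdot (axis j z) v = (\<Sum>i\<in>UNIV. if i = j then cnj z * v $ j else 0)"
    unfolding cdot_def by (rule sum.cong) (auto simp: axis_def)
  then show ?thesis by simp
qed

lemma cdot_axis_right: "cdot v (axis j z) = cnj (v $ j) * z"
  by (subst cdot_commute) (simp add: cdot_axis_left)

lemma norm_axis_complex: "norm (axis j z :: complex ^ 'n::finite) = cmod z"
proof -
  have "complex_of_real ((norm (axis j z :: complex ^ 'n))\<^sup>2) = complex_of_real ((cmod z)\<^sup>2)"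
    unfolding cdot_self[symmetric] cdot_axis_left by (simp add: axis_def complex_norm_square mult.commute del: of_real_power)
  then show ?thesis by (simp only: of_real_eq_iff) (simp add: power2_eq_iff_nonneg)
qed

text \<open>Since \<open>u\<close> and \<open>v\<close> are real, the linear part of the exponent is
  real in the first variable and imaginary in the second, and the double integral is a product of
  the two preceding ones.\<close>

lemma average_weyl_exp_vec:
  fixes u v :: "real ^ 'n::finite" and \<epsilon> :: real and j :: 'n
  assumes \<epsilon>: "0 < \<epsilon>" "\<epsilon> \<le> 1"
  defines "W \<equiv> \<lambda>p. weyl (axis j (Complex (\<epsilon> * fst p) (\<epsilon> * snd p)))"
  defines "s \<equiv> (1 - \<epsilon>\<^sup>2) / (1 + \<epsilon>\<^sup>2)"
  shows "(\<lambda>p. cinner (exp_vec (rvec u)) (W p (exp_vec (rvec v)))) \<in> borel_measurable std_normal2"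
    "(\<integral>p. cinner (exp_vec (rvec u)) (W p (exp_vec (rvec v))) \<partial>std_normal2) =
      cinner (complex_of_real (1 / (1 + \<epsilon>\<^sup>2)) *\<^sub>C diag (\<lambda>M. s ^ count M j) (exp_vec (rvec u))) (exp_vec (rvec v))"
proof -
  \<comment> \<open>With \<zeta> = \<epsilon> (x + i y) the linear part is
    \<open>u $ j * \<zeta> - cnj \<zeta> * v $ j\<close>, which equals
    \<open>\<epsilon> * a * x + \<i> * \<epsilon> * b * y\<close>.\<close>
  define a b where "a = u $ j - v $ j" and "b = u $ j + v $ j"
  define f where "f x = exp (- (\<epsilon>\<^sup>2 * x\<^sup>2 / 2) + \<epsilon> * a * x)" for x
  define g where "g y = complex_of_real (exp (- (\<epsilon>\<^sup>2 * y\<^sup>2 / 2))) * iexp (\<epsilon> * b * y)" for y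
  define c where "c = exp (cdot (rvec u) (rvec v))"
  have eq: "cinner (exp_vec (rvec u)) (W p (exp_vec (rvec v))) = c * (complex_of_real (f (fst p)) * g (snd p))" for p
  proof -
    have "(cmod (Complex (\<epsilon> * fst p) (\<epsilon> * snd p)))\<^sup>2 = \<epsilon>\<^sup>2 * (fst p)\<^sup>2 + \<epsilon>\<^sup>2 * (snd p)\<^sup>2"
      by (simp add: cmod_power2 power_mult_distrib)
    then show ?thesis
      unfolding W_def weyl_exp_vec weyl_factor_def cinner_scaleC_right cinner_exp_vec cdot_add_right
        cdot_axis_left cdot_axis_right norm_axis_complex c_def f_def g_def exp_of_real[symmetric] exp_add[symmetric]
      by (intro arg_cong[where f = exp])
        (simp add: complex_eq_iff rvec_def a_def b_def cdot_def algebra_simps add_divide_distrib diff_divide_distrib)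
  qed
  have [measurable]: "f \<in> borel_measurable borel" "g \<in> borel_measurable borel"
    unfolding f_def g_def by (auto intro!: borel_measurable_continuous_onI continuous_intros)
  show meas: "(\<lambda>p. cinner (exp_vec (rvec u)) (W p (exp_vec (rvec v)))) \<in> borel_measurable std_normal2"
    unfolding eq by measurable
  have int: "integrable std_normal2 (\<lambda>p. cinner (exp_vec (rvec u)) (W p (exp_vec (rvec v))))"
  proof (rule std_normal2.P.integrable_const_bound[OF _ meas])
    show "AE p in std_normal2. cmod (cinner (exp_vec (rvec u)) (W p (exp_vec (rvec v)))) \<le>
        norm (exp_vec (rvec u)) * norm (exp_vec (rvec v))"
      unfolding W_def using Cauchy_Schwarz_cinner unitary_norm[OF unitary_weyl] by (metis (no_types, lifting) AE_I2)
  qed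
  have "(\<integral>p. cinner (exp_vec (rvec u)) (W p (exp_vec (rvec v))) \<partial>std_normal2) =
      (\<integral>x. \<integral>y. c * (complex_of_real (f x) * g y) \<partial>std_normal_distribution \<partial>std_normal_distribution)"
    using std_normal2.integral_fst'[OF int, symmetric] unfolding eq fst_conv snd_conv .
  also have "\<dots> = c * (complex_of_real (\<integral>x. f x \<partial>std_normal_distribution) * (\<integral>y. g y \<partial>std_normal_distribution))"
    by (simp only: integral_mult_right_zero integral_mult_left_zero integral_complex_of_real)
  also have "\<dots> = c * complex_of_real (exp (\<epsilon>\<^sup>2 * a\<^sup>2 / (2 * (1 + \<epsilon>\<^sup>2))) * exp (- (\<epsilon>\<^sup>2 * b\<^sup>2 / (2 * (1 + \<epsilon>\<^sup>2)))) / (1 + \<epsilon>\<^sup>2))"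
  proof -
    have "sqrt (1 + \<epsilon>\<^sup>2) * sqrt (1 + \<epsilon>\<^sup>2) = 1 + \<epsilon>\<^sup>2" by (simp add: add_nonneg_nonneg)
    then show ?thesis
      unfolding f_def g_def integral_std_normal_quadratic_exp integral_std_normal_quadratic_iexp
        of_real_mult[symmetric] times_divide_times_eq by (simp only:)
  qed
  \<comment> \<open>This is where \<open>s\<close> originates:
    \<open>a\<^sup>2 - b\<^sup>2 = - 4 * (u $ j * v $ j)\<close>, and the resulting coefficient
    \<open>- 2 * \<epsilon>\<^sup>2 / (1 + \<epsilon>\<^sup>2)\<close> is
    \<open>s - 1\<close>.\<close>
  also have "exp (\<epsilon>\<^sup>2 * a\<^sup>2 / (2 * (1 + \<epsilon>\<^sup>2))) * exp (- (\<epsilon>\<^sup>2 * b\<^sup>2 / (2 * (1 + \<epsilon>\<^sup>2)))) = exp ((s - 1) * (u $ j * v $ j))"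
  proof -
    have "1 + \<epsilon>\<^sup>2 \<noteq> 0" by (metis add_pos_nonneg less_numeral_extra(1,3) zero_le_power2)
    have frac: "x * (- 4 * w) / (2 * d) = - 2 * x / d * w" for x w d :: real
      by (cases "d = 0") (simp_all add: field_simps)
    from \<open>1 + \<epsilon>\<^sup>2 \<noteq> 0\<close> have "s - 1 = - 2 * \<epsilon>\<^sup>2 / (1 + \<epsilon>\<^sup>2)" unfolding s_def by (simp add: field_simps)
    moreover have "\<epsilon>\<^sup>2 * a\<^sup>2 / (2 * (1 + \<epsilon>\<^sup>2)) + - (\<epsilon>\<^sup>2 * b\<^sup>2 / (2 * (1 + \<epsilon>\<^sup>2))) =
        \<epsilon>\<^sup>2 * (a\<^sup>2 - b\<^sup>2) / (2 * (1 + \<epsilon>\<^sup>2))"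
      by (simp add: right_diff_distrib diff_divide_distrib)
    moreover have "a\<^sup>2 - b\<^sup>2 = - 4 * (u $ j * v $ j)"
      unfolding a_def b_def by (simp add: power2_eq_square algebra_simps)
    ultimately show ?thesis
      unfolding exp_add[symmetric] using frac by (simp only:)
  qed
  also have "c * complex_of_real (exp ((s - 1) * (u $ j * v $ j)) / (1 + \<epsilon>\<^sup>2)) =
      cinner (complex_of_real (1 / (1 + \<epsilon>\<^sup>2)) *\<^sub>C diag (\<lambda>M. s ^ count M j) (exp_vec (rvec u))) (exp_vec (rvec v))"
  proof -
    have s: "0 \<le> s" "s \<le> 1"
    proof -
      have "0 < 1 + \<epsilon>\<^sup>2" by (simp add: add_pos_nonneg)
      moreover have "\<epsilon>\<^sup>2 \<le> 1" using \<epsilon> by (simp add: power_le_one)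
      ultimately show "0 \<le> s" "s \<le> 1" by (simp_all add: s_def)
    qed
    let ?u = "\<chi> i. if i = j then s * u $ i else u $ i"
    have "cdot (rvec ?u) (rvec v) = (\<Sum>i\<in>UNIV. cnj (rvec u $ i) * rvec v $ i +
        (if i = j then complex_of_real ((s - 1) * (u $ j * v $ j)) else 0))"
      unfolding cdot_def by (intro sum.cong refl) (auto simp: rvec_def algebra_simps)
    also have "\<dots> = cdot (rvec u) (rvec v) + complex_of_real ((s - 1) * (u $ j * v $ j))"
      by (simp add: sum.distrib cdot_def)
    finally have "exp (cdot (rvec ?u) (rvec v)) = c * complex_of_real (exp ((s - 1) * (u $ j * v $ j)))"
      by (simp only: exp_add c_def exp_of_real)
    then show ?thesis
      unfolding diag_exp_vec[OF s] cinner_scaleC_left cinner_exp_vec by simp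
  qed
  finally show "(\<integral>p. cinner (exp_vec (rvec u)) (W p (exp_vec (rvec v))) \<partial>std_normal2) =
      cinner (complex_of_real (1 / (1 + \<epsilon>\<^sup>2)) *\<^sub>C diag (\<lambda>M. s ^ count M j) (exp_vec (rvec u))) (exp_vec (rvec v))" .
qed

lemma cinner_weyl_minus: "cinner \<psi> (weyl (- u) \<phi>) = cnj (cinner \<phi> (weyl u \<psi>))"
  using unitary_cinner_inv[OF unitary_weyl[of u]] cinner_commute by (metis inv_weyl)

text \<open>\<open>average_extend\<close> frees only the right-hand vector. Passing to the inverse
  Weyl operators and conjugating exchanges the two sides, so a second application frees the other
  vector.\<close>

lemma average_weyl:
  fixes \<phi> \<psi> :: "'n::finite fock" and \<epsilon> :: real and j :: 'n
  assumes \<epsilon>: "0 < \<epsilon>" "\<epsilon> \<le> 1"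
  defines "W \<equiv> \<lambda>p. weyl (axis j (Complex (\<epsilon> * fst p) (\<epsilon> * snd p)))"
  defines "s \<equiv> (1 - \<epsilon>\<^sup>2) / (1 + \<epsilon>\<^sup>2)"
  shows "(\<lambda>p. cinner \<phi> (W p \<psi>)) \<in> borel_measurable std_normal2 \<and>
    (\<integral>p. cinner \<phi> (W p \<psi>) \<partial>std_normal2) =
      complex_of_real (1 / (1 + \<epsilon>\<^sup>2)) * cinner \<phi> (diag (\<lambda>M. s ^ count M j) \<psi>)"
proof -
  define V where "V p = weyl (- axis j (Complex (\<epsilon> * fst p) (\<epsilon> * snd p)) :: complex ^ 'n)" for p
  define D :: "'n operator" where "D = diag (\<lambda>M. s ^ count M j)"
  define k where "k = complex_of_real (1 / (1 + \<epsilon>\<^sup>2))"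
  have ps: "prob_space std_normal2" by unfold_locales
  have UW: "unitary_op (W p)" and UV: "unitary_op (V p)" for p
    unfolding W_def V_def by (rule unitary_weyl)+
  have VW: "cinner \<psi> (V p \<phi>) = cnj (cinner \<phi> (W p \<psi>))" for p \<phi> \<psi>
    unfolding V_def W_def by (rule cinner_weyl_minus)
  have WV: "cinner \<phi> (W p \<psi>) = cnj (cinner \<psi> (V p \<phi>))" for p \<phi> \<psi>
    by (simp add: VW)
  have cnj_k: "cnj k = k" by (simp add: k_def)
  have 1: "(\<lambda>p. cinner (exp_vec (rvec u)) (W p \<psi>)) \<in> borel_measurable std_normal2 \<and>
      (\<integral>p. cinner (exp_vec (rvec u)) (W p \<psi>) \<partial>std_normal2) = cinner (k *\<^sub>C D (exp_vec (rvec u))) \<psi>" for u \<psi>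
    by (rule average_extend[OF ps UW exp_vec_real_total])
      (use average_weyl_exp_vec[OF \<epsilon>, where j = j] in \<open>auto simp: W_def D_def k_def s_def\<close>)
  have 2: "(\<lambda>p. cinner \<psi> (V p \<phi>)) \<in> borel_measurable std_normal2 \<and>
      (\<integral>p. cinner \<psi> (V p \<phi>) \<partial>std_normal2) = cinner (k *\<^sub>C D \<psi>) \<phi>" for \<psi> \<phi>
  proof (rule average_extend[OF ps UV exp_vec_real_total])
    fix g :: "'n fock" assume "g \<in> range (\<lambda>v. exp_vec (rvec v))"
    then obtain u where g: "g = exp_vec (rvec u)" by blast
    show "(\<lambda>p. cinner \<psi> (V p g)) \<in> borel_measurable std_normal2"
      unfolding VW g using 1 by (intro borel_measurable_continuous_on[of cnj] continuous_intros) blast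
    have "(\<integral>p. cinner \<psi> (V p g) \<partial>std_normal2) = cnj (cinner (k *\<^sub>C D g) \<psi>)"
      unfolding VW integral_cnj using 1 by (simp add: g)
    then show "(\<integral>p. cinner \<psi> (V p g) \<partial>std_normal2) = cinner (k *\<^sub>C D \<psi>) g"
      by (simp add: cinner_scaleC_left cnj_k D_def cinner_diag flip: cinner_commute)
  qed
  have "(\<lambda>p. cinner \<phi> (W p \<psi>)) \<in> borel_measurable std_normal2"
    unfolding WV using 2 by (intro borel_measurable_continuous_on[of cnj] continuous_intros) blast
  moreover have "(\<integral>p. cinner \<phi> (W p \<psi>) \<partial>std_normal2) = cnj (cinner (k *\<^sub>C D \<psi>) \<phi>)"
    unfolding WV integral_cnj using 2 by simp
  moreover have "cnj (cinner (k *\<^sub>C D \<psi>) \<phi>) = k * cinner \<phi> (D \<psi>)"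
    by (simp add: cinner_scaleC_left cnj_k flip: cinner_commute)
  ultimately show ?thesis by (simp add: k_def D_def)
qed

section \<open>The mean particle number of a Gaussian state\<close>

text \<open>\<open>F n\<close> is a probability generating function at \<open>s n\<close>, and
  \<open>L\<close> is the limit of its difference quotients at 1. Such a quotient averages the
  geometric sum of \<open>s n ^ i\<close> over \<open>i < c x\<close>, which is at most
  \<open>c x\<close> and tends to it. Finite partial sums are thus bounded by \<open>L\<close>, so
  summability of the mean is obtained along with its value.\<close>

lemma has_sum_of_sums_pos:
  fixes f :: "'x \<Rightarrow> real" and c :: "'x \<Rightarrow> nat" and s F :: "nat \<Rightarrow> real"
  assumes q: "\<And>x. 0 \<le> q x" "(q has_sum 1) UNIV"
    and s: "\<And>n. 0 \<le> s n" "\<And>n. s n < 1" "s \<longlonglongrightarrow> 1"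
    and F: "\<And>n. ((\<lambda>x. s n ^ c x * q x) has_sum F n) UNIV"
    and L: "(\<lambda>n. (1 - F n) / (1 - s n)) \<longlonglongrightarrow> L"
  shows "((\<lambda>x. real (c x) * q x) has_sum L) UNIV"
proof -
  define g where "g n x = (\<Sum>i<c x. s n ^ i) * q x" for n x
  have g_eq: "g n x = inverse (1 - s n) * (q x - s n ^ c x * q x)" for n x
  proof -
    have "1 - s n \<noteq> 0" using s(2)[of n] by simp
    then have "(\<Sum>i<c x. s n ^ i) = inverse (1 - s n) * (1 - s n ^ c x)"
      by (simp add: one_diff_power_eq)
    then show ?thesis unfolding g_def by (simp only: left_diff_distrib mult.assoc mult_1_left)
  qed
  have g_sum: "(g n has_sum ((1 - F n) / (1 - s n))) UNIV" for n
  proof -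
    have "((\<lambda>x. q x - s n ^ c x * q x) has_sum (1 - F n)) UNIV"
      using has_sum_add[OF q(2) has_sum_uminusI[OF F[of n]]] by simp
    from has_sum_cmult_right[OF this, of "inverse (1 - s n)"]
    show ?thesis unfolding g_eq[abs_def] by (simp add: divide_inverse mult.commute)
  qed
  have g_nonneg: "0 \<le> g n x" for n x
    unfolding g_def by (intro mult_nonneg_nonneg sum_nonneg zero_le_power s q)
  have g_le: "g n x \<le> real (c x) * q x" for n x
  proof -
    have "(\<Sum>i<c x. s n ^ i) \<le> (\<Sum>i<c x. 1)"
      by (intro sum_mono power_le_one s less_imp_le)
    then show ?thesis unfolding g_def by (intro mult_right_mono q) simp
  qed
  have g_lim: "(\<lambda>n. g n x) \<longlonglongrightarrow> real (c x) * q x" for x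
  proof -
    have "(\<lambda>n. g n x) \<longlonglongrightarrow> (\<Sum>i<c x. 1 ^ i) * q x"
      unfolding g_def by (intro tendsto_intros s)
    then show ?thesis by simp
  qed
  have finite_le: "(\<Sum>x\<in>A. real (c x) * q x) \<le> L" if A: "finite A" for A
  proof (rule LIMSEQ_le[OF _ L])
    show "(\<lambda>n. \<Sum>x\<in>A. g n x) \<longlonglongrightarrow> (\<Sum>x\<in>A. real (c x) * q x)"
      by (intro tendsto_sum g_lim)
    show "\<exists>N. \<forall>n\<ge>N. (\<Sum>x\<in>A. g n x) \<le> (1 - F n) / (1 - s n)"
      using finite_sum_le_has_sum[OF g_sum A] g_nonneg by auto
  qed
  have summable: "(\<lambda>x. real (c x) * q x) summable_on UNIV"
  proof (rule nonneg_bdd_above_summable_on)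
    show "bdd_above (sum (\<lambda>x. real (c x) * q x) ` {F. F \<subseteq> UNIV \<and> finite F})"
      by (rule bdd_aboveI2[where M = L]) (auto intro: finite_le)
  qed (simp add: q)
  then obtain T where T: "((\<lambda>x. real (c x) * q x) has_sum T) UNIV" by (auto simp: summable_on_def)
  have "T \<le> L" by (rule has_sum_le_finite_sums[OF T]) (auto intro: finite_le)
  moreover have "L \<le> T"
  proof (rule LIMSEQ_le_const2[OF L])
    show "\<exists>N. \<forall>n\<ge>N. (1 - F n) / (1 - s n) \<le> T"
      using has_sum_mono[OF g_sum T g_le] by blast
  qed
  ultimately show ?thesis using T by simp
qed

section \<open>Gaussian second moments and the small-variance limit\<close>

lemma integrable_std_normal2_squares:
  "integrable std_normal2 (\<lambda>p. (fst p)\<^sup>2)" "integrable std_normal2 (\<lambda>p. (snd p)\<^sup>2)"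
proof -
  have i: "integrable std_normal_distribution (\<lambda>x. x\<^sup>2)"
    by (rule integrable_std_normal_distribution_moment)
  have "integrable (distr std_normal2 std_normal_distribution fst) (\<lambda>x. x\<^sup>2)"
    using i by (subst std_normal.distr_pair_fst)
  then show 1: "integrable std_normal2 (\<lambda>p. (fst p)\<^sup>2)"
    by (rule integrable_distr[rotated]) simp
  show "integrable std_normal2 (\<lambda>p. (snd p)\<^sup>2)"
    using std_normal2.integrable_product_swap[OF 1] by (simp add: case_prod_unfold)
qed

lemma integral_std_normal2_quadratic:
  fixes A B C :: real
  shows "integrable std_normal2 (\<lambda>p. A * (fst p)\<^sup>2 + B * (fst p * snd p) + C * (snd p)\<^sup>2)" (is ?int)
    and "(\<integral>p. A * (fst p)\<^sup>2 + B * (fst p * snd p) + C * (snd p)\<^sup>2 \<partial>std_normal2) = A + C"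
proof -
  have xy: "integrable std_normal2 (\<lambda>p. fst p * snd p)"
  proof (rule Bochner_Integration.integrable_bound)
    show "integrable std_normal2 (\<lambda>p. (fst p)\<^sup>2 + (snd p)\<^sup>2)"
      by (intro Bochner_Integration.integrable_add integrable_std_normal2_squares)
    show "AE p in std_normal2. norm (fst p * snd p) \<le> norm ((fst p)\<^sup>2 + (snd p)\<^sup>2)"
    proof (rule AE_I2)
      fix p :: "real \<times> real"
      have "2 * (\<bar>fst p\<bar> * \<bar>snd p\<bar>) \<le> (fst p)\<^sup>2 + (snd p)\<^sup>2"
        using sum_squares_bound[of "\<bar>fst p\<bar>" "\<bar>snd p\<bar>"] by simp
      moreover have "0 \<le> \<bar>fst p\<bar> * \<bar>snd p\<bar>" by simp
      ultimately show "norm (fst p * snd p) \<le> norm ((fst p)\<^sup>2 + (snd p)\<^sup>2)"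
        unfolding real_norm_def abs_mult by linarith
    qed
  qed simp
  show int: ?int
    by (intro Bochner_Integration.integrable_add integrable_mult_right integrable_std_normal2_squares xy)
  have m0: "(\<integral>y. 1 \<partial>std_normal_distribution) = (1 :: real)"
    using std_normal.prob_space by simp
  have m1: "(\<integral>y. y \<partial>std_normal_distribution) = 0"
    using integral_std_normal_distribution_moment_odd[of 1] by simp
  have m2: "(\<integral>y. y\<^sup>2 \<partial>std_normal_distribution) = 1"
    using std_normal_distribution_even_moments(1)[of 1] by simp
  have i0: "integrable std_normal_distribution (\<lambda>y. c)" for c :: real by simp
  have i1: "integrable std_normal_distribution (\<lambda>y. y)"
    using integrable_std_normal_distribution_moment[of 1] by simp
  have i2: "integrable std_normal_distribution (\<lambda>y. y\<^sup>2)"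
    by (rule integrable_std_normal_distribution_moment)
  have "(\<integral>p. A * (fst p)\<^sup>2 + B * (fst p * snd p) + C * (snd p)\<^sup>2 \<partial>std_normal2) =
      (\<integral>x. \<integral>y. A * x\<^sup>2 + B * (x * y) + C * y\<^sup>2 \<partial>std_normal_distribution \<partial>std_normal_distribution)"
    using std_normal2.integral_fst'[OF int, symmetric] unfolding fst_conv snd_conv .
  also have "\<dots> = (\<integral>x. A * x\<^sup>2 + C \<partial>std_normal_distribution)"
  proof (rule Bochner_Integration.integral_cong[OF refl])
    fix x :: real
    have "(\<integral>y. A * x\<^sup>2 + B * (x * y) + C * y\<^sup>2 \<partial>std_normal_distribution) =
      (\<integral>y. A * x\<^sup>2 * 1 \<partial>std_normal_distribution) + (\<integral>y. B * x * y \<partial>std_normal_distribution)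
        + (\<integral>y. C * y\<^sup>2 \<partial>std_normal_distribution)"
      using i0 i1 i2 by (simp add: mult.assoc)
    also have "\<dots> = A * x\<^sup>2 + C"
      unfolding integral_mult_right_zero m0 m1 m2 by simp
    finally show "(\<integral>y. A * x\<^sup>2 + B * (x * y) + C * y\<^sup>2 \<partial>std_normal_distribution) = A * x\<^sup>2 + C" .
  qed
  also have "\<dots> = (\<integral>x. A * x\<^sup>2 \<partial>std_normal_distribution) + (\<integral>x. C * 1 \<partial>std_normal_distribution)"
    using i0 i2 by simp
  also have "\<dots> = A + C"
    unfolding integral_mult_right_zero m0 m2 by simp
  finally show "(\<integral>p. A * (fst p)\<^sup>2 + B * (fst p * snd p) + C * (snd p)\<^sup>2 \<partial>std_normal2) = A + C" .
qed

text \<open>The deviation from 1 splits into \<open>1 - exp (- a)\<close> and a damped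
  \<open>1 - cos b\<close>, each below its leading Taylor term. This supplies the domination for the
  small-variance limit.\<close>

lemma one_minus_exp_cos_bounds:
  fixes a b :: real
  assumes "0 \<le> a"
  shows "0 \<le> 1 - exp (- a) * cos b" "1 - exp (- a) * cos b \<le> a + b\<^sup>2 / 2"
proof -
  have "exp (- a) \<le> 1" using assms by simp
  then show "0 \<le> 1 - exp (- a) * cos b"
    using mult_left_mono[OF cos_le_one[of b] exp_ge_zero[of "- a"]] by linarith
  have "1 - cos b \<le> b\<^sup>2 / 2"
  proof -
    have "1 - cos b = 2 * (sin (b / 2))\<^sup>2" using cos_double_sin[of "b / 2"] by simp
    also have "\<dots> \<le> 2 * (b / 2)\<^sup>2"
      using abs_sin_x_le_abs_x[of "b / 2"] unfolding abs_le_square_iff by simp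
    finally show ?thesis by (simp add: power2_eq_square)
  qed
  moreover have "exp (- a) * (1 - cos b) \<le> 1 - cos b"
    using \<open>exp (- a) \<le> 1\<close> by (intro mult_left_le_one_le) auto
  moreover have "1 - exp (- a) \<le> a" using exp_ge_add_one_self[of "- a"] by simp
  ultimately show "1 - exp (- a) * cos b \<le> a + b\<^sup>2 / 2" by (simp add: algebra_simps)
qed

lemma tendsto_one_minus_exp_cos:
  fixes Q c :: real
  shows "((\<lambda>e. (1 - exp (- (e\<^sup>2 * Q)) * cos (c * e)) / e\<^sup>2) \<longlongrightarrow> Q + c\<^sup>2 / 2) (at_right 0)"
  unfolding power2_eq_square[of c] by real_asymp

text \<open>The quotients converge to \<open>w\<close>, the quadratic form plus half the square of
  the linear form, and \<open>w\<close> also dominates them. The factor \<open>sqrt 2\<close> makes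
  the linear form contribute \<open>a\<^sup>2 + b\<^sup>2\<close>, and the mixed products average to
  zero.\<close>

lemma gaussian_average_limit:
  fixes a b A B C :: real
  assumes pos: "\<And>x y. 0 \<le> A * x\<^sup>2 + B * (x * y) + C * y\<^sup>2"
  defines "e \<equiv> \<lambda>n. inverse (real (Suc n))"
  shows "(\<lambda>n. (1 - (\<integral>p. exp (- ((e n)\<^sup>2 * (A * (fst p)\<^sup>2 + B * (fst p * snd p) + C * (snd p)\<^sup>2))) *
      cos (sqrt 2 * (a * fst p + b * snd p) * e n) \<partial>std_normal2)) / (e n)\<^sup>2) \<longlonglongrightarrow> A + C + a\<^sup>2 + b\<^sup>2"
proof -
  define q where "q p = A * (fst p)\<^sup>2 + B * (fst p * snd p) + C * (snd p)\<^sup>2" for p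
  define h where "h p = sqrt 2 * (a * fst p + b * snd p)" for p
  define r where "r n p = exp (- ((e n)\<^sup>2 * q p)) * cos (h p * e n)" for n p
  define w where "w p = q p + (h p)\<^sup>2 / 2" for p
  have w_eq: "w p = (A + a\<^sup>2) * (fst p)\<^sup>2 + (B + 2 * a * b) * (fst p * snd p) + (C + b\<^sup>2) * (snd p)\<^sup>2" for p
    by (simp add: w_def q_def h_def power_mult_distrib power2_sum algebra_simps)
  have w_int: "integrable std_normal2 w" and w_val: "(\<integral>p. w p \<partial>std_normal2) = A + C + a\<^sup>2 + b\<^sup>2"
    unfolding w_eq[abs_def] using integral_std_normal2_quadratic by simp_all
  have e: "0 < e n" for n by (simp add: e_def)
  have q_nonneg: "0 \<le> (e n)\<^sup>2 * q p" for n p using pos by (simp add: q_def)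
  have [measurable]: "q \<in> borel_measurable std_normal2" "h \<in> borel_measurable std_normal2"
    unfolding q_def h_def by measurable
  have r_meas [measurable]: "r n \<in> borel_measurable std_normal2" for n
    unfolding r_def by measurable
  have r_int: "integrable std_normal2 (r n)" for n
  proof (rule std_normal2.P.integrable_const_bound[where B = 1])
    show "AE p in std_normal2. norm (r n p) \<le> 1"
      unfolding r_def real_norm_def abs_mult
      by (intro AE_I2 mult_le_one) (use q_nonneg in auto)
  qed simp
  have "(\<lambda>n. \<integral>p. (1 - r n p) / (e n)\<^sup>2 \<partial>std_normal2) \<longlonglongrightarrow> (\<integral>p. w p \<partial>std_normal2)"
  proof (rule integral_dominated_convergence[OF _ _ w_int])
    show "w \<in> borel_measurable std_normal2" using w_int by blast
    show "AE p in std_normal2. (\<lambda>n. (1 - r n p) / (e n)\<^sup>2) \<longlonglongrightarrow> w p"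
    proof (rule AE_I2)
      fix p
      have "filterlim e (at_right 0) sequentially"
        unfolding e_def by real_asymp
      from filterlim_compose[OF tendsto_one_minus_exp_cos[of "q p" "h p"] this]
      show "(\<lambda>n. (1 - r n p) / (e n)\<^sup>2) \<longlonglongrightarrow> w p" by (simp add: r_def w_def)
    qed
    show "AE p in std_normal2. norm ((1 - r n p) / (e n)\<^sup>2) \<le> w p" for n
    proof (rule AE_I2)
      fix p
      have "0 \<le> 1 - r n p" "1 - r n p \<le> (e n)\<^sup>2 * q p + (h p * e n)\<^sup>2 / 2"
        unfolding r_def using one_minus_exp_cos_bounds[OF q_nonneg] by blast+
      moreover have "(e n)\<^sup>2 * q p + (h p * e n)\<^sup>2 / 2 = w p * (e n)\<^sup>2"
        by (simp add: w_def power_mult_distrib algebra_simps)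
      ultimately show "norm ((1 - r n p) / (e n)\<^sup>2) \<le> w p"
        using e[of n] by (simp add: divide_le_eq)
    qed
  qed simp
  moreover have "(\<integral>p. (1 - r n p) / (e n)\<^sup>2 \<partial>std_normal2) = (1 - (\<integral>p. r n p \<partial>std_normal2)) / (e n)\<^sup>2" for n
    using r_int[of n] std_normal2.P.prob_space by simp
  ultimately show ?thesis
    unfolding w_val by (simp only: r_def q_def h_def)
qed

section \<open>Number distribution of a mixture of vector states\<close>

lemma cinner_diag_has_sum:
  assumes "\<And>M. 0 \<le> f M" "\<And>M. f M \<le> 1"
  shows "((\<lambda>xs. f (mset xs) * (cmod (coord \<phi> xs))\<^sup>2) has_sum Re (cinner \<phi> (diag f \<phi>))) UNIV"
proof -
  have "Re (cnj (coord \<phi> xs) * coord (diag f \<phi>) xs) = f (mset xs) * (cmod (coord \<phi> xs))\<^sup>2" for xs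
    by (simp add: coord_diag assms cmod_power2, simp add: power2_eq_square algebra_simps)
  then show ?thesis using has_sum_Re[OF cinner_has_sum[of \<phi> "diag f \<phi>"]] by simp
qed

lemma cvec_axis:
  "cvec (x *\<^sub>R axis (Inl j) 1 + y *\<^sub>R axis (Inr j) 1) = axis j (Complex x y)"
  by (simp add: vec_eq_iff cvec_def axis_def complex_eq_iff)

lemma inner_matrix_axis: "axis a 1 \<bullet> (S *v axis b 1) = S $ a $ b" for S :: "real ^ 'k ^ 'k"
  by (simp add: inner_axis' matrix_vector_mult_basis column_def)

text \<open>Tonelli for a nonnegative family indexed by vectors and words. Summing over the vectors
  first, a word receives the weight that acts as its probability in the mixture.\<close>

lemma swap_weighted_norms:
  fixes \<phi> :: "nat \<Rightarrow> 'n::finite fock"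
  assumes norm: "((\<lambda>k. (norm (\<phi> k))\<^sup>2) has_sum 1) UNIV"
    and f: "\<And>M. 0 \<le> f M" "\<And>M. f M \<le> 1"
  shows "\<exists>T. ((\<lambda>k. Re (cinner (\<phi> k) (diag f (\<phi> k)))) has_sum T) UNIV \<and>
    ((\<lambda>xs. f (mset xs) * (\<Sum>\<^sub>\<infinity>k. (cmod (coord (\<phi> k) xs))\<^sup>2)) has_sum T) UNIV"
proof -
  let ?g = "\<lambda>(k, xs). f (mset xs) * (cmod (coord (\<phi> k) xs))\<^sup>2"
  have le: "f (mset xs) * (cmod (coord (\<phi> k) xs))\<^sup>2 \<le> (cmod (coord (\<phi> k) xs))\<^sup>2" for k xs
    using f by (intro mult_left_le_one_le) auto
  have row: "((\<lambda>xs. ?g (k, xs)) has_sum Re (cinner (\<phi> k) (diag f (\<phi> k)))) UNIV" for k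
    using cinner_diag_has_sum[of f "\<phi> k", OF f] by simp
  have up: "Re (cinner (\<phi> k) (diag f (\<phi> k))) \<le> (norm (\<phi> k))\<^sup>2" for k
    by (rule has_sum_mono[OF row norm_fock_has_sum]) (simp only: prod.case le)
  have lo: "0 \<le> Re (cinner (\<phi> k) (diag f (\<phi> k)))" for k
    by (rule has_sum_nonneg[OF row]) (use f in simp)
  have "(\<lambda>k. (norm (\<phi> k))\<^sup>2) summable_on UNIV" using norm by (auto simp: summable_on_def)
  then have "(\<lambda>k. Re (cinner (\<phi> k) (diag f (\<phi> k)))) summable_on UNIV"
    by (rule summable_on_comparison_test) (rule up, rule lo)
  with row have "?g summable_on UNIV \<times> UNIV"
    by (rule summable_on_SigmaI) (use f in simp)
  then obtain T where T: "(?g has_sum T) (UNIV \<times> UNIV)" by (auto simp: summable_on_def)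
  have "((\<lambda>k. Re (cinner (\<phi> k) (diag f (\<phi> k)))) has_sum T) UNIV"
    using T by (rule has_sum_SigmaD) (use row in auto)
  moreover have "((\<lambda>(xs, k). ?g (k, xs)) has_sum T) (UNIV \<times> UNIV)"
    using T by (subst (asm) has_sum_swap) simp
  then have "((\<lambda>xs. f (mset xs) * (\<Sum>\<^sub>\<infinity>k. (cmod (coord (\<phi> k) xs))\<^sup>2)) has_sum T) UNIV"
  proof (rule has_sum_SigmaD)
    fix xs :: "'n list"
    have "(\<lambda>k. (cmod (coord (\<phi> k) xs))\<^sup>2) summable_on UNIV"
    proof (rule summable_on_comparison_test)
      show "(\<lambda>k. (norm (\<phi> k))\<^sup>2) summable_on UNIV" using norm by (auto simp: summable_on_def)
      show "(cmod (coord (\<phi> k) xs))\<^sup>2 \<le> (norm (\<phi> k))\<^sup>2" for k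
        by (intro power_mono coord_le_norm) simp
    qed simp
    then show "((\<lambda>k. case (xs, k) of (xs, k) \<Rightarrow> ?g (k, xs)) has_sum
        f (mset xs) * (\<Sum>\<^sub>\<infinity>k. (cmod (coord (\<phi> k) xs))\<^sup>2)) UNIV"
      by (simp add: has_sum_cmult_right)
  qed
  ultimately show ?thesis by blast
qed

text \<open>Averaging \<open>chi\<close> over Weyl operators of mode \<open>j\<close> identifies the
  generating function of the occupation number at \<open>s n\<close> as
  \<open>(1 + (e n)\<^sup>2) * G n\<close>, and its difference quotient at 1 gives the mean. The
  summand -1 is the contribution of the prefactor.\<close>

lemma gaussian_mode_number_has_sum:
  fixes \<phi> :: "nat \<Rightarrow> 'n::finite fock" and w :: "real ^ ('n + 'n)" and S :: "real ^ ('n + 'n) ^ ('n + 'n)"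
  assumes norm: "((\<lambda>k. (norm (\<phi> k))\<^sup>2) has_sum 1) UNIV"
    and chi: "\<And>z. ((\<lambda>k. cinner (\<phi> k) (weyl (cvec z) (\<phi> k))) has_sum
      exp (- \<i> * complex_of_real (sqrt 2 * (w \<bullet> z)) - complex_of_real (z \<bullet> (S *v z)))) UNIV"
    and pos: "\<And>z. 0 \<le> z \<bullet> (S *v z)"
  shows "((\<lambda>xs. real (count (mset xs) j) * (\<Sum>\<^sub>\<infinity>k. (cmod (coord (\<phi> k) xs))\<^sup>2)) has_sum
    ((S $ Inl j $ Inl j + S $ Inr j $ Inr j + (w $ Inl j)\<^sup>2 + (w $ Inr j)\<^sup>2 - 1) / 2)) UNIV"
proof -
  define q where "q xs = (\<Sum>\<^sub>\<infinity>k. (cmod (coord (\<phi> k) xs))\<^sup>2)" for xs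
  define e where "e n = inverse (real (Suc n))" for n
  define s where "s n = (1 - (e n)\<^sup>2) / (1 + (e n)\<^sup>2)" for n
  define A B C where "A = S $ Inl j $ Inl j" and "B = S $ Inl j $ Inr j + S $ Inr j $ Inl j"
    and "C = S $ Inr j $ Inr j"
  define a b where "a = w $ Inl j" and "b = w $ Inr j"
  define Z where "Z n p = (e n * fst p) *\<^sub>R axis (Inl j) 1 + (e n * snd p) *\<^sub>R axis (Inr j) (1::real)" for n p
  define X where "X n p = exp (- \<i> * complex_of_real (sqrt 2 * (w \<bullet> Z n p)) - complex_of_real (Z n p \<bullet> (S *v Z n p)))" for n p
  define W where "W n p = weyl (axis j (Complex (e n * fst p) (e n * snd p)))" for n p
  define D :: "nat \<Rightarrow> 'n operator" where "D n = diag (\<lambda>M. s n ^ count M j)" for n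
  define G where "G n = (\<integral>p. exp (- ((e n)\<^sup>2 * (A * (fst p)\<^sup>2 + B * (fst p * snd p) + C * (snd p)\<^sup>2))) *
      cos (sqrt 2 * (a * fst p + b * snd p) * e n) \<partial>std_normal2)" for n
  \<comment> \<open>\<open>e n \<le> 1\<close> keeps \<open>s n\<close> nonnegative, so that its
    powers are admissible weights for \<open>diag\<close>.\<close>
  have e: "0 < e n" "e n \<le> 1" for n by (auto simp: e_def inverse_le_1_iff)
  have e2: "0 < (e n)\<^sup>2" "(e n)\<^sup>2 \<le> 1" for n using e[of n] by (auto simp: power_le_one)
  have s: "0 \<le> s n" "s n < 1" for n
    using e2[of n] by (simp_all add: s_def divide_less_eq add_pos_pos)
  have Zw: "w \<bullet> Z n p = (a * fst p + b * snd p) * e n" for n p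
    by (simp add: Z_def inner_add_right inner_axis a_def b_def algebra_simps)
  have quad: "(x *\<^sub>R axis (Inl j) 1 + y *\<^sub>R axis (Inr j) 1) \<bullet> (S *v (x *\<^sub>R axis (Inl j) 1 + y *\<^sub>R axis (Inr j) 1)) =
      A * x\<^sup>2 + B * (x * y) + C * y\<^sup>2" for x y
    by (simp add: matrix_vector_right_distrib matrix_vector_mult_scaleR inner_add_left inner_add_right
        inner_matrix_axis A_def B_def C_def power2_eq_square algebra_simps)
  have ZS: "Z n p \<bullet> (S *v Z n p) = (e n)\<^sup>2 * (A * (fst p)\<^sup>2 + B * (fst p * snd p) + C * (snd p)\<^sup>2)" for n p
    unfolding Z_def quad by (simp add: power2_eq_square algebra_simps)
  have chi': "((\<lambda>k. cinner (\<phi> k) (W n p (\<phi> k))) has_sum X n p) UNIV" for n p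
    using chi[of "Z n p"] unfolding W_def X_def Z_def cvec_axis .
  have avg: "(\<lambda>p. cinner \<psi> (W n p \<psi>)) \<in> borel_measurable std_normal2"
    "(\<integral>p. cinner \<psi> (W n p \<psi>) \<partial>std_normal2) = complex_of_real (1 / (1 + (e n)\<^sup>2)) * cinner \<psi> (D n \<psi>)" for \<psi> n
    using average_weyl[OF e, where j = j and \<phi> = \<psi> and \<psi> = \<psi>] unfolding W_def D_def s_def by blast+
  have bound: "cmod (cinner \<psi> (W n p \<psi>)) \<le> (norm \<psi>)\<^sup>2" for \<psi> n p
    using Cauchy_Schwarz_cinner[of \<psi> "W n p \<psi>"]
    unfolding W_def power2_eq_square unitary_norm[OF unitary_weyl] .
  have int: "integrable std_normal2 (\<lambda>p. cinner (\<phi> k) (W n p (\<phi> k)))" for n k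
    by (rule std_normal2.P.integrable_const_bound[where B = "(norm (\<phi> k))\<^sup>2"]) (use avg bound in auto)
  have summable_norm: "summable (\<lambda>k. (norm (\<phi> k))\<^sup>2)"
    using norm has_sum_imp_sums sums_summable by blast
  have X_Re: "Re (X n p) = exp (- ((e n)\<^sup>2 * (A * (fst p)\<^sup>2 + B * (fst p * snd p) + C * (snd p)\<^sup>2))) *
      cos (sqrt 2 * (a * fst p + b * snd p) * e n)" for n p
    unfolding X_def Zw ZS by (simp add: Re_exp mult.assoc)
  have main: "(\<lambda>k. Re (cinner (\<phi> k) (D n (\<phi> k)))) sums ((1 + (e n)\<^sup>2) * G n)" for n
  proof -
    \<comment> \<open>All terms are bounded by \<open>(norm (\<phi> k))\<^sup>2\<close>, whose
      series converges; this permits exchanging series and integral.\<close>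
    have sm: "summable (\<lambda>k. cmod (cinner (\<phi> k) (W n p (\<phi> k))))" for p
      by (rule summable_comparison_test'[OF summable_norm]) (simp add: bound)
    have si: "summable (\<lambda>k. \<integral>p. cmod (cinner (\<phi> k) (W n p (\<phi> k))) \<partial>std_normal2)"
    proof (rule summable_comparison_test'[OF summable_norm])
      fix k
      have "(\<integral>p. cmod (cinner (\<phi> k) (W n p (\<phi> k))) \<partial>std_normal2) \<le> (\<integral>p. (norm (\<phi> k))\<^sup>2 \<partial>std_normal2)"
        by (intro integral_mono integrable_norm int bound) simp
      then show "norm (\<integral>p. cmod (cinner (\<phi> k) (W n p (\<phi> k))) \<partial>std_normal2) \<le> (norm (\<phi> k))\<^sup>2"
        using std_normal2.P.prob_space by simp
    qed
    have suminf: "(\<Sum>k. cinner (\<phi> k) (W n p (\<phi> k))) = X n p" for p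
      using has_sum_imp_sums[OF chi'] by (rule sums_unique[symmetric])
    have X_int: "integrable std_normal2 (X n)"
      using integrable_suminf[OF int AE_I2[OF sm] si] by (simp add: suminf)
    have "(\<lambda>k. \<integral>p. cinner (\<phi> k) (W n p (\<phi> k)) \<partial>std_normal2) sums (\<integral>p. X n p \<partial>std_normal2)"
      using sums_integral[OF int AE_I2[OF sm] si] by (simp add: suminf)
    then have "(\<lambda>k. (1 + (e n)\<^sup>2) * Re (complex_of_real (1 / (1 + (e n)\<^sup>2)) * cinner (\<phi> k) (D n (\<phi> k))))
        sums ((1 + (e n)\<^sup>2) * Re (\<integral>p. X n p \<partial>std_normal2))"
      unfolding avg by (intro sums_mult sums_Re)
    moreover have "Re (\<integral>p. X n p \<partial>std_normal2) = G n"
      using integral_bounded_linear[OF bounded_linear_Re X_int] unfolding X_Re G_def by simp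
    moreover have "(1 + (e n)\<^sup>2) * Re (complex_of_real (1 / (1 + (e n)\<^sup>2)) * z) = Re z" for z
    proof -
      have "1 + (e n)\<^sup>2 \<noteq> 0" using e2[of n] by linarith
      then show ?thesis by (simp add: Re_divide_of_real)
    qed
    ultimately show ?thesis by simp
  qed
  have F: "((\<lambda>xs. s n ^ count (mset xs) j * q xs) has_sum ((1 + (e n)\<^sup>2) * G n)) UNIV" for n
  proof -
    have "0 \<le> s n ^ count M j" "s n ^ count M j \<le> 1" for M
      using s[of n] by (auto simp: power_le_one)
    from swap_weighted_norms[OF norm, of "\<lambda>M. s n ^ count M j", OF this]
    obtain T where T: "((\<lambda>k. Re (cinner (\<phi> k) (D n (\<phi> k)))) has_sum T) UNIV"
      "((\<lambda>xs. s n ^ count (mset xs) j * q xs) has_sum T) UNIV"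
      unfolding D_def q_def by blast
    then have "T = (1 + (e n)\<^sup>2) * G n"
      using has_sum_imp_sums[OF T(1)] main[of n] sums_unique2 by blast
    then show ?thesis using T(2) by simp
  qed
  have q1: "(q has_sum 1) UNIV"
  proof -
    obtain T where T: "((\<lambda>k. Re (cinner (\<phi> k) (diag (\<lambda>_. 1) (\<phi> k)))) has_sum T) UNIV"
      "((\<lambda>xs. 1 * q xs) has_sum T) UNIV"
      using swap_weighted_norms[OF norm, of "\<lambda>_. 1"] unfolding q_def by auto
    have "diag (\<lambda>_. 1) \<psi> = \<psi>" for \<psi> :: "'n fock"
      by (rule fock_eqI) (simp add: coord_diag)
    then have "T = 1" using T(1) norm has_sum_unique by (simp add: cinner_self) blast
    then show ?thesis using T(2) by simp
  qed
  have lim_e: "(\<lambda>n. (e n)\<^sup>2) \<longlonglongrightarrow> 0" unfolding e_def by real_asymp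
  have "((\<lambda>xs. real (count (mset xs) j) * q xs) has_sum ((A + C + a\<^sup>2 + b\<^sup>2 - 1) / 2)) UNIV"
  proof (rule has_sum_of_sums_pos[where s = s and F = "\<lambda>n. (1 + (e n)\<^sup>2) * G n"])
    show "0 \<le> q xs" for xs unfolding q_def by (rule infsum_nonneg) simp
    show "s \<longlonglongrightarrow> 1"
    proof -
      have "s \<longlonglongrightarrow> (1 - 0) / (1 + 0)" unfolding s_def by (intro tendsto_intros lim_e) simp
      then show ?thesis by simp
    qed
    have "(\<lambda>n. (1 - G n) / (e n)\<^sup>2) \<longlonglongrightarrow> A + C + a\<^sup>2 + b\<^sup>2"
      unfolding G_def e_def
    proof (rule gaussian_average_limit)
      show "0 \<le> A * x\<^sup>2 + B * (x * y) + C * y\<^sup>2" for x y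
        using pos[of "x *\<^sub>R axis (Inl j) 1 + y *\<^sub>R axis (Inr j) 1"] unfolding quad .
    qed
    \<comment> \<open>With \<open>t = (e n)\<^sup>2\<close>, the difference quotient is rewritten by
      \<open>1 - (1 + t) * G n = (1 + t) * (1 - G n) - t\<close> and
      \<open>1 - s n = 2 * t / (1 + t)\<close>.\<close>
    then have "(\<lambda>n. (1 + (e n)\<^sup>2) * ((1 + (e n)\<^sup>2) * ((1 - G n) / (e n)\<^sup>2) - 1) / 2) \<longlonglongrightarrow>
        (1 + 0) * ((1 + 0) * (A + C + a\<^sup>2 + b\<^sup>2) - 1) / 2"
      by (intro tendsto_intros lim_e) simp_all
    moreover have "(1 + (e n)\<^sup>2) * ((1 + (e n)\<^sup>2) * ((1 - G n) / (e n)\<^sup>2) - 1) / 2 =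
        (1 - (1 + (e n)\<^sup>2) * G n) / (1 - s n)" for n
    proof -
      define t where "t = (e n)\<^sup>2"
      have t: "0 < t" unfolding t_def by (rule e2)
      then have s_eq: "1 - s n = 2 * t / (1 + t)" unfolding s_def t_def[symmetric] by (simp add: field_simps)
      show ?thesis using t unfolding s_eq t_def[symmetric] by (simp add: field_simps)
    qed
    ultimately show "(\<lambda>n. (1 - (1 + (e n)\<^sup>2) * G n) / (1 - s n)) \<longlonglongrightarrow> (A + C + a\<^sup>2 + b\<^sup>2 - 1) / 2"
      by (simp only: add_0_right mult_1_left)
  qed (use s q1 F in auto)
  then show ?thesis by (simp add: q_def A_def C_def a_def b_def)
qed

lemma has_sum_sum_family:
  fixes f :: "'i \<Rightarrow> 'x \<Rightarrow> real"
  assumes "finite I" "\<And>i. i \<in> I \<Longrightarrow> (f i has_sum S i) A"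
  shows "((\<lambda>x. \<Sum>i\<in>I. f i x) has_sum (\<Sum>i\<in>I. S i)) A"
  using assms by (induction I rule: finite_induct) (auto intro: has_sum_add)

lemma sum_UNIV_Plus: "(\<Sum>a\<in>UNIV. f a) = (\<Sum>j\<in>UNIV. f (Inl j) + f (Inr j))" for f :: "'n::finite + 'n \<Rightarrow> real"
  by (simp add: UNIV_Plus_UNIV[symmetric] sum.Plus sum.distrib del: UNIV_Plus_UNIV)

text \<open>The occupation numbers of a word add up to its length, so the mode-wise means add up to
  the total mean; regrouping words by length then gives the sum over particle numbers.\<close>

lemma gaussian_number_has_sum:
  fixes \<phi> :: "nat \<Rightarrow> 'n::finite fock" and w :: "real ^ ('n + 'n)" and S :: "real ^ ('n + 'n) ^ ('n + 'n)"
  assumes norm: "((\<lambda>k. (norm (\<phi> k))\<^sup>2) has_sum 1) UNIV"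
    and chi: "\<And>z. ((\<lambda>k. cinner (\<phi> k) (weyl (cvec z) (\<phi> k))) has_sum
      exp (- \<i> * complex_of_real (sqrt 2 * (w \<bullet> z)) - complex_of_real (z \<bullet> (S *v z)))) UNIV"
    and pos: "\<And>z. 0 \<le> z \<bullet> (S *v z)"
  shows "((\<lambda>r. real r * (\<Sum>xs | length xs = r. \<Sum>\<^sub>\<infinity>k. (cmod (coord (\<phi> k) xs))\<^sup>2)) has_sum
    ((trace S + w \<bullet> w - real CARD('n)) / 2)) UNIV"
proof -
  define q where "q xs = (\<Sum>\<^sub>\<infinity>k. (cmod (coord (\<phi> k) xs))\<^sup>2)" for xs
  have "((\<lambda>xs. \<Sum>j\<in>UNIV. real (count (mset xs) j) * q xs) has_sum
      (\<Sum>j\<in>UNIV. (S $ Inl j $ Inl j + S $ Inr j $ Inr j + (w $ Inl j)\<^sup>2 + (w $ Inr j)\<^sup>2 - 1) / 2)) UNIV"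
    unfolding q_def by (intro has_sum_sum_family gaussian_mode_number_has_sum assms) simp
  moreover have "(\<Sum>j\<in>UNIV. real (count (mset xs) j) * q xs) = real (length xs) * q xs" for xs
  proof -
    have "(\<Sum>j\<in>UNIV. count (mset xs) j) = size (mset xs)"
      unfolding size_multiset_overloaded_eq by (rule sum.mono_neutral_right) (auto simp: not_in_iff)
    then show ?thesis by (simp flip: sum_distrib_right of_nat_sum)
  qed
  moreover have "(\<Sum>j\<in>UNIV. (S $ Inl j $ Inl j + S $ Inr j $ Inr j + (w $ Inl j)\<^sup>2 + (w $ Inr j)\<^sup>2 - 1) / 2) =
      (trace S + w \<bullet> w - real CARD('n)) / 2"
    unfolding trace_def inner_vec_def sum_UNIV_Plus sum_divide_distrib[symmetric]
    by (simp add: sum.distrib sum_subtractf power2_eq_square)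
  ultimately have "((\<lambda>xs. real (length xs) * q xs) has_sum ((trace S + w \<bullet> w - real CARD('n)) / 2)) UNIV"
    by simp
  then have "((\<lambda>(r, xs). real r * q xs) has_sum ((trace S + w \<bullet> w - real CARD('n)) / 2))
      (Sigma UNIV (\<lambda>r. {xs. length xs = r}))"
    by (subst has_sum_reindex_bij_betw[OF bij_betw_words, symmetric]) simp
  then show ?thesis
    unfolding q_def[symmetric]
    by (rule has_sum_SigmaD) (simp add: has_sum_finite_iff sum_distrib_left)
qed

text \<open>Applying \<open>V\<close> to the vectors of the decomposition turns the observable into
  the number operator itself. Only the characteristic function of the rotated state enters, and that
  is \<open>chi\<close>.\<close>

lemma number_expectation_gaussian:
  fixes \<rho> V :: "'n::finite operator" and w :: "real ^ ('n + 'n)" and S :: "real ^ ('n + 'n) ^ ('n + 'n)"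
  assumes \<rho>: "state \<rho>" and V: "unitary_op V"
    and chi: "\<And>z. tr_op (\<rho> \<circ> (inv V \<circ> weyl (cvec z) \<circ> V)) =
      exp (- \<i> * complex_of_real (sqrt 2 * (w \<bullet> z)) - complex_of_real (z \<bullet> (S *v z)))"
    and pos: "\<And>z. 0 \<le> z \<bullet> (S *v z)"
  shows "number_expectation \<rho> V = complex_of_real ((trace S + w \<bullet> w - real CARD('n)) / 2)"
proof -
  obtain v :: "nat \<Rightarrow> 'n fock" where v: "((\<lambda>k. (norm (v k))\<^sup>2) has_sum 1) UNIV"
    and tr: "\<And>T T'. (\<And>\<psi> \<phi>. cinner (T' \<psi>) \<phi> = cinner \<psi> (T \<phi>)) \<Longrightarrow> (\<And>\<psi>. norm (T' \<psi>) \<le> norm \<psi>) \<Longrightarrow>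
          ((\<lambda>k. cinner (v k) (T (v k))) has_sum tr_op (\<rho> \<circ> T)) UNIV"
    by (rule state_decomposition[OF \<rho>]) (rule that, assumption, blast)
  define \<phi> where "\<phi> k = V (v k)" for k
  have norm: "((\<lambda>k. (norm (\<phi> k))\<^sup>2) has_sum 1) UNIV"
    using v by (simp add: \<phi>_def unitary_norm[OF V])
  have inv_norm: "norm (inv V \<psi>) = norm \<psi>" for \<psi>
    using unitary_norm[OF V, of "inv V \<psi>"] V by simp
  have "((\<lambda>k. cinner (\<phi> k) (weyl (cvec z) (\<phi> k))) has_sum
      exp (- \<i> * complex_of_real (sqrt 2 * (w \<bullet> z)) - complex_of_real (z \<bullet> (S *v z)))) UNIV" for z
  proof -
    have "((\<lambda>k. cinner (v k) ((inv V \<circ> weyl (cvec z) \<circ> V) (v k))) has_sum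
        tr_op (\<rho> \<circ> (inv V \<circ> weyl (cvec z) \<circ> V))) UNIV"
    proof (rule tr[where T' = "inv V \<circ> inv (weyl (cvec z)) \<circ> V"])
      show "cinner ((inv V \<circ> inv (weyl (cvec z)) \<circ> V) \<psi>) \<eta> = cinner \<psi> ((inv V \<circ> weyl (cvec z) \<circ> V) \<eta>)" for \<psi> \<eta>
        by (simp add: unitary_cinner_inv_left V unitary_weyl unitary_cinner_inv)
      show "norm ((inv V \<circ> inv (weyl (cvec z)) \<circ> V) \<psi>) \<le> norm \<psi>" for \<psi>
        by (simp add: inv_norm inv_weyl unitary_norm[OF unitary_weyl] unitary_norm[OF V])
    qed
    then show ?thesis unfolding chi by (simp add: \<phi>_def unitary_cinner_inv[OF V])
  qed
  from gaussian_number_has_sum[OF norm this pos]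
  have sum: "((\<lambda>r. real r * (\<Sum>xs | length xs = r. \<Sum>\<^sub>\<infinity>k. (cmod (coord (\<phi> k) xs))\<^sup>2)) has_sum
    ((trace S + w \<bullet> w - real CARD('n)) / 2)) UNIV" .
  have "tr_op (\<rho> \<circ> adj_op V \<circ> number_proj r \<circ> V) =
      complex_of_real (\<Sum>xs | length xs = r. \<Sum>\<^sub>\<infinity>k. (cmod (coord (\<phi> k) xs))\<^sup>2)" for r
  proof -
    let ?T = "inv V \<circ> number_proj r \<circ> V"
    have "((\<lambda>k. cinner (v k) (?T (v k))) has_sum tr_op (\<rho> \<circ> ?T)) UNIV"
    proof (rule tr[where T' = ?T])
      show "cinner (?T \<psi>) \<eta> = cinner \<psi> (?T \<eta>)" for \<psi> \<eta>
        by (simp add: unitary_cinner_inv_left V unitary_cinner_inv cinner_number_proj)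
      show "norm (?T \<psi>) \<le> norm \<psi>" for \<psi>
        using norm_number_proj_le[of r "V \<psi>"] by (simp add: inv_norm unitary_norm[OF V])
    qed
    then have "((\<lambda>k. complex_of_real (\<Sum>xs | length xs = r. (cmod (coord (\<phi> k) xs))\<^sup>2)) has_sum tr_op (\<rho> \<circ> ?T)) UNIV"
      by (simp only: o_apply unitary_cinner_inv[OF V] \<phi>_def[symmetric] cinner_number_proj_self)
    moreover have "((\<lambda>k. complex_of_real (\<Sum>xs | length xs = r. (cmod (coord (\<phi> k) xs))\<^sup>2)) has_sum
        complex_of_real (\<Sum>xs | length xs = r. \<Sum>\<^sub>\<infinity>k. (cmod (coord (\<phi> k) xs))\<^sup>2)) UNIV"
    proof (intro has_sum_of_real has_sum_sum_family)
      fix xs :: "'n list"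
      have "(\<lambda>k. (cmod (coord (\<phi> k) xs))\<^sup>2) summable_on UNIV"
      proof (rule summable_on_comparison_test)
        show "(\<lambda>k. (norm (\<phi> k))\<^sup>2) summable_on UNIV" using norm by (auto simp: summable_on_def)
        show "(cmod (coord (\<phi> k) xs))\<^sup>2 \<le> (norm (\<phi> k))\<^sup>2" for k
          by (intro power_mono coord_le_norm) simp
      qed simp
      then show "((\<lambda>k. (cmod (coord (\<phi> k) xs))\<^sup>2) has_sum (\<Sum>\<^sub>\<infinity>k. (cmod (coord (\<phi> k) xs))\<^sup>2)) UNIV"
        by (rule has_sum_infsum)
    qed simp
    ultimately have "tr_op (\<rho> \<circ> ?T) = complex_of_real (\<Sum>xs | length xs = r. \<Sum>\<^sub>\<infinity>k. (cmod (coord (\<phi> k) xs))\<^sup>2)"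
      by (rule has_sum_unique)
    then show ?thesis by (simp add: adj_op_unitary[OF V] o_assoc)
  qed
  then have "number_expectation \<rho> V = (\<Sum>\<^sub>\<infinity>r. complex_of_real (real r *
      (\<Sum>xs | length xs = r. \<Sum>\<^sub>\<infinity>k. (cmod (coord (\<phi> k) xs))\<^sup>2)))"
    unfolding number_expectation_def by simp
  also have "\<dots> = complex_of_real ((trace S + w \<bullet> w - real CARD('n)) / 2)"
    by (rule infsumI, rule has_sum_of_real, rule sum)
  finally show ?thesis .
qed

section \<open>Gaussian states under the gates\<close>

text \<open>The sign of \<open>m\<close> is absorbed into the single vector \<open>w\<close>, and of
  the uncertainty relation only the nonnegativity of the real quadratic form is kept, which is what
  the small-variance limit uses.\<close>

definition gaussian_char ::
    "real ^ ('n + 'n) \<Rightarrow> real ^ ('n + 'n) ^ ('n + 'n) \<Rightarrow> 'n::finite operator \<Rightarrow> bool" where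
  "gaussian_char w S \<rho> \<longleftrightarrow> state \<rho> \<and> (\<forall>z. 0 \<le> z \<bullet> (S *v z)) \<and>
     (\<forall>z. tr_op (\<rho> \<circ> weyl (cvec z)) =
        exp (- \<i> * complex_of_real (sqrt 2 * (w \<bullet> z)) - complex_of_real (z \<bullet> (S *v z))))"

lemma pt_components [simp]: "pt x y $ Inl j = x $ j" "pt x y $ Inr j = y $ j"
  by (simp_all add: pt_def)

lemma pt_cases: obtains x y where "z = pt x y"
proof
  have "z $ a = pt (\<chi> j. z $ Inl j) (\<chi> j. z $ Inr j) $ a" for a
    by (cases a) simp_all
  then show "z = pt (\<chi> j. z $ Inl j) (\<chi> j. z $ Inr j)" by (subst vec_eq_iff) blast
qed

lemma inner_pt: "pt l m \<bullet> pt x y = l \<bullet> x + m \<bullet> y"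
  by (simp add: inner_vec_def sum_UNIV_Plus sum.distrib)

text \<open>On a real vector the matrix \<open>Q\<close> contributes nothing to the real part of the
  Hermitian form.\<close>

lemma cpsd_imp_nonneg:
  assumes "cpsd P Q"
  shows "0 \<le> z \<bullet> (P *v z)"
proof -
  define v where "v = (\<chi> a. complex_of_real (z $ a))"
  have "0 \<le> Re (cdot v ((\<chi> a b. Complex (P $ a $ b) (Q $ a $ b)) *v v))"
    using assms unfolding cpsd_def complex_nonneg_Reals_iff by blast
  also have "\<dots> = z \<bullet> (P *v z)"
    by (simp add: cdot_def inner_vec_def matrix_vector_mult_def v_def)
  finally show ?thesis .
qed

lemma gaussian_state_imp_char:
  assumes "gaussian_state l m S \<rho>"
  shows "gaussian_char (pt l (- m)) S \<rho>"
proof -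
  have "0 \<le> z \<bullet> (S *v z)" for z
    using assms cpsd_imp_nonneg[of "2 *\<^sub>R S" Jmat z]
    by (simp add: gaussian_state_def flip: scaleR_matrix_vector_assoc)
  moreover have "tr_op (\<rho> \<circ> weyl (cvec z)) =
      exp (- \<i> * complex_of_real (sqrt 2 * (pt l (- m) \<bullet> z)) - complex_of_real (z \<bullet> (S *v z)))" for z
  proof -
    obtain x y where z: "z = pt x y" by (rule pt_cases)
    have "tr_op (\<rho> \<circ> weyl (cvec (pt x y))) = exp (- \<i> * complex_of_real (sqrt 2 * (l \<bullet> x - m \<bullet> y))
        - complex_of_real (pt x y \<bullet> (S *v pt x y)))"
      using assms unfolding gaussian_state_def by blast
    moreover have "l \<bullet> x - m \<bullet> y = pt l (- m) \<bullet> z"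
      by (simp add: z inner_pt)
    ultimately show ?thesis by (simp add: z)
  qed
  ultimately show ?thesis using assms by (simp add: gaussian_char_def gaussian_state_def)
qed

lemma gaussian_channel_char:
  assumes "gaussian_channel A B K" and "gaussian_state l m S \<rho>"
  shows "gaussian_char (transpose A *v pt l (- m)) (transpose A ** S ** A + (1 / 2) *\<^sub>R B) (K \<rho>)"
proof -
  define w where "w = transpose A *v pt l (- m)"
  \<comment> \<open>\<open>pt\<close> is onto, so output parameters meeting the premise in
    \<open>gaussian_channel\<close> exist.\<close>
  obtain l' m where "w = pt l' m" by (rule pt_cases)
  then obtain m' where w: "pt l' (- m') = w" by (metis minus_minus)
  then have "gaussian_state l' m' (transpose A ** S ** A + (1 / 2) *\<^sub>R B) (K \<rho>)"
    using assms unfolding gaussian_channel_def w_def by blast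
  from gaussian_state_imp_char[OF this] show ?thesis unfolding w by (simp add: w_def)
qed

lemma number_expectation_id:
  fixes \<rho> :: "'n::finite operator"
  assumes "gaussian_char w S \<rho>"
  shows "number_expectation \<rho> id = complex_of_real ((trace S + w \<bullet> w - real CARD('n)) / 2)"
  by (rule number_expectation_gaussian) (use assms unitary_id in \<open>auto simp: gaussian_char_def\<close>)

lemma tr_op_scaleC:
  assumes "state \<rho>"
  shows "tr_op (\<rho> \<circ> (\<lambda>\<psi>. c *\<^sub>C T \<psi>)) = c * tr_op (\<rho> \<circ> T)"
proof -
  have "bounded_op \<rho>" using assms by (simp add: state_def positive_op_def)
  then show ?thesis
    by (simp add: tr_op_def bounded_op_scaleC cinner_scaleC_right infsum_cmult_right')
qed

text \<open>Conjugating a Weyl operator by \<open>weyl u\<close> only multiplies it by a phase whose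
  exponent is linear in \<open>z\<close>; this phase joins the linear term of the characteristic
  function and shifts \<open>w\<close> by \<open>d\<close>.\<close>

lemma number_expectation_weyl:
  fixes \<rho> :: "'n::finite operator"
  assumes \<rho>: "gaussian_char w S \<rho>" and d: "\<And>z. 2 * Im (cdot (cvec z) u) = sqrt 2 * (d \<bullet> z)"
  shows "number_expectation \<rho> (weyl u) =
    complex_of_real ((trace S + (w + d) \<bullet> (w + d) - real CARD('n)) / 2)"
proof (rule number_expectation_gaussian)
  fix z
  let ?c = "exp (- \<i> * complex_of_real (sqrt 2 * (d \<bullet> z)))"
  have "inv (weyl u) \<circ> weyl (cvec z) \<circ> weyl u = (\<lambda>\<psi>. ?c *\<^sub>C weyl (cvec z) \<psi>)"
  proof
    fix \<psi>
    have "Im (cdot (- u) (cvec z + u)) = Im (cdot (cvec z) u)"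
      by (simp add: cdot_minus_left cdot_add_right cdot_self cdot_commute[of u "cvec z"])
    then have "weyl (- u) (weyl (cvec z) (weyl u \<psi>)) =
        (exp (- \<i> * Im (cdot (cvec z) u)) * exp (- \<i> * Im (cdot (cvec z) u))) *\<^sub>C weyl (cvec z) \<psi>"
      by (simp add: weyl_weyl bounded_op_scaleC[OF bounded_op_unitary[OF unitary_weyl]])
    also have "exp (- \<i> * Im (cdot (cvec z) u)) * exp (- \<i> * Im (cdot (cvec z) u)) = ?c"
      unfolding exp_add[symmetric] d[symmetric] by (simp add: algebra_simps)
    finally show "(inv (weyl u) \<circ> weyl (cvec z) \<circ> weyl u) \<psi> = ?c *\<^sub>C weyl (cvec z) \<psi>"
      by (simp add: inv_weyl)
  qed
  then have "tr_op (\<rho> \<circ> (inv (weyl u) \<circ> weyl (cvec z) \<circ> weyl u)) = ?c * tr_op (\<rho> \<circ> weyl (cvec z))"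
    using \<rho> by (simp add: tr_op_scaleC gaussian_char_def)
  also have "\<dots> = ?c * exp (- \<i> * complex_of_real (sqrt 2 * (w \<bullet> z)) - complex_of_real (z \<bullet> (S *v z)))"
    using \<rho> by (simp add: gaussian_char_def)
  also have "\<dots> = exp (- \<i> * complex_of_real (sqrt 2 * ((w + d) \<bullet> z)) - complex_of_real (z \<bullet> (S *v z)))"
    unfolding exp_add[symmetric] by (simp add: inner_add_left algebra_simps)
  finally show "tr_op (\<rho> \<circ> (inv (weyl u) \<circ> weyl (cvec z) \<circ> weyl u)) =
    exp (- \<i> * complex_of_real (sqrt 2 * ((w + d) \<bullet> z)) - complex_of_real (z \<bullet> (S *v z)))" .
qed (use \<rho> unitary_weyl in \<open>auto simp: gaussian_char_def\<close>)

lemma two_mult_div_sqrt_two: "2 * x / sqrt 2 = sqrt 2 * (x :: real)"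
  by (simp add: field_simps)

lemma number_expectation_Gp:
  fixes \<rho> :: "'n::finite operator"
  assumes "gaussian_char w S \<rho>"
  shows "number_expectation \<rho> (Gp j) =
    complex_of_real ((trace S + (w \<bullet> w + 2 * w $ Inl j + 1) - real CARD('n)) / 2)"
proof -
  \<comment> \<open>The shift is a unit vector, so the squared length of the shifted mean exposes
    the entry \<open>w $ Inl j\<close> linearly.\<close>
  have "2 * Im (cdot (cvec z) (axis j (\<i> / complex_of_real (sqrt 2)))) = sqrt 2 * (axis (Inl j) 1 \<bullet> z)" for z
    using two_mult_div_sqrt_two by (simp add: cdot_axis_right cvec_def inner_axis' Im_divide_of_real)
  from number_expectation_weyl[OF assms this]
  show ?thesis
    by (simp add: Gp_def inner_add_left inner_add_right inner_axis inner_axis' algebra_simps)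
qed

lemma number_expectation_Gq:
  fixes \<rho> :: "'n::finite operator"
  assumes "gaussian_char w S \<rho>"
  shows "number_expectation \<rho> (Gq j) =
    complex_of_real ((trace S + (w \<bullet> w - 2 * w $ Inr j + 1) - real CARD('n)) / 2)"
proof -
  \<comment> \<open>The minus sign comes from the conjugation of \<open>cvec z\<close> in
    \<open>cdot\<close>.\<close>
  have "2 * Im (cdot (cvec z) (axis j (1 / complex_of_real (sqrt 2)))) = sqrt 2 * ((- axis (Inr j) 1) \<bullet> z)" for z
    using two_mult_div_sqrt_two by (simp add: cdot_axis_right cvec_def inner_axis' Im_divide_of_real)
  from number_expectation_weyl[OF assms this]
  show ?thesis
    by (simp add: Gq_def inner_add_left inner_add_right inner_diff_left inner_diff_right inner_axis inner_axis' algebra_simps)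
qed

text \<open>Moving the gate onto the Weyl operators replaces \<open>z\<close> by
  \<open>M *v z\<close>; the inverse \<open>M\<close> of \<open>L\<close> appears because
  \<open>V\<close> is undone on the outside.\<close>

lemma number_expectation_second_quant:
  fixes \<rho> :: "'n::finite operator"
  assumes \<rho>: "gaussian_char w S \<rho>" and V: "second_quant L V" and LM: "L ** M = mat 1"
  shows "number_expectation \<rho> V = complex_of_real
    ((trace (transpose M ** S ** M) + (transpose M *v w) \<bullet> (transpose M *v w) - real CARD('n)) / 2)"
proof (rule number_expectation_gaussian)
  show U: "unitary_op V" using V by (simp add: second_quant_def)
  have inner_M: "x \<bullet> (transpose M *v y) = (M *v x) \<bullet> y" for x y
    by (metis dot_lmul_matrix inner_commute transpose_matrix_vector)
  have quad: "z \<bullet> (transpose M ** S ** M *v z) = (M *v z) \<bullet> (S *v (M *v z))" for z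
    by (simp only: inner_M matrix_vector_mul_assoc[symmetric])
  show "0 \<le> z \<bullet> (transpose M ** S ** M *v z)" for z
    unfolding quad using \<rho> by (simp add: gaussian_char_def)
  fix z
  have "V \<circ> weyl (cvec (M *v z)) \<circ> inv V = weyl (cvec (L *v (M *v z)))"
    using V by (simp add: second_quant_def)
  then have "weyl (cvec z) = V \<circ> weyl (cvec (M *v z)) \<circ> inv V"
    by (simp add: matrix_vector_mul_assoc LM)
  then have "inv V \<circ> weyl (cvec z) \<circ> V = weyl (cvec (M *v z))"
    using U by (simp add: fun_eq_iff)
  then have "tr_op (\<rho> \<circ> (inv V \<circ> weyl (cvec z) \<circ> V)) = exp (- \<i> * complex_of_real (sqrt 2 * (w \<bullet> (M *v z)))
      - complex_of_real ((M *v z) \<bullet> (S *v (M *v z))))"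
    using \<rho> by (simp add: gaussian_char_def)
  moreover have "(transpose M *v w) \<bullet> z = w \<bullet> (M *v z)"
    using inner_M[of z w] by (simp add: inner_commute)
  ultimately show "tr_op (\<rho> \<circ> (inv V \<circ> weyl (cvec z) \<circ> V)) =
    exp (- \<i> * complex_of_real (sqrt 2 * ((transpose M *v w) \<bullet> z)) - complex_of_real (z \<bullet> (transpose M ** S ** M *v z)))"
    unfolding quad by simp
qed (use \<rho> in \<open>simp add: gaussian_char_def\<close>)

text \<open>Subtracting the value at \<open>id\<close> from those at the displaced observables
  isolates single entries of the mean; once the means agree, the value at \<open>id\<close> leaves
  the trace.\<close>

lemma gates_a_determine:
  fixes \<rho> \<rho>' :: "'n::finite operator"
  assumes \<rho>: "gaussian_char w S \<rho>" and \<rho>': "gaussian_char w' S' \<rho>'"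
    and eq: "\<And>V. V \<in> gates_a \<Longrightarrow> number_expectation \<rho> V = number_expectation \<rho>' V"
  shows "w = w'" "trace S = trace S'"
proof -
  have id: "trace S + w \<bullet> w = trace S' + w' \<bullet> w'"
    using eq[of id] unfolding number_expectation_id[OF \<rho>] number_expectation_id[OF \<rho>'] of_real_eq_iff
    by (simp add: gates_a_def)
  have Inl: "w $ Inl j = w' $ Inl j" for j
    using eq[of "Gp j"] id
    unfolding number_expectation_Gp[OF \<rho>] number_expectation_Gp[OF \<rho>'] of_real_eq_iff
    by (simp add: gates_a_def)
  have Inr: "w $ Inr j = w' $ Inr j" for j
    using eq[of "Gq j"] id
    unfolding number_expectation_Gq[OF \<rho>] number_expectation_Gq[OF \<rho>'] of_real_eq_iff
    by (simp add: gates_a_def)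
  have "w $ a = w' $ a" for a by (cases a) (simp_all add: Inl Inr)
  then show "w = w'" by (simp add: vec_eq_iff)
  then show "trace S = trace S'" using id by simp
qed

section \<open>Embedded symplectic matrices\<close>

text \<open>Block-diagonal matrices along \<open>range f\<close>. Embedded gates, where
  \<open>D = mat 1\<close>, and \<open>Jmat\<close> itself both have this form, so products with
  \<open>Jmat\<close> can be computed blockwise.\<close>

definition glue :: "('k \<Rightarrow> 'm) \<Rightarrow> real ^ 'k ^ 'k \<Rightarrow> real ^ 'm ^ 'm \<Rightarrow> real ^ 'm ^ 'm::finite" where
  "glue f Q D = (\<chi> a b. if a \<in> range f \<and> b \<in> range f then Q $ inv f a $ inv f b
     else if a \<notin> range f \<and> b \<notin> range f then D $ a $ b else 0)"

lemma glue_embed: "embed f Q = glue f Q (mat 1)"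
  by (auto simp: embed_def glue_def vec_eq_iff mat_def)

lemma transpose_glue: "transpose (glue f Q D) = glue f (transpose Q) (transpose D)"
  by (auto simp: glue_def vec_eq_iff transpose_def)

lemma sum_range:
  fixes f :: "'k::finite \<Rightarrow> 'm::finite" and g :: "'m \<Rightarrow> real"
  assumes "inj f" and "\<And>c. c \<notin> range f \<Longrightarrow> g c = 0"
  shows "(\<Sum>c\<in>UNIV. g c) = (\<Sum>l\<in>UNIV. g (f l))"
proof -
  have "(\<Sum>c\<in>UNIV. g c) = (\<Sum>c\<in>range f. g c)"
    by (rule sum.mono_neutral_right) (use assms in auto)
  then show ?thesis using assms by (simp add: sum.reindex)
qed

lemma embed_mult_glue:
  fixes f :: "'k::finite \<Rightarrow> 'm::finite"
  assumes f: "inj f"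
  shows "embed f A ** glue f B D = glue f (A ** B) D"
proof -
  have "(embed f A ** glue f B D) $ a $ b = glue f (A ** B) D $ a $ b" for a b
  proof (cases "a \<in> range f")
    case True
    then obtain k where a: "a = f k" by blast
    have "(embed f A ** glue f B D) $ a $ b = (\<Sum>c\<in>UNIV. embed f A $ a $ c * glue f B D $ c $ b)"
      by (simp add: matrix_matrix_mult_def)
    also have "\<dots> = (\<Sum>l\<in>UNIV. embed f A $ a $ f l * glue f B D $ f l $ b)"
      by (rule sum_range[OF f]) (use True in \<open>auto simp: embed_def\<close>)
    also have "\<dots> = glue f (A ** B) D $ a $ b"
      using f by (auto simp: embed_def glue_def a matrix_matrix_mult_def)
    finally show ?thesis .
  next
    case False
    have "(embed f A ** glue f B D) $ a $ b = (\<Sum>c\<in>UNIV. if c = a then glue f B D $ a $ b else 0)"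
      unfolding matrix_matrix_mult_def vec_lambda_beta
      by (intro sum.cong refl) (use False in \<open>auto simp: embed_def\<close>)
    also have "\<dots> = glue f B D $ a $ b" by simp
    also have "\<dots> = glue f (A ** B) D $ a $ b" using False by (simp add: glue_def)
    finally show ?thesis .
  qed
  then show ?thesis by (simp add: vec_eq_iff)
qed

lemma transpose_embed: "transpose (embed f Q) = embed f (transpose Q)"
  by (simp add: glue_embed transpose_glue)

lemma glue_mult_embed:
  fixes f :: "'k::finite \<Rightarrow> 'm::finite"
  assumes f: "inj f"
  shows "glue f B D ** embed f A = glue f (B ** A) D"
proof -
  have "transpose (glue f B D ** embed f A) = transpose (glue f (B ** A) D)"
    by (simp add: matrix_transpose_mul transpose_embed transpose_glue embed_mult_glue[OF f])
  then show ?thesis by (metis transpose_transpose)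
qed

lemma embed_mult_embed: "inj f \<Longrightarrow> embed f A ** embed f B = embed f (A ** B)"
  for f :: "'k::finite \<Rightarrow> 'm::finite"
  by (simp add: glue_embed[of f B] glue_embed[of f "A ** B"] embed_mult_glue)

lemma embed_one: "inj f \<Longrightarrow> embed f (mat 1) = mat 1"
  by (auto simp: embed_def vec_eq_iff mat_def)

lemma matrix_inv_mult:
  fixes Q :: "real ^ 'k ^ 'k"
  assumes "Q ** R = mat 1"
  shows "Q ** matrix_inv Q = mat 1"
proof -
  have "R ** Q = mat 1" using assms matrix_left_right_inverse by blast
  with assms show ?thesis
    unfolding matrix_inv_def by (metis (mono_tags, lifting) someI_ex)
qed

definition Jsub :: "('k \<Rightarrow> 'n + 'n::finite) \<Rightarrow> real ^ 'k ^ 'k::finite" where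
  "Jsub f = (\<chi> k l. Jmat $ f k $ f l)"

text \<open>
  \<open>sp_block f Q\<close> collects what makes \<open>embed f (tau Q)\<close> symplectic with inverse \<open>embed f Q\<close>;
  the last condition says that the coordinates in \<open>range f\<close> form complete modes.
\<close>

definition sp_block :: "('k::finite \<Rightarrow> 'n + 'n::finite) \<Rightarrow> real ^ 'k ^ 'k \<Rightarrow> bool" where
  "sp_block f Q \<longleftrightarrow> inj f \<and> transpose Q = Q \<and> Q ** Jsub f ** Q = Jsub f \<and>
     Jsub f ** Jsub f = - mat 1 \<and> (\<forall>a b. (a \<in> range f) \<noteq> (b \<in> range f) \<longrightarrow> Jmat $ a $ b = 0)"

text \<open>Multiplying \<open>Q ** Jsub f ** Q = Jsub f\<close> by \<open>- Jsub f\<close> from the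
  right exhibits a right inverse of \<open>Q\<close>; by symmetry of \<open>Q\<close>, transposing
  the resulting identity yields the one for \<open>tau Q\<close>.\<close>

lemma sp_block_inverse:
  assumes "sp_block f Q"
  shows "embed f (tau Q) ** embed f Q = mat 1"
proof -
  have f: "inj f" and Q: "transpose Q = Q" "Q ** Jsub f ** Q = Jsub f" "Jsub f ** Jsub f = - mat 1"
    using assms by (auto simp: sp_block_def)
  have "Q ** (Jsub f ** Q ** (- Jsub f)) = (Q ** Jsub f ** Q) ** (- Jsub f)"
    by (simp only: matrix_mul_assoc)
  also have "\<dots> = - (Jsub f ** Jsub f)"
    unfolding Q(2) by (simp add: vec_eq_iff matrix_matrix_mult_def sum_negf)
  finally have "Q ** (Jsub f ** Q ** (- Jsub f)) = mat 1" by (simp add: Q(3))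
  then have "Q ** matrix_inv Q = mat 1" by (rule matrix_inv_mult)
  then have "tau Q ** Q = mat 1"
    unfolding tau_def by (metis Q(1) matrix_transpose_mul transpose_mat)
  then show ?thesis by (simp add: embed_mult_embed[OF f] embed_one[OF f])
qed

text \<open>The symplectic relation holds blockwise for the symmetric matrix
  \<open>embed f Q\<close>, and multiplying it by the inverse on both sides gives the relation for
  \<open>embed f (tau Q)\<close>.\<close>

lemma sp_block_Sp:
  assumes "sp_block f Q"
  shows "embed f (tau Q) \<in> Sp"
proof -
  let ?P = "embed f Q" and ?L = "embed f (tau Q)"
  have f: "inj f" and Q: "transpose Q = Q" "Q ** Jsub f ** Q = Jsub f"
    and off: "\<And>a b. (a \<in> range f) \<noteq> (b \<in> range f) \<Longrightarrow> Jmat $ a $ b = 0"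
    using assms by (auto simp: sp_block_def)
  have J: "Jmat = glue f (Jsub f) Jmat"
  proof -
    have "Jmat $ a $ b = glue f (Jsub f) Jmat $ a $ b" for a b
      using off[of a b] f by (auto simp: glue_def Jsub_def)
    then show ?thesis by (auto simp only: vec_eq_iff)
  qed
  have "?P ** Jmat ** ?P = Jmat"
    by (subst J, subst embed_mult_glue[OF f], subst glue_mult_embed[OF f]) (simp add: Q J[symmetric])
  moreover have LP: "?L ** ?P = mat 1" by (rule sp_block_inverse[OF assms])
  moreover have PL: "?P ** ?L = mat 1" using LP matrix_left_right_inverse by blast
  moreover have "transpose ?L ** ?P = mat 1"
    using arg_cong[OF PL, of transpose] by (simp add: matrix_transpose_mul transpose_embed Q transpose_mat)
  ultimately have "transpose ?L ** Jmat ** ?L = transpose ?L ** (?P ** Jmat ** ?P) ** ?L" by simp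
  also have "\<dots> = (transpose ?L ** ?P) ** Jmat ** (?P ** ?L)" by (simp only: matrix_mul_assoc)
  also have "\<dots> = Jmat" using PL \<open>transpose ?L ** ?P = mat 1\<close> by simp
  finally show ?thesis by (simp add: Sp_def)
qed

text \<open>\<open>embed f R\<close> differs from the identity only in rows and columns from
  \<open>range f\<close>, so only those entries of \<open>D\<close> add to its trace.\<close>

lemma trace_mult_embed:
  fixes f :: "'k::finite \<Rightarrow> 'm::finite"
  assumes f: "inj f"
  shows "trace (D ** embed f R) = trace D + (\<Sum>k\<in>UNIV. \<Sum>l\<in>UNIV. D $ f k $ f l * (R $ l $ k - mat 1 $ l $ k))"
proof -
  define E where "E b a = embed f R $ b $ a - mat 1 $ b $ a" for a b
  have E0: "E b a = 0" if "a \<notin> range f \<or> b \<notin> range f" for a b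
    using that by (auto simp: E_def embed_def mat_def)
  have "trace (D ** embed f R) = (\<Sum>a\<in>UNIV. \<Sum>b\<in>UNIV. D $ a $ b * mat 1 $ b $ a + D $ a $ b * E b a)"
    by (simp add: trace_def matrix_matrix_mult_def E_def algebra_simps)
  also have "\<dots> = trace (D ** mat 1) + (\<Sum>a\<in>UNIV. \<Sum>b\<in>UNIV. D $ a $ b * E b a)"
    by (simp only: sum.distrib trace_def matrix_matrix_mult_def vec_lambda_beta)
  also have "(\<Sum>a\<in>UNIV. \<Sum>b\<in>UNIV. D $ a $ b * E b a) = (\<Sum>k\<in>UNIV. \<Sum>b\<in>UNIV. D $ f k $ b * E b (f k))"
    by (rule sum_range[OF f]) (simp add: E0)
  also have "\<dots> = (\<Sum>k\<in>UNIV. \<Sum>l\<in>UNIV. D $ f k $ f l * E (f l) (f k))"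
    by (intro sum.cong refl sum_range[OF f]) (simp add: E0)
  also have "\<dots> = (\<Sum>k\<in>UNIV. \<Sum>l\<in>UNIV. D $ f k $ f l * (R $ l $ k - mat 1 $ l $ k))"
    using f by (simp add: E_def embed_def mat_def inj_eq)
  finally show ?thesis by simp
qed

text \<open>The means agree, so their contributions cancel, and cyclicity of the trace puts the
  squared gate matrix on one side of the covariance. As the total traces agree as well, only the
  block \<open>Q ** Q - mat 1\<close> survives.\<close>

lemma gate_equation:
  fixes \<rho> \<rho>' :: "'n::finite operator" and f :: "'k::finite \<Rightarrow> 'n + 'n"
  assumes \<rho>: "gaussian_char w S \<rho>" and \<rho>': "gaussian_char w S' \<rho>'" and tr: "trace S = trace S'"
    and Q: "sp_block f Q" and V: "second_quant (embed f (tau Q)) V"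
    and eq: "number_expectation \<rho> V = number_expectation \<rho>' V"
  shows "(\<Sum>k\<in>UNIV. \<Sum>l\<in>UNIV. (S - S') $ f k $ f l * ((Q ** Q) $ l $ k - mat 1 $ l $ k)) = 0"
proof -
  let ?P = "embed f Q"
  have f: "inj f" and sym: "transpose Q = Q" using Q by (auto simp: sp_block_def)
  have P: "transpose ?P = ?P" by (simp add: transpose_embed sym)
  have tr_eq: "trace (?P ** T ** ?P) = trace T +
      (\<Sum>k\<in>UNIV. \<Sum>l\<in>UNIV. T $ f k $ f l * ((Q ** Q) $ l $ k - mat 1 $ l $ k))" for T
  proof -
    have "trace (?P ** T ** ?P) = trace (T ** (?P ** ?P))"
      by (metis trace_mul_sym matrix_mul_assoc)
    then show ?thesis by (simp add: embed_mult_embed[OF f] trace_mult_embed[OF f])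
  qed
  note LP = sp_block_inverse[OF Q]
  have "trace (?P ** S ** ?P) = trace (?P ** S' ** ?P)"
    using eq unfolding number_expectation_second_quant[OF \<rho> V LP] number_expectation_second_quant[OF \<rho>' V LP]
      of_real_eq_iff P by simp
  then have "(\<Sum>k\<in>UNIV. \<Sum>l\<in>UNIV. S $ f k $ f l * ((Q ** Q) $ l $ k - mat 1 $ l $ k)) =
      (\<Sum>k\<in>UNIV. \<Sum>l\<in>UNIV. S' $ f k $ f l * ((Q ** Q) $ l $ k - mat 1 $ l $ k))"
    unfolding tr_eq using tr by simp
  then show ?thesis
    by (simp add: left_diff_distrib sum_subtractf)
qed

section \<open>One- and two-mode blocks of the gates\<close>

lemma coords1_simps [simp]: "coords1 j 1 = Inl j" "coords1 j 2 = Inr j"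
  by (simp_all add: coords1_def)

lemma range_coords1: "range (coords1 j) = {Inl j, Inr j}"
proof -
  have "UNIV = {1, 2 :: 2}" using exhaust_2 by auto
  then have "range (coords1 j) = coords1 j ` {1, 2}" by simp
  then show ?thesis by simp
qed

lemma inj_coords1: "inj (coords1 j)"
proof -
  have "\<forall>k l. coords1 j k = coords1 j l \<longrightarrow> k = l" unfolding forall_2 by simp
  then show ?thesis by (intro injI) blast
qed

lemma coords2_simps [simp]:
  "coords2 i j 1 = Inl i" "coords2 i j 2 = Inr i" "coords2 i j 3 = Inl j" "coords2 i j 4 = Inr j"
  by (simp_all add: coords2_def)

lemma range_coords2: "range (coords2 i j) = {Inl i, Inr i, Inl j, Inr j}"
proof -
  have "UNIV = {1, 2, 3, 4 :: 4}" using exhaust_4 by auto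
  then have "range (coords2 i j) = coords2 i j ` {1, 2, 3, 4}" by simp
  then show ?thesis by simp
qed

lemma inj_coords2: "i \<noteq> j \<Longrightarrow> inj (coords2 i j)"
proof -
  assume "i \<noteq> j"
  then have "\<forall>k l. coords2 i j k = coords2 i j l \<longrightarrow> k = l" unfolding forall_4 by simp
  then show ?thesis by (intro injI) blast
qed

text \<open>For a symmetric 2 by 2 matrix the symplectic relation amounts to determinant
  one.\<close>

lemma sp_block_coords1:
  assumes "Q $ 1 $ 2 = Q $ 2 $ 1" "Q $ 1 $ 1 * Q $ 2 $ 2 - Q $ 2 $ 1 * Q $ 2 $ 1 = 1"
  shows "sp_block (coords1 j) Q"
  unfolding sp_block_def
proof (intro conjI allI impI)
  show "inj (coords1 j)" by (rule inj_coords1)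
  show "transpose Q = Q" using assms by (simp add: vec_eq_iff forall_2 transpose_def)
  have J: "Jsub (coords1 j) $ 1 $ 1 = 0" "Jsub (coords1 j) $ 1 $ 2 = -1"
    "Jsub (coords1 j) $ 2 $ 1 = 1" "Jsub (coords1 j) $ 2 $ 2 = 0"
    by (simp_all add: Jsub_def Jmat_def)
  show "Q ** Jsub (coords1 j) ** Q = Jsub (coords1 j)"
    using assms by (simp add: vec_eq_iff forall_2 matrix_matrix_mult_def sum_2 J algebra_simps)
  show "Jsub (coords1 j) ** Jsub (coords1 j) = - mat 1"
    by (simp add: vec_eq_iff forall_2 matrix_matrix_mult_def sum_2 J mat_def)
  show "Jmat $ a $ b = 0" if "(a \<in> range (coords1 j)) \<noteq> (b \<in> range (coords1 j))" for a b
    using that unfolding range_coords1 by (cases a; cases b) (auto simp: Jmat_def)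
qed

lemma Jsub_coords2:
  assumes "i \<noteq> j"
  shows "Jsub (coords2 i j) $ 1 $ 1 = 0" "Jsub (coords2 i j) $ 1 $ 2 = -1"
    "Jsub (coords2 i j) $ 1 $ 3 = 0" "Jsub (coords2 i j) $ 1 $ 4 = 0"
    "Jsub (coords2 i j) $ 2 $ 1 = 1" "Jsub (coords2 i j) $ 2 $ 2 = 0"
    "Jsub (coords2 i j) $ 2 $ 3 = 0" "Jsub (coords2 i j) $ 2 $ 4 = 0"
    "Jsub (coords2 i j) $ 3 $ 1 = 0" "Jsub (coords2 i j) $ 3 $ 2 = 0"
    "Jsub (coords2 i j) $ 3 $ 3 = 0" "Jsub (coords2 i j) $ 3 $ 4 = -1"
    "Jsub (coords2 i j) $ 4 $ 1 = 0" "Jsub (coords2 i j) $ 4 $ 2 = 0"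
    "Jsub (coords2 i j) $ 4 $ 3 = 1" "Jsub (coords2 i j) $ 4 $ 4 = 0"
  using assms by (simp_all add: Jsub_def Jmat_def)

lemma sp_block_coords2:
  assumes "i \<noteq> j" and "transpose Q = Q" "Q ** Jsub (coords2 i j) ** Q = Jsub (coords2 i j)"
  shows "sp_block (coords2 i j) Q"
  unfolding sp_block_def
proof (intro conjI allI impI assms inj_coords2)
  show "Jsub (coords2 i j) ** Jsub (coords2 i j) = - mat 1"
    by (simp add: vec_eq_iff forall_4 matrix_matrix_mult_def sum_4 Jsub_coords2[OF assms(1)] mat_def)
  show "Jmat $ a $ b = 0" if "(a \<in> range (coords2 i j)) \<noteq> (b \<in> range (coords2 i j))" for a b
    using that unfolding range_coords2 by (cases a; cases b) (auto simp: Jmat_def)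
qed

lemma vector_4:
  "(vector [w, x, y, z] :: 'a::zero ^ 4) $ 1 = w" "(vector [w, x, y, z] :: 'a::zero ^ 4) $ 2 = x"
  "(vector [w, x, y, z] :: 'a::zero ^ 4) $ 3 = y" "(vector [w, x, y, z] :: 'a::zero ^ 4) $ 4 = z"
  unfolding vector_def by simp_all

lemma L1_zero_angle: "L1 x 0 = vector [vector [x, 0], vector [0, inverse x]]"
  by (simp add: L1_def rot_def vec_eq_iff forall_2 matrix_matrix_mult_def sum_2 transpose_def)

lemma L1_pi_4: "L1 x (pi / 4) = vector [vector [(x + inverse x) / 2, (x - inverse x) / 2],
    vector [(x - inverse x) / 2, (x + inverse x) / 2]]"
proof -
  define r where "r = sqrt 2 / 2"
  have r: "r * r = 1 / 2" "r * (r * y) = y / 2" for y :: real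
    by (simp_all add: r_def flip: mult.assoc)
  show ?thesis
    by (simp add: L1_def rot_def cos_45 sin_45 vec_eq_iff forall_2 matrix_matrix_mult_def sum_2
        transpose_def r algebra_simps flip: r_def)
      (simp add: field_simps)
qed

text \<open>The explicit form shows the purpose of \<open>Hmat\<close>: it couples x with x and y
  with y across the two modes, and nothing else.\<close>

lemma L2_Hmat: "L2 Hmat 1 x = vector
   [vector [(1 + x) / 2, 0, (x - 1) / 2, 0],
    vector [0, (1 + inverse x) / 2, 0, (inverse x - 1) / 2],
    vector [(x - 1) / 2, 0, (1 + x) / 2, 0],
    vector [0, (inverse x - 1) / 2, 0, (1 + inverse x) / 2]]"
proof -
  define r where "r = 1 / sqrt 2"
  have r: "r * r = 1 / 2" "r * (r * y) = y / 2" for y :: real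
    by (simp_all add: r_def flip: mult.assoc)
  have H: "Hmat $ 1 $ 1 = complex_of_real r" "Hmat $ 1 $ 2 = complex_of_real r"
    by (simp_all only: Hmat_def vector_scaleR_component vector_2) (simp_all add: r_def scaleR_conv_of_real)
  show ?thesis
    by (simp add: L2_def Omat_def H Let_def vec_eq_iff forall_4 matrix_matrix_mult_def sum_4
        transpose_def vector_4 r algebra_simps)
      (simp add: field_simps)
qed

text \<open>Complementary to \<open>Hmat\<close>: the x of each mode is coupled with the y of the
  other.\<close>

lemma L2_Kmat: "L2 Kmat 1 x = vector
   [vector [(1 + x) / 2, 0, 0, (1 - x) / 2],
    vector [0, (1 + inverse x) / 2, (inverse x - 1) / 2, 0],
    vector [0, (inverse x - 1) / 2, (1 + inverse x) / 2, 0],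
    vector [(1 - x) / 2, 0, 0, (1 + x) / 2]]"
proof -
  define r where "r = 1 / sqrt 2"
  have r: "r * r = 1 / 2" "r * (r * y) = y / 2" for y :: real
    by (simp_all add: r_def flip: mult.assoc)
  have K: "Kmat $ 1 $ 1 = complex_of_real r * \<i>" "Kmat $ 1 $ 2 = complex_of_real r"
    by (simp_all only: Kmat_def vector_scaleR_component vector_2) (simp_all add: r_def scaleR_conv_of_real)
  show ?thesis
    by (simp add: L2_def Omat_def K Let_def vec_eq_iff forall_4 matrix_matrix_mult_def sum_4
        transpose_def vector_4 r algebra_simps)
      (simp add: field_simps)
qed

section \<open>Determination of the channel\<close>

lemma sp_block_L1_zero_angle:
  assumes "x \<noteq> 0"
  shows "sp_block (coords1 j) (L1 x 0)"
  using assms by (intro sp_block_coords1) (simp_all add: L1_zero_angle)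

lemma sp_block_L1_pi_4:
  assumes "x \<noteq> 0"
  shows "sp_block (coords1 j) (L1 x (pi / 4))"
  using assms by (intro sp_block_coords1) (simp_all add: L1_pi_4 field_simps power2_eq_square)

lemma sp_block_L2_Hmat:
  assumes "i \<noteq> j" "x \<noteq> 0"
  shows "sp_block (coords2 i j) (L2 Hmat 1 x)"
proof (rule sp_block_coords2[OF assms(1)])
  show "transpose (L2 Hmat 1 x) = L2 Hmat 1 x"
    by (simp add: L2_Hmat vec_eq_iff forall_4 transpose_def vector_4)
  show "L2 Hmat 1 x ** Jsub (coords2 i j) ** L2 Hmat 1 x = Jsub (coords2 i j)"
    using assms(2) by (simp add: L2_Hmat vec_eq_iff forall_4 matrix_matrix_mult_def sum_4 vector_4
        Jsub_coords2[OF assms(1)]) (simp add: field_simps)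
qed

lemma sp_block_L2_Kmat:
  assumes "i \<noteq> j" "x \<noteq> 0"
  shows "sp_block (coords2 i j) (L2 Kmat 1 x)"
proof (rule sp_block_coords2[OF assms(1)])
  show "transpose (L2 Kmat 1 x) = L2 Kmat 1 x"
    by (simp add: L2_Kmat vec_eq_iff forall_4 transpose_def vector_4)
  show "L2 Kmat 1 x ** Jsub (coords2 i j) ** L2 Kmat 1 x = Jsub (coords2 i j)"
    using assms(2) by (simp add: L2_Kmat vec_eq_iff forall_4 matrix_matrix_mult_def sum_4 vector_4
        Jsub_coords2[OF assms(1)]) (simp add: field_simps)
qed

text \<open>The equations are triangular. The diagonal of the difference vanishes first, then the
  entry inside each mode; after that every two-mode equation has just two unknowns left.\<close>

lemma covariance_determined:
  fixes \<rho> \<rho>' :: "'n::{finite,linorder} operator"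
    and \<Gamma> :: "real ^ ('n + 'n) ^ ('n + 'n) \<Rightarrow> 'n operator"
  assumes \<rho>: "gaussian_char w S \<rho>" and \<rho>': "gaussian_char w S' \<rho>'" and tr: "trace S = trace S'"
    and sym: "transpose S = S" "transpose S' = S'"
    and \<Gamma>: "\<And>L. L \<in> Sp \<Longrightarrow> second_quant L (\<Gamma> L)"
    and eq: "\<And>V. V \<in> gates_b \<Gamma> \<union> gates_c \<Gamma> \<Longrightarrow> number_expectation \<rho> V = number_expectation \<rho>' V"
  shows "S = S'"
proof -
  define D where "D = S - S'"
  have D_sym: "D $ a $ b = D $ b $ a" for a b
  proof -
    have "T $ a $ b = T $ b $ a" if "transpose T = T" for T :: "real ^ ('n + 'n) ^ ('n + 'n)"
      using arg_cong[OF that, of "\<lambda>T. T $ b $ a"] by (simp add: transpose_def)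
    from this[OF sym(1)] this[OF sym(2)] show ?thesis by (simp add: D_def)
  qed
  have gate: "(\<Sum>k\<in>UNIV. \<Sum>l\<in>UNIV. D $ f k $ f l * ((Q ** Q) $ l $ k - mat 1 $ l $ k)) = 0"
    if "sp_block f Q" "\<Gamma> (embed f (tau Q)) \<in> gates_b \<Gamma> \<union> gates_c \<Gamma>" for f :: "'k::finite \<Rightarrow> 'n + 'n" and Q
    unfolding D_def
    by (rule gate_equation[OF \<rho> \<rho>' tr that(1) \<Gamma>[OF sp_block_Sp[OF that(1)]] eq[OF that(2)]])
  have b_mem: "\<Gamma> (embed (coords1 j) (tau (L1 (sqrt 2) 0))) \<in> gates_b \<Gamma>"
    "\<Gamma> (embed (coords1 j) (tau (L1 (sqrt 2) (pi / 4)))) \<in> gates_b \<Gamma>"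
    "j \<noteq> Max UNIV \<Longrightarrow> \<Gamma> (embed (coords1 j) (tau (L1 (sqrt 3) 0))) \<in> gates_b \<Gamma>" for j :: 'n
    unfolding gates_b_def by blast+
  have c_mem: "\<Gamma> (embed (coords2 i j) (tau (L2 Hmat 1 2))) \<in> gates_c \<Gamma>"
    "\<Gamma> (embed (coords2 i j) (tau (L2 Hmat 1 3))) \<in> gates_c \<Gamma>"
    "\<Gamma> (embed (coords2 i j) (tau (L2 Kmat 1 2))) \<in> gates_c \<Gamma>"
    "\<Gamma> (embed (coords2 i j) (tau (L2 Kmat 1 3))) \<in> gates_c \<Gamma>" if "i < j" for i j :: 'n
    using that unfolding gates_c_def by blast+
  \<comment> \<open>The squared squeezing matrix minus the identity has diagonal
    \<open>(x\<^sup>2 - 1, 1 / x\<^sup>2 - 1)\<close>: here (1, -1/2), and (2, -2/3) for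
    \<open>sqrt 3\<close>. These pairs are not proportional.\<close>
  have eq2: "D $ Inl j $ Inl j = D $ Inr j $ Inr j / 2" for j
    using gate[OF sp_block_L1_zero_angle[of "sqrt 2" j]] b_mem(1)[of j]
    by (simp add: sum_2 L1_zero_angle matrix_matrix_mult_def mat_def flip: inverse_mult_distrib)
  have eq3: "2 * D $ Inl j $ Inl j = 2 * D $ Inr j $ Inr j / 3" if "j \<noteq> Max UNIV" for j
    using gate[OF sp_block_L1_zero_angle[of "sqrt 3" j]] b_mem(3)[OF that]
    by (simp add: sum_2 L1_zero_angle matrix_matrix_mult_def mat_def flip: inverse_mult_distrib)
  have diag: "D $ Inl j $ Inl j = 0 \<and> D $ Inr j $ Inr j = 0" for j
  proof -
    have other: "D $ Inl j $ Inl j = 0 \<and> D $ Inr j $ Inr j = 0" if "j \<noteq> Max UNIV" for j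
      using eq2[of j] eq3[OF that] by simp
    \<comment> \<open>In the last mode the vanishing trace takes the place of the equation from a
      \<open>sqrt 3\<close> gate.\<close>
    have "trace D = 0" using tr by (simp add: D_def trace_sub)
    then have "(\<Sum>j\<in>UNIV. D $ Inl j $ Inl j + D $ Inr j $ Inr j) = 0"
      by (simp add: trace_def sum_UNIV_Plus)
    moreover have "(\<Sum>j\<in>UNIV. D $ Inl j $ Inl j + D $ Inr j $ Inr j) =
        (\<Sum>j\<in>{Max UNIV}. D $ Inl j $ Inl j + D $ Inr j $ Inr j)"
      by (rule sum.mono_neutral_right) (use other in auto)
    ultimately have "D $ Inl (Max UNIV) $ Inl (Max UNIV) = 0 \<and> D $ Inr (Max UNIV) $ Inr (Max UNIV) = 0"
      using eq2[of "Max UNIV"] by simp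
    then show ?thesis using other by (cases "j = Max UNIV") auto
  qed
  \<comment> \<open>With the diagonal of \<open>D\<close> gone, only the off-diagonal entry
    \<open>(x\<^sup>2 - 1 / x\<^sup>2) / 2 = 3 / 4\<close> of the squared matrix counts, and it is
    nonzero.\<close>
  have same: "D $ Inl j $ Inr j = 0" for j
    using gate[OF sp_block_L1_pi_4[of "sqrt 2" j]] b_mem(2)[of j] diag[of j] D_sym[of "Inr j" "Inl j"]
    by (simp add: sum_2 L1_pi_4 matrix_matrix_mult_def mat_def field_simps)
  have less: "D $ Inl i $ Inl j = 0 \<and> D $ Inr i $ Inr j = 0 \<and> D $ Inl i $ Inr j = 0 \<and> D $ Inr i $ Inl j = 0"
    if "i < j" for i j
  proof -
    have "i \<noteq> j" using that by simp
    note zero = diag[of i] diag[of j] same[of i] same[of j] D_sym[of "Inr i" "Inl i"] D_sym[of "Inr j" "Inl j"]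
      D_sym[of "Inl j" "Inl i"] D_sym[of "Inr j" "Inr i"] D_sym[of "Inl j" "Inr i"] D_sym[of "Inr j" "Inl i"]
    \<comment> \<open>The cross entries of the squared matrix are \<open>(x\<^sup>2 - 1) / 2\<close>
      and \<open>(1 / x\<^sup>2 - 1) / 2\<close>, each occurring twice by symmetry of
      \<open>D\<close>; \<open>x = 2\<close> and \<open>x = 3\<close> give independent
      equations.\<close>
    have H2: "3 * D $ Inl i $ Inl j - 3 / 4 * D $ Inr i $ Inr j = 0"
      using gate[OF sp_block_L2_Hmat[OF \<open>i \<noteq> j\<close>, of 2]] c_mem(1)[OF that] zero
      by (simp add: sum_4 L2_Hmat matrix_matrix_mult_def mat_def vector_4)
    have H3: "8 * D $ Inl i $ Inl j - 8 / 9 * D $ Inr i $ Inr j = 0"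
      using gate[OF sp_block_L2_Hmat[OF \<open>i \<noteq> j\<close>, of 3]] c_mem(2)[OF that] zero
      by (simp add: sum_4 L2_Hmat matrix_matrix_mult_def mat_def vector_4)
    have K2: "3 * D $ Inl i $ Inr j + 3 / 4 * D $ Inr i $ Inl j = 0"
      using gate[OF sp_block_L2_Kmat[OF \<open>i \<noteq> j\<close>, of 2]] c_mem(3)[OF that] zero
      by (simp add: sum_4 L2_Kmat matrix_matrix_mult_def mat_def vector_4)
    have K3: "8 * D $ Inl i $ Inr j + 8 / 9 * D $ Inr i $ Inl j = 0"
      using gate[OF sp_block_L2_Kmat[OF \<open>i \<noteq> j\<close>, of 3]] c_mem(4)[OF that] zero
      by (simp add: sum_4 L2_Kmat matrix_matrix_mult_def mat_def vector_4)
    show ?thesis using H2 H3 K2 K3 by auto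
  qed
  have "D $ a $ b = 0" for a b
  proof -
    define m :: "'n + 'n \<Rightarrow> 'n" where "m = case_sum id id"
    consider "m a < m b" | "m a = m b" | "m b < m a" by fastforce
    then show ?thesis
    proof cases
      case 1
      then show ?thesis using less[of "m a" "m b"] by (cases a; cases b) (auto simp: m_def)
    next
      case 2
      then show ?thesis using diag[of "m a"] same[of "m a"] D_sym[of "Inr (m a)" "Inl (m a)"]
        by (cases a; cases b) (auto simp: m_def)
    next
      case 3
      then show ?thesis using less[of "m b" "m a"] D_sym[of a b] by (cases a; cases b) (auto simp: m_def)
    qed
  qed
  then show ?thesis by (simp add: D_def vec_eq_iff)
qed

theorem mainTheorem5:
  fixes A B A' B' :: "real ^ ('n + 'n) ^ ('n + 'n::{finite,linorder})"
    and K K' :: "'n operator \<Rightarrow> 'n operator"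
    and \<rho> \<rho>' :: "'n \<Rightarrow> 'n operator"
    and \<Gamma> :: "real ^ ('n + 'n) ^ ('n + 'n) \<Rightarrow> 'n operator"
  assumes "gaussian_channel A B K"
    and "gaussian_channel A' B' K'"
    and "\<And>j. gaussian_state (axis j 1) 0 ((1 / 2) *\<^sub>R mat 1) (\<rho> j)"
    and "\<And>j. gaussian_state 0 (axis j 1) ((1 / 2) *\<^sub>R mat 1) (\<rho>' j)"
    and "\<And>L. L \<in> Sp \<Longrightarrow> second_quant L (\<Gamma> L)"
    and "\<And>V. V \<in> gates_a \<union> gates_b \<Gamma> \<union> gates_c \<Gamma> \<Longrightarrow>
           number_expectation (K (\<rho> (Min UNIV))) V = number_expectation (K' (\<rho> (Min UNIV))) V"
    and "\<And>j V. j \<noteq> Min UNIV \<Longrightarrow> V \<in> gates_a \<Longrightarrow>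
           number_expectation (K (\<rho> j)) V = number_expectation (K' (\<rho> j)) V"
    and "\<And>j V. V \<in> gates_a \<Longrightarrow>
           number_expectation (K (\<rho>' j)) V = number_expectation (K' (\<rho>' j)) V"
  shows "A = A' \<and> B = B'"
proof -
  \<comment> \<open>All inputs share the covariance \<open>S0\<close>, so one output covariance
    \<open>S\<close> serves for all of them.\<close>
  define S0 :: "real ^ ('n + 'n) ^ ('n + 'n)" where "S0 = (1 / 2) *\<^sub>R mat 1"
  define S where "S = transpose A ** S0 ** A + (1 / 2) *\<^sub>R B"
  define S' where "S' = transpose A' ** S0 ** A' + (1 / 2) *\<^sub>R B'"
  have pt_axis: "pt (axis j 1) (- 0) = axis (Inl j) 1" "pt 0 (- axis j 1) = - axis (Inr j) 1" for j :: 'n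
  proof -
    have "pt (axis j 1) (- 0) $ a = axis (Inl j) 1 $ a" "pt 0 (- axis j 1) $ a = (- axis (Inr j) 1) $ a" for a
      by (cases a; simp add: axis_def)+
    then show "pt (axis j 1) (- 0) = axis (Inl j) 1" "pt 0 (- axis j 1) = - axis (Inr j) 1"
      by (simp_all only: vec_eq_iff) simp_all
  qed
  have p: "gaussian_char (transpose A *v axis (Inl j) 1) S (K (\<rho> j))"
    "gaussian_char (transpose A' *v axis (Inl j) 1) S' (K' (\<rho> j))" for j
    using gaussian_channel_char[OF assms(1) assms(3)[of j]] gaussian_channel_char[OF assms(2) assms(3)[of j]]
    unfolding pt_axis S_def S'_def S0_def by simp_all
  have q: "gaussian_char (transpose A *v - axis (Inr j) 1) S (K (\<rho>' j))"
    "gaussian_char (transpose A' *v - axis (Inr j) 1) S' (K' (\<rho>' j))" for j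
    using gaussian_channel_char[OF assms(1) assms(4)[of j]] gaussian_channel_char[OF assms(2) assms(4)[of j]]
    unfolding pt_axis S_def S'_def S0_def by simp_all
  \<comment> \<open>For the first input the larger list of observables contains
    \<open>gates_a\<close>.\<close>
  have eq_a: "number_expectation (K (\<rho> j)) V = number_expectation (K' (\<rho> j)) V" if "V \<in> gates_a" for j V
    using assms(6)[of V] assms(7)[of j V] that by (cases "j = Min UNIV") auto
  have Inl: "transpose A *v axis (Inl j) 1 = transpose A' *v axis (Inl j) 1" for j
    by (rule gates_a_determine(1)[OF p eq_a])
  have Inr: "transpose A *v - axis (Inr j) 1 = transpose A' *v - axis (Inr j) 1" for j
    by (rule gates_a_determine(1)[OF q assms(8)])
  have "transpose A *v axis a 1 = transpose A' *v axis a 1" for a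
  proof (cases a)
    case (Inl j)
    then show ?thesis using \<open>\<And>j. transpose A *v axis (Inl j) 1 = transpose A' *v axis (Inl j) 1\<close> by simp
  next
    case (Inr j)
    have "transpose A *v (- 1) *\<^sub>R axis (Inr j) 1 = transpose A' *v (- 1) *\<^sub>R axis (Inr j) 1"
      using \<open>\<And>j. transpose A *v - axis (Inr j) 1 = transpose A' *v - axis (Inr j) 1\<close>[of j] by simp
    then show ?thesis unfolding matrix_vector_mult_scaleR Inr by simp
  qed
  then have A: "A = A'"
    unfolding matrix_vector_mult_basis by (simp add: vec_eq_iff column_def transpose_def)
  have "trace S = trace S'"
    by (rule gates_a_determine(2)[OF p eq_a])
  moreover have "transpose S = S" "transpose S' = S'"
  proof -
    have B: "transpose B = B" "transpose B' = B'"
      using assms(1,2) by (auto simp: gaussian_channel_def psd_def)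
    have S0: "transpose S0 = S0" unfolding S0_def by (simp add: transpose_scalar transpose_mat)
    have tr_add: "transpose (X + (1 / 2) *\<^sub>R Y) = transpose X + (1 / 2) *\<^sub>R transpose Y"
      for X Y :: "real ^ ('n + 'n) ^ ('n + 'n)"
      by (simp add: transpose_def vec_eq_iff)
    show "transpose S = S" "transpose S' = S'"
      unfolding S_def S'_def tr_add B by (simp_all add: matrix_transpose_mul S0 matrix_mul_assoc)
  qed
  \<comment> \<open>Folding with \<open>Inl\<close> gives both outputs literally the same mean
    vector, as \<open>covariance_determined\<close> requires.\<close>
  ultimately have "S = S'"
    using covariance_determined[OF p(1)[of "Min UNIV"] p(2)[of "Min UNIV", folded Inl], of \<Gamma>] assms(5,6)
    by blast
  \<comment> \<open>With \<open>A = A'\<close> the first summands of the two covariances coincide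
    and cancel.\<close>
  then have "B = B'" unfolding S_def S'_def A by simp
  with A show ?thesis by simp
qed

end
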